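(* Let $T>0$ and let $\psi=\psi(x,t)$ be a bounded energy solution of the Schrödinger equation $i\psi_t=-\frac12\Delta\psi+V(x)\psi$ on $[0,T]$, with $\psi(\cdot,t)$ continuous in $x\in\mathbb{R}^d$ for $t=0$ and $t=T$. Let $\varrho=|\psi|^2$ and $J=\mathrm{Im}(\bar\psi\nabla\psi)$. Let $N_0$ be the number of connected components of $D_0:=\{x\in\mathbb{R}^d:\varrho(x,0)\neq0\}$ and $N_T$ the number of connected components of $D_T:=\{x\in\mathbb{R}^d:\varrho(x,T)\neq0\}$, and assume $N_T<N_0\le\infty$. Furthermore, assume that all the connected components of $D_0$ are of locally finite perimeter. Then there is non-uniqueness of Schrödinger-generated bounded energy solutions of the QHD system on $[0,T]$ with initial data $\varrho(\cdot,0)$, $J(\cdot,0)$; that is, there exists a bounded energy solution $\varphi$ of the same Schrödinger equation on $[0,T]$ such that $|\varphi(\cdot,0)|^2=\varrho(\cdot,0)$ and $\mathrm{Im}(\bar\varphi\nabla\varphi)(\cdot,0)=J(\cdot,0)$ a.e. on $\mathbb{R}^d$, but $(|\varphi|^2,\mathrm{Im}(\bar\varphi\nabla\varphi))$ and $(\varrho,J)$ do not coincide on $[0,T]$ (i.e. they differ as pairs of functions of $x$, on a set of positive measure, for some $t\in[0,T]$).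
   Context: Standing assumption: the real potential $V$ is in $C^{1,1}_{loc}(\mathbb{R}^d)$ and bounded from below, and such that $H:=-\frac12\Delta+V$ is essentially self-adjoint on $L^2(\mathbb{R}^d)$. A bounded energy solution of the Schrödinger equation is $\psi\in C(\mathbb{R}_t;L^2(\mathbb{R}^d_x))$ given by the unitary evolution generated by (the closure of) $H$ from a datum $\psi_0\in L^2(\mathbb{R}^d)$ with finite energy, where the energy $E(t)=\frac12\int_{\mathbb{R}^d}|\nabla\psi(x,t)|^2dx+\int_{\mathbb{R}^d}V(x)|\psi(x,t)|^2dx$ is finite at $t=0$ (and is then constant in time, so that $\psi\in L^\infty(\mathbb{R}_t;H^1(\mathbb{R}^d_x))$). The Quantum Hydrodynamic (QHD) system is $$\varrho_t+\mathrm{div}J=0,\qquad J_t+\mathrm{div}\Big[\frac{J\otimes J}{\varrho}\Big]+\varrho\nabla V-\frac12\varrho\nabla\Big(\frac{\Delta\sqrt\varrho}{\sqrt\varrho}\Big)=0,\qquad x\in\mathbb{R}^d,$$ understood in the sense of distributions. A Schrödinger-generated bounded energy solution of the QHD system is a pair $(\varrho,J)=(|\psi|^2,\mathrm{Im}(\bar\psi\nabla\psi))$ for some bounded energy solution $\psi$ of the Schrödinger equation (such a pair is known to satisfy the QHD system in the sense of distributions). *)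

theory Defs
  imports "HOL-Analysis.Analysis" "HOL-Library.Extended_Nat"
begin

section \<open>Differentiable functions on Euclidean space\<close>

definition partial_deriv :: "'n::finite \<Rightarrow> (real^'n \<Rightarrow> 'b::real_normed_vector) \<Rightarrow> real^'n \<Rightarrow> 'b" where
  "partial_deriv i f x = frechet_derivative f (at x) (axis i 1)"

primrec C_k :: "nat \<Rightarrow> (real^'n::finite \<Rightarrow> 'b::real_normed_vector) \<Rightarrow> bool" where
  "C_k 0 f \<longleftrightarrow> continuous_on UNIV f"
| "C_k (Suc k) f \<longleftrightarrow> (\<forall>x. f differentiable (at x)) \<and> (\<forall>i. C_k k (partial_deriv i f))"

definition compactly_supported_in :: "(real^'n::finite) set \<Rightarrow> (real^'n \<Rightarrow> 'b::zero) \<Rightarrow> bool" where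
  "compactly_supported_in \<Omega> f \<longleftrightarrow> compact (closure {x. f x \<noteq> 0}) \<and> closure {x. f x \<noteq> 0} \<subseteq> \<Omega>"

definition test_functions :: "(real^'n::finite \<Rightarrow> complex) set" where
  "test_functions = {u. (\<forall>k. C_k k u) \<and> compactly_supported_in UNIV u}"

definition laplacian :: "(real^'n::finite \<Rightarrow> 'b::real_normed_vector) \<Rightarrow> real^'n \<Rightarrow> 'b" where
  "laplacian f x = (\<Sum>i\<in>UNIV. partial_deriv i (partial_deriv i f) x)"

definition divergence :: "(real^'n::finite \<Rightarrow> real^'n) \<Rightarrow> real^'n \<Rightarrow> real" where
  "divergence F x = (\<Sum>i\<in>UNIV. partial_deriv i F x $ i)"

definition C11_loc :: "(real^'n::finite \<Rightarrow> real) \<Rightarrow> bool" where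
  "C11_loc V \<longleftrightarrow> (\<exists>G. (\<forall>x. GDERIV V x :> G x) \<and> (\<forall>K. compact K \<longrightarrow> (\<exists>L. L-lipschitz_on K G)))"

section \<open>The Hilbert space of square-integrable functions\<close>

text \<open>Elements of \<open>L\<^sup>2\<close> are represented by Borel functions; equality in \<open>L\<^sup>2\<close> is equality almost
  everywhere. The inner product is linear in the first argument.\<close>

definition L2 :: "(real^'n::finite \<Rightarrow> complex) set" where
  "L2 = {f. f \<in> borel_measurable lborel \<and> integrable lborel (\<lambda>x. (cmod (f x))\<^sup>2)}"

definition L2_inner :: "(real^'n::finite \<Rightarrow> complex) \<Rightarrow> (real^'n \<Rightarrow> complex) \<Rightarrow> complex" where
  "L2_inner f g = (LINT x|lborel. f x * cnj (g x))"

definition L2_norm :: "(real^'n::finite \<Rightarrow> complex) \<Rightarrow> real" where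
  "L2_norm f = sqrt (LINT x|lborel. (cmod (f x))\<^sup>2)"

section \<open>Unbounded operators, given by their graphs\<close>

type_synonym 'n L2_operator = "((real^'n \<Rightarrow> complex) \<times> (real^'n \<Rightarrow> complex)) set"

definition op_closure :: "'n::finite L2_operator \<Rightarrow> 'n L2_operator" where
  "op_closure A = {(f, g). f \<in> L2 \<and> g \<in> L2 \<and>
     (\<exists>u v. (\<forall>k. (u k, v k) \<in> A) \<and>
        (\<lambda>k::nat. L2_norm (\<lambda>x. u k x - f x)) \<longlonglongrightarrow> 0 \<and>
        (\<lambda>k. L2_norm (\<lambda>x. v k x - g x)) \<longlonglongrightarrow> 0)}"

definition op_adjoint :: "'n::finite L2_operator \<Rightarrow> 'n L2_operator" where
  "op_adjoint A = {(f, g). f \<in> L2 \<and> g \<in> L2 \<and> (\<forall>(u, v)\<in>A. L2_inner v f = L2_inner u g)}"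

definition densely_defined :: "'n::finite L2_operator \<Rightarrow> bool" where
  "densely_defined A \<longleftrightarrow> Domain A \<subseteq> L2 \<and>
     (\<forall>f\<in>L2. \<forall>\<epsilon>>0. \<exists>u\<in>Domain A. L2_norm (\<lambda>x. u x - f x) < \<epsilon>)"

definition self_adjoint :: "'n::finite L2_operator \<Rightarrow> bool" where
  "self_adjoint A \<longleftrightarrow> densely_defined A \<and> op_adjoint A = A"

definition essentially_self_adjoint :: "'n::finite L2_operator \<Rightarrow> bool" where
  "essentially_self_adjoint A \<longleftrightarrow> densely_defined A \<and> self_adjoint (op_closure A)"

definition hamiltonian :: "(real^'n::finite \<Rightarrow> real) \<Rightarrow> 'n L2_operator" where
  "hamiltonian V = (\<lambda>u. (u, \<lambda>x. - (1/2) * laplacian u x + of_real (V x) * u x)) ` test_functions"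

section \<open>Unitary evolution\<close>

text \<open>Compatibility with equality almost everywhere follows from linearity and isometry,
  surjectivity from the group law.\<close>

definition unitary_group :: "(real \<Rightarrow> (real^'n::finite \<Rightarrow> complex) \<Rightarrow> (real^'n \<Rightarrow> complex)) \<Rightarrow> bool" where
  "unitary_group U \<longleftrightarrow>
     (\<forall>t. \<forall>f\<in>L2. U t f \<in> L2) \<and>
     (\<forall>t. \<forall>f\<in>L2. \<forall>g\<in>L2. \<forall>a b.
        AE x in lborel. U t (\<lambda>y. a * f y + b * g y) x = a * U t f x + b * U t g x) \<and>
     (\<forall>t. \<forall>f\<in>L2. \<forall>g\<in>L2. L2_inner (U t f) (U t g) = L2_inner f g) \<and>
     (\<forall>f\<in>L2. AE x in lborel. U 0 f x = f x) \<and>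
     (\<forall>s t. \<forall>f\<in>L2. AE x in lborel. U (s + t) f x = U s (U t f) x) \<and>
     (\<forall>f\<in>L2. ((\<lambda>t. L2_norm (\<lambda>x. U t f x - f x)) \<longlongrightarrow> 0) (at 0))"

text \<open>\<open>U t = exp (- \<i> t A)\<close> in the sense of Stone's theorem: the domain of \<open>A\<close> consists exactly of
  those \<open>f\<close> for which \<open>U t f\<close> is differentiable at \<open>t = 0\<close>, and the derivative is \<open>- \<i> A f\<close>.\<close>

definition generated_by ::
  "(real \<Rightarrow> (real^'n::finite \<Rightarrow> complex) \<Rightarrow> (real^'n \<Rightarrow> complex)) \<Rightarrow> 'n L2_operator \<Rightarrow> bool" where
  "generated_by U A \<longleftrightarrow>
     (\<forall>f g. (f, g) \<in> A \<longleftrightarrow> f \<in> L2 \<and> g \<in> L2 \<and>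
        ((\<lambda>h. L2_norm (\<lambda>x. (U h f x - f x) / of_real h - (- \<i> * g x))) \<longlongrightarrow> 0) (at 0))"

section \<open>Bounded energy solutions and their hydrodynamic quantities\<close>

definition locally_integrable :: "(real^'n::finite \<Rightarrow> complex) \<Rightarrow> bool" where
  "locally_integrable f \<longleftrightarrow> (\<forall>K. compact K \<longrightarrow> set_integrable lborel K f)"

definition has_weak_gradient :: "(real^'n::finite \<Rightarrow> complex) \<Rightarrow> (real^'n \<Rightarrow> complex^'n) \<Rightarrow> bool" where
  "has_weak_gradient f G \<longleftrightarrow> locally_integrable f \<and> (\<forall>i. locally_integrable (\<lambda>x. G x $ i)) \<and>
     (\<forall>\<eta>\<in>test_functions. \<forall>i.
        (LINT x|lborel. f x * partial_deriv i \<eta> x) = - (LINT x|lborel. G x $ i * \<eta> x))"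

text \<open>A weak gradient is unique up to null sets, so the choice only selects a representative.\<close>

definition weak_gradient :: "(real^'n::finite \<Rightarrow> complex) \<Rightarrow> real^'n \<Rightarrow> complex^'n" where
  "weak_gradient f = (SOME G. has_weak_gradient f G)"

text \<open>Finiteness of \<open>1/2 \<integral> |\<nabla>f|\<^sup>2 + \<integral> V |f|\<^sup>2\<close>; for \<open>V\<close> bounded from below and \<open>f \<in> L\<^sup>2\<close> the negative
  part of the potential energy is finite, so both terms have to be finite.\<close>

definition finite_energy :: "(real^'n::finite \<Rightarrow> real) \<Rightarrow> (real^'n \<Rightarrow> complex) \<Rightarrow> bool" where
  "finite_energy V f \<longleftrightarrow> f \<in> L2 \<and>
     (\<exists>G. has_weak_gradient f G \<and> (\<forall>i. (\<lambda>x. G x $ i) \<in> L2)) \<and>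
     integrable lborel (\<lambda>x. V x * (cmod (f x))\<^sup>2)"

text \<open>Finite energy is required of the datum \<open>\<psi> 0\<close> only; its conservation is a theorem. The values
  \<open>\<psi> t\<close> are arbitrary representatives of the \<open>L\<^sup>2\<close> classes.\<close>

definition bounded_energy_solution ::
  "(real^'n::finite \<Rightarrow> real) \<Rightarrow> real \<Rightarrow> (real \<Rightarrow> real^'n \<Rightarrow> complex) \<Rightarrow> bool" where
  "bounded_energy_solution V T \<psi> \<longleftrightarrow> finite_energy V (\<psi> 0) \<and>
     (\<exists>U. unitary_group U \<and> generated_by U (op_closure (hamiltonian V)) \<and>
        (\<forall>t\<in>{0..T}. \<psi> t \<in> L2 \<and> (AE x in lborel. \<psi> t x = U t (\<psi> 0) x)))"

definition mass_density :: "(real^'n::finite \<Rightarrow> complex) \<Rightarrow> real^'n \<Rightarrow> real" where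
  "mass_density f x = (cmod (f x))\<^sup>2"

definition current_density :: "(real^'n::finite \<Rightarrow> complex) \<Rightarrow> real^'n \<Rightarrow> real^'n" where
  "current_density f x = (\<chi> i. Im (cnj (f x) * weak_gradient f x $ i))"

section \<open>Perimeter and connected components\<close>

definition perimeter :: "(real^'n::finite) set \<Rightarrow> (real^'n) set \<Rightarrow> ereal" where
  "perimeter E \<Omega> = (SUP F \<in> {F. C_k 1 F \<and> compactly_supported_in \<Omega> F \<and> (\<forall>x. norm (F x) \<le> 1)}.
     ereal (LINT x:E|lborel. divergence F x))"

definition locally_finite_perimeter :: "(real^'n::finite) set \<Rightarrow> bool" where
  "locally_finite_perimeter E \<longleftrightarrow> E \<in> sets lborel \<and>
     (\<forall>\<Omega>. open \<Omega> \<and> bounded \<Omega> \<longrightarrow> perimeter E \<Omega> < \<infinity>)"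

definition num_components :: "'a::topological_space set \<Rightarrow> enat" where
  "num_components S = (if finite (components S) then enat (card (components S)) else \<infinity>)"

end

theory Submission
  imports Defs
begin

text \<open>
  Reverse the sign of the initial datum \<open>\<psi> 0\<close> on one connected component \<open>C\<close> of its support. Since \<open>\<psi> 0\<close>
  is continuous and vanishes on the boundary of \<open>C\<close>, this changes neither the Sobolev regularity nor the initial
  density and current. Suppose that the density and the current at time \<open>T\<close> are unchanged as well.
  They determine a function of finite Dirichlet energy up to a constant phase on each component of its support,
  so the new solution at time \<open>T\<close> is a constant multiple of \<open>\<psi> T\<close> on each of the \<open>N\<^sub>T\<close> components of the support
  of \<open>\<psi> T\<close>, and by linearity so is the evolution of \<open>1\<^sub>C \<psi> 0\<close>. For \<open>N\<^sub>T + 1\<close> different components \<open>C\<close> these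
  evolutions are thus linearly dependent, but the functions \<open>1\<^sub>C \<psi> 0\<close> are not, and the evolution is isometric.

  That solutions have finite Dirichlet energy at time \<open>T\<close> comes from essential self-adjointness: a
  finite energy datum is the limit of test functions of bounded energy, namely of approximate
  resolvents \<open>(1 + \<epsilon> (H + c))\<inverse> f\<close>, and the energy of an evolved test function is conserved.
\<close>

section \<open>Square-integrable functions\<close>

text \<open>Two steps hide the work. At time 0, weak differentiability of
  \<open>indicator C x * f x\<close> rests on \<open>f\<close> tending to 0 at the boundary of
  \<open>C\<close>. Truncating away the values with squared modulus at most \<open>\<delta>\<close>
  leaves two disjoint closed sets, one inside and one outside \<open>C\<close>; on the compact
  support of a test function a smooth cutoff separating them can stand in for the indicator, and
  then \<open>\<delta>\<close> tends to 0. At time \<open>T\<close>, the phase is a quotient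
  \<open>g / f\<close> with \<open>f\<close> vanishing somewhere; it is regularised to
  \<open>g * cnj f / (|f|^2 + \<epsilon>)\<close>, whose weak gradient tends to 0 inside a
  component. Both steps are chain rules with nonlinear coefficients. They are proved for test
  functions and carried over by limits, which is why \<open>H1\<close> is a closure of test
  functions; membership in it, at time 0 as well as at time \<open>T\<close>, comes from the
  evolution. Constancy of a function with vanishing weak gradient is obtained by comparing it with
  its translates and applying Fubini. The count at the end is linear algebra: each evolved piece is
  described by one coefficient per component of the support of \<open>g\<close>, so one more piece
  than there are components forces a dependence.\<close>

lemma L2_measurable: "f \<in> L2 \<Longrightarrow> f \<in> borel_measurable lborel"
  by (simp add: L2_def)

lemma L2_integrable: "f \<in> L2 \<Longrightarrow> integrable lborel (\<lambda>x. (cmod (f x))\<^sup>2)"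
  by (simp add: L2_def)

lemma L2_bound:
  assumes "g \<in> borel_measurable lborel" "integrable lborel w"
    and "AE x in lborel. (cmod (g x))\<^sup>2 \<le> w x"
  shows "g \<in> L2"
proof -
  have [measurable]: "g \<in> borel_measurable lborel" by fact
  have "integrable lborel (\<lambda>x. (cmod (g x))\<^sup>2)"
    by (rule Bochner_Integration.integrable_bound[OF assms(2)]) (use assms(3) in auto)
  then show ?thesis by (simp add: L2_def assms(1))
qed

lemma L2_cnj [simp]: "(\<lambda>x. cnj (f x)) \<in> L2 \<longleftrightarrow> f \<in> L2"
proof -
  have "f \<in> borel_measurable lborel" if "(\<lambda>x. cnj (f x)) \<in> borel_measurable lborel"
    using borel_measurable_continuous_onI[of cnj] measurable_compose[OF that, of cnj borel]
    by (simp add: continuous_on_cnj)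
  moreover have "(\<lambda>x. cnj (f x)) \<in> borel_measurable lborel" if "f \<in> borel_measurable lborel"
    using borel_measurable_continuous_onI[of cnj] measurable_compose[OF that, of cnj borel]
    by (simp add: continuous_on_cnj)
  ultimately have "(\<lambda>x. cnj (f x)) \<in> borel_measurable lborel \<longleftrightarrow> f \<in> borel_measurable lborel"
    by blast
  then show ?thesis by (simp add: L2_def)
qed

lemma L2_cmult: "f \<in> L2 \<Longrightarrow> (\<lambda>x. c * f x) \<in> L2"
  by (auto simp: L2_def norm_mult power_mult_distrib)

lemma L2_zero [simp]: "(\<lambda>x. 0) \<in> L2"
  by (simp add: L2_def)

lemma norm_add_sq_le: "(cmod (a + b))\<^sup>2 \<le> 2 * (cmod a)\<^sup>2 + 2 * (cmod b)\<^sup>2"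
proof -
  have "(cmod (a + b))\<^sup>2 \<le> (cmod a + cmod b)\<^sup>2"
    by (simp add: norm_triangle_ineq power_mono)
  also have "\<dots> \<le> 2 * (cmod a)\<^sup>2 + 2 * (cmod b)\<^sup>2"
    using sum_squares_bound[of "cmod a" "cmod b"] by (simp add: power2_sum)
  finally show ?thesis .
qed

lemma L2_add:
  assumes "f \<in> L2" "g \<in> L2" shows "(\<lambda>x. f x + g x) \<in> L2"
proof (rule L2_bound)
  have [measurable]: "f \<in> borel_measurable lborel" "g \<in> borel_measurable lborel"
    using assms by (auto simp: L2_def)
  show "(\<lambda>x. f x + g x) \<in> borel_measurable lborel" by measurable
  show "integrable lborel (\<lambda>x. 2 * (cmod (f x))\<^sup>2 + 2 * (cmod (g x))\<^sup>2)"
    using assms by (auto simp: L2_def)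
qed (simp add: norm_add_sq_le)

lemma L2_uminus: "f \<in> L2 \<Longrightarrow> (\<lambda>x. - f x) \<in> L2"
  by (simp add: L2_def)

lemma L2_diff: "f \<in> L2 \<Longrightarrow> g \<in> L2 \<Longrightarrow> (\<lambda>x. f x - g x) \<in> L2"
  using L2_add[OF _ L2_uminus] by fastforce

lemma L2_sum: "(\<And>i. i \<in> I \<Longrightarrow> f i \<in> L2) \<Longrightarrow> (\<lambda>x. \<Sum>i\<in>I. f i x) \<in> L2"
  by (induction I rule: infinite_finite_induct) (auto intro: L2_add)

lemma L2_AE_cong:
  assumes "f \<in> L2" "g \<in> borel_measurable lborel" "AE x in lborel. f x = g x"
  shows "g \<in> L2"
proof (rule L2_bound[OF assms(2) L2_integrable[OF assms(1)]])
  show "AE x in lborel. (cmod (g x))\<^sup>2 \<le> (cmod (f x))\<^sup>2" using assms(3) by auto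
qed

lemma L2_mult_bounded:
  assumes "f \<in> L2" and [measurable]: "c \<in> borel_measurable lborel" and "\<And>x. cmod (c x) \<le> M"
  shows "(\<lambda>x. c x * f x) \<in> L2"
proof (rule L2_bound)
  have [measurable]: "f \<in> borel_measurable lborel" using assms by (auto simp: L2_def)
  show "(\<lambda>x. c x * f x) \<in> borel_measurable lborel" by measurable
  show "integrable lborel (\<lambda>x. M\<^sup>2 * (cmod (f x))\<^sup>2)" using assms(1) by (auto simp: L2_def)
  show "AE x in lborel. (cmod (c x * f x))\<^sup>2 \<le> M\<^sup>2 * (cmod (f x))\<^sup>2"
    using assms(3) by (auto simp: norm_mult power_mult_distrib intro!: mult_right_mono power_mono)
qed

lemma L2_mult_integrable:
  assumes "f \<in> L2" "g \<in> L2"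
  shows "integrable lborel (\<lambda>x. f x * g x)"
proof (rule Bochner_Integration.integrable_bound)
  have [measurable]: "f \<in> borel_measurable lborel" "g \<in> borel_measurable lborel"
    using assms by (auto simp: L2_def)
  show "(\<lambda>x. f x * g x) \<in> borel_measurable lborel" by measurable
  show "integrable lborel (\<lambda>x. (cmod (f x))\<^sup>2 + (cmod (g x))\<^sup>2)"
    using assms by (auto simp: L2_def)
  show "AE x in lborel. cmod (f x * g x) \<le> norm ((cmod (f x))\<^sup>2 + (cmod (g x))\<^sup>2)"
  proof (rule AE_I2)
    fix x
    have "2 * cmod (f x) * cmod (g x) \<le> (cmod (f x))\<^sup>2 + (cmod (g x))\<^sup>2"
      by (rule sum_squares_bound)
    moreover have "0 \<le> cmod (f x) * cmod (g x)" by simp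
    ultimately have "cmod (f x) * cmod (g x) \<le> (cmod (f x))\<^sup>2 + (cmod (g x))\<^sup>2" by linarith
    then show "cmod (f x * g x) \<le> norm ((cmod (f x))\<^sup>2 + (cmod (g x))\<^sup>2)"
      by (simp add: norm_mult)
  qed
qed

section \<open>Inner product, norm and the Cauchy-Schwarz inequality\<close>

lemma L2_inner_integrable:
  "f \<in> L2 \<Longrightarrow> g \<in> L2 \<Longrightarrow> integrable lborel (\<lambda>x. f x * cnj (g x))"
  by (intro L2_mult_integrable) auto

lemma L2_norm_nonneg [simp]: "0 \<le> L2_norm f"
  by (simp add: L2_norm_def)

lemma L2_norm_sq: "(L2_norm f)\<^sup>2 = (LINT x|lborel. (cmod (f x))\<^sup>2)"
  by (simp add: L2_norm_def)

lemma L2_inner_self: "L2_inner f f = of_real ((L2_norm f)\<^sup>2)"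
  unfolding L2_inner_def L2_norm_sq
  by (subst integral_complex_of_real[symmetric]) (simp only: complex_norm_square)

lemma L2_inner_cnj: "cnj (L2_inner f g) = L2_inner g f"
  using Bochner_Integration.integral_cnj[of lborel "\<lambda>x. f x * cnj (g x)"] by (simp add: L2_inner_def mult.commute)

lemma L2_inner_add_left:
  "f \<in> L2 \<Longrightarrow> g \<in> L2 \<Longrightarrow> h \<in> L2 \<Longrightarrow>
    L2_inner (\<lambda>x. f x + g x) h = L2_inner f h + L2_inner g h"
  unfolding L2_inner_def by (simp add: distrib_right L2_inner_integrable)

lemma L2_inner_cmult_left: "L2_inner (\<lambda>x. c * f x) h = c * L2_inner f h"
  unfolding L2_inner_def by (simp add: mult.assoc)

lemma L2_inner_add_right:
  "f \<in> L2 \<Longrightarrow> g \<in> L2 \<Longrightarrow> h \<in> L2 \<Longrightarrow>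
    L2_inner h (\<lambda>x. f x + g x) = L2_inner h f + L2_inner h g"
  unfolding L2_inner_def by (simp add: distrib_left L2_inner_integrable)

lemma L2_inner_cmult_right: "L2_inner h (\<lambda>x. c * f x) = cnj c * L2_inner h f"
  unfolding L2_inner_def by (simp add: mult.left_commute)

lemma L2_norm_cmult: "L2_norm (\<lambda>x. c * f x) = cmod c * L2_norm f"
  by (simp add: L2_norm_def norm_mult power_mult_distrib real_sqrt_mult)

lemma L2_norm_minus_commute: "L2_norm (\<lambda>x. f x - g x) = L2_norm (\<lambda>x. g x - f x)"
  by (simp add: L2_norm_def norm_minus_commute)

lemma L2_norm_AE_cong:
  assumes "f \<in> borel_measurable lborel" "g \<in> borel_measurable lborel" "AE x in lborel. f x = g x"
  shows "L2_norm f = L2_norm g"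
proof -
  have [measurable]: "f \<in> borel_measurable lborel" "g \<in> borel_measurable lborel" by fact+
  show ?thesis unfolding L2_norm_def
    by (intro arg_cong[of _ _ sqrt] integral_cong_AE) (use assms(3) in auto)
qed

lemma L2_norm_zero_AE: "AE x in lborel. f x = 0" if "f \<in> L2" "L2_norm f = 0"
proof -
  have "(LINT x|lborel. (cmod (f x))\<^sup>2) = 0"
    using that(2) L2_norm_sq[of f] by simp
  then show ?thesis
    using integral_nonneg_eq_0_iff_AE[OF L2_integrable[OF that(1)]] by auto
qed

text \<open>A weighted form of Young's inequality, integrated; if one of the norms is 0, the
  function vanishes almost everywhere. The moduli stand inside the integral so that the estimate
  also serves for products with bounded coefficients.\<close>

lemma L2_Cauchy_Schwarz:
  assumes "f \<in> L2" "g \<in> L2"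
  shows "(LINT x|lborel. cmod (f x) * cmod (g x)) \<le> L2_norm f * L2_norm g"
proof -
  define a b where "a = L2_norm f" and "b = L2_norm g"
  have ab: "a \<ge> 0" "b \<ge> 0" by (auto simp: a_def b_def)
  have int: "integrable lborel (\<lambda>x. cmod (f x) * cmod (g x))"
    using integrable_norm[OF L2_mult_integrable[OF assms]] by (simp add: norm_mult)
  show ?thesis
  proof (cases "a = 0 \<or> b = 0")
    case True
    then have "(AE x in lborel. f x = 0) \<or> (AE x in lborel. g x = 0)"
      using L2_norm_zero_AE assms by (auto simp: a_def b_def)
    then have "AE x in lborel. cmod (f x) * cmod (g x) = 0"
      by (elim disjE) auto
    then have "(LINT x|lborel. cmod (f x) * cmod (g x)) = 0"
      by (rule integral_eq_zero_AE)
    then show ?thesis by simp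
  next
    case False
    then have pos: "a > 0" "b > 0" using ab by auto
    \<comment> \<open>With the weights \<open>b/a\<close> and \<open>a/b\<close> each of the two
      terms integrates to \<open>a * b / 2\<close>.\<close>
    have "cmod (f x) * cmod (g x) \<le> (b/a) / 2 * (cmod (f x))\<^sup>2 + (a/b) / 2 * (cmod (g x))\<^sup>2" for x
    proof -
      have "0 \<le> (b * cmod (f x) - a * cmod (g x))\<^sup>2" by simp
      then have "2 * (a * b) * (cmod (f x) * cmod (g x)) \<le> b\<^sup>2 * (cmod (f x))\<^sup>2 + a\<^sup>2 * (cmod (g x))\<^sup>2"
        by (simp add: power2_diff power_mult_distrib algebra_simps)
      then have "cmod (f x) * cmod (g x) \<le> (b\<^sup>2 * (cmod (f x))\<^sup>2 + a\<^sup>2 * (cmod (g x))\<^sup>2) / (2 * (a * b))"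
        using pos by (simp add: pos_le_divide_eq mult.commute)
      also have "\<dots> = (b/a) / 2 * (cmod (f x))\<^sup>2 + (a/b) / 2 * (cmod (g x))\<^sup>2"
        using pos by (simp add: field_simps power2_eq_square)
      finally show ?thesis .
    qed
    then have "(LINT x|lborel. cmod (f x) * cmod (g x))
      \<le> (LINT x|lborel. (b/a) / 2 * (cmod (f x))\<^sup>2 + (a/b) / 2 * (cmod (g x))\<^sup>2)"
      using assms by (intro integral_mono int) (auto simp: L2_def)
    also have "\<dots> = (b/a) / 2 * a\<^sup>2 + (a/b) / 2 * b\<^sup>2"
      using assms by (simp add: L2_integrable a_def b_def L2_norm_sq)
    also have "\<dots> = a * b" using pos by (simp add: power2_eq_square)
    finally show ?thesis by (simp add: a_def b_def)
  qed
qed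

lemma L2_inner_le:
  assumes "f \<in> L2" "g \<in> L2"
  shows "cmod (L2_inner f g) \<le> L2_norm f * L2_norm g"
proof -
  have "cmod (L2_inner f g) \<le> (LINT x|lborel. cmod (f x) * cmod (g x))"
    unfolding L2_inner_def using integral_norm_bound[of lborel "\<lambda>x. f x * cnj (g x)"]
    by (simp add: norm_mult)
  with L2_Cauchy_Schwarz[OF assms] show ?thesis by linarith
qed

lemma L2_norm_add_sq:
  assumes "f \<in> L2" "g \<in> L2"
  shows "(L2_norm (\<lambda>x. f x + g x))\<^sup>2 = (L2_norm f)\<^sup>2 + (L2_norm g)\<^sup>2 + 2 * Re (L2_inner f g)"
proof -
  have "of_real ((L2_norm (\<lambda>x. f x + g x))\<^sup>2) =
    of_real ((L2_norm f)\<^sup>2) + of_real ((L2_norm g)\<^sup>2) + (L2_inner f g + L2_inner g f)"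
    using assms by (simp only: L2_inner_self[symmetric])
      (simp add: L2_inner_add_left L2_inner_add_right L2_add)
  also have "L2_inner f g + L2_inner g f = of_real (2 * Re (L2_inner f g))"
    by (subst (2) L2_inner_cnj[symmetric]) (simp add: complex_eq_iff)
  finally show ?thesis
    by (simp only: of_real_add[symmetric] of_real_eq_iff)
qed

lemma L2_norm_triangle:
  assumes "f \<in> L2" "g \<in> L2"
  shows "L2_norm (\<lambda>x. f x + g x) \<le> L2_norm f + L2_norm g"
proof (rule power2_le_imp_le)
  have "Re (L2_inner f g) \<le> L2_norm f * L2_norm g"
    using L2_inner_le[OF assms] complex_Re_le_cmod[of "L2_inner f g"] by linarith
  then show "(L2_norm (\<lambda>x. f x + g x))\<^sup>2 \<le> (L2_norm f + L2_norm g)\<^sup>2"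
    by (simp add: L2_norm_add_sq assms power2_sum)
qed simp

lemma L2_norm_triangle_diff:
  assumes "f \<in> L2" "g \<in> L2" "h \<in> L2"
  shows "L2_norm (\<lambda>x. f x - h x) \<le> L2_norm (\<lambda>x. f x - g x) + L2_norm (\<lambda>x. g x - h x)"
  using L2_norm_triangle[of "\<lambda>x. f x - g x" "\<lambda>x. g x - h x"] assms by (simp add: L2_diff)

lemma L2_norm_diff_sq:
  assumes "f \<in> L2" "g \<in> L2"
  shows "(L2_norm (\<lambda>x. f x - g x))\<^sup>2 = (L2_norm f)\<^sup>2 + (L2_norm g)\<^sup>2 - 2 * Re (L2_inner f g)"
  using L2_norm_add_sq[OF assms(1) L2_cmult[OF assms(2), of "-1"]]
    L2_norm_cmult[of "-1" g] L2_inner_cmult_right[of f "-1" g] by simp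

lemma L2_parallelogram:
  assumes "f \<in> L2" "g \<in> L2"
  shows "(L2_norm (\<lambda>x. f x + g x))\<^sup>2 + (L2_norm (\<lambda>x. f x - g x))\<^sup>2
    = 2 * (L2_norm f)\<^sup>2 + 2 * (L2_norm g)\<^sup>2"
  by (simp add: L2_norm_add_sq L2_norm_diff_sq assms)

lemma L2_norm_mult_bounded:
  assumes "f \<in> L2" and [measurable]: "c \<in> borel_measurable lborel" and "\<And>x. cmod (c x) \<le> M"
  shows "L2_norm (\<lambda>x. c x * f x) \<le> M * L2_norm f"
proof -
  have M: "M \<ge> 0" using assms(3)[of undefined] norm_ge_zero order_trans by blast
  have "(L2_norm (\<lambda>x. c x * f x))\<^sup>2 \<le> (LINT x|lborel. M\<^sup>2 * (cmod (f x))\<^sup>2)"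
    unfolding L2_norm_sq
    using L2_integrable[OF L2_mult_bounded[OF assms(1-3)]] assms(1,3)
    by (intro integral_mono)
      (auto simp: L2_integrable norm_mult power_mult_distrib intro!: mult_right_mono power_mono)
  also have "\<dots> = (M * L2_norm f)\<^sup>2" using assms(1)
    by (simp add: power_mult_distrib L2_norm_sq)
  finally show ?thesis by (rule power2_le_imp_le) (use M in simp)
qed

text \<open>Membership in \<open>L2\<close> is part of the notion because the integral of a
  non-integrable function is 0, so a small \<open>L2_norm\<close> alone would say nothing.\<close>

definition L2_tendsto :: "(nat \<Rightarrow> real^'n::finite \<Rightarrow> complex) \<Rightarrow> (real^'n \<Rightarrow> complex) \<Rightarrow> bool" where
  "L2_tendsto u f \<longleftrightarrow> (\<forall>k. u k \<in> L2) \<and> f \<in> L2 \<and> (\<lambda>k. L2_norm (\<lambda>x. u k x - f x)) \<longlonglongrightarrow> 0"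

lemma L2_tendsto_const: "f \<in> L2 \<Longrightarrow> L2_tendsto (\<lambda>_. f) f"
  by (simp add: L2_tendsto_def L2_norm_def)

lemma L2_tendsto_subseq: "L2_tendsto u f \<Longrightarrow> strict_mono r \<Longrightarrow> L2_tendsto (\<lambda>k. u (r k)) f"
  unfolding L2_tendsto_def using LIMSEQ_subseq_LIMSEQ[of _ 0 r] by (auto simp: o_def)

lemma L2_tendsto_AE_cong:
  assumes "L2_tendsto u f" "g \<in> borel_measurable lborel" "AE x in lborel. f x = g x"
  shows "L2_tendsto u g"
proof -
  have "g \<in> L2" using assms L2_AE_cong by (auto simp: L2_tendsto_def)
  moreover have "L2_norm (\<lambda>x. u k x - f x) = L2_norm (\<lambda>x. u k x - g x)" for k
    using assms \<open>g \<in> L2\<close> by (intro L2_norm_AE_cong L2_measurable L2_diff) (auto simp: L2_tendsto_def)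
  ultimately show ?thesis using assms(1) by (simp add: L2_tendsto_def)
qed

lemma L2_tendsto_add:
  assumes "L2_tendsto u f" "L2_tendsto v g"
  shows "L2_tendsto (\<lambda>k x. u k x + v k x) (\<lambda>x. f x + g x)"
proof -
  have L: "u k \<in> L2" "v k \<in> L2" "f \<in> L2" "g \<in> L2" for k using assms by (auto simp: L2_tendsto_def)
  have "(\<lambda>k. L2_norm (\<lambda>x. u k x + v k x - (f x + g x))) \<longlonglongrightarrow> 0"
  proof (rule tendsto_sandwich[OF _ _ tendsto_const])
    show "\<forall>\<^sub>F k in sequentially. L2_norm (\<lambda>x. u k x + v k x - (f x + g x)) \<le>
        L2_norm (\<lambda>x. u k x - f x) + L2_norm (\<lambda>x. v k x - g x)"
      using L2_norm_triangle[OF L2_diff[OF L(1) L(3)] L2_diff[OF L(2) L(4)]]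
      by (intro always_eventually allI) (simp add: algebra_simps)
    show "(\<lambda>k. L2_norm (\<lambda>x. u k x - f x) + L2_norm (\<lambda>x. v k x - g x)) \<longlonglongrightarrow> 0"
      using tendsto_add[of _ 0 _ _ 0] assms by (auto simp: L2_tendsto_def)
  qed simp
  then show ?thesis by (simp add: L2_tendsto_def L L2_add)
qed

lemma L2_tendsto_cmult:
  assumes "L2_tendsto u f" shows "L2_tendsto (\<lambda>k x. c * u k x) (\<lambda>x. c * f x)"
proof -
  have "(\<lambda>k. cmod c * L2_norm (\<lambda>x. u k x - f x)) \<longlonglongrightarrow> cmod c * 0"
    using assms by (intro tendsto_intros) (auto simp: L2_tendsto_def)
  then show ?thesis using assms
    by (simp add: L2_tendsto_def L2_cmult right_diff_distrib[symmetric] L2_norm_cmult)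
qed

lemma L2_tendsto_cnj: "L2_tendsto u f \<Longrightarrow> L2_tendsto (\<lambda>k x. cnj (u k x)) (\<lambda>x. cnj (f x))"
  by (simp add: L2_tendsto_def L2_norm_def complex_cnj_diff[symmetric] del: complex_cnj_diff)

lemma L2_norm_tendsto:
  assumes "L2_tendsto u f" shows "(\<lambda>k. L2_norm (u k)) \<longlonglongrightarrow> L2_norm f"
proof -
  have L: "u k \<in> L2" "f \<in> L2" for k using assms by (auto simp: L2_tendsto_def)
  have bd: "\<bar>L2_norm (u k) - L2_norm f\<bar> \<le> L2_norm (\<lambda>x. u k x - f x)" for k
    using L2_norm_triangle_diff[OF L(1)[of k] L(2) L2_zero] L2_norm_triangle_diff[OF L(2) L(1)[of k] L2_zero]
      L2_norm_minus_commute[of "u k" f] by auto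
  have "(\<lambda>k. L2_norm (u k) - L2_norm f) \<longlonglongrightarrow> 0"
  proof (rule Lim_null_comparison[OF always_eventually])
    show "\<forall>k. norm (L2_norm (u k) - L2_norm f) \<le> L2_norm (\<lambda>x. u k x - f x)" using bd by simp
    show "(\<lambda>k. L2_norm (\<lambda>x. u k x - f x)) \<longlonglongrightarrow> 0" using assms by (simp add: L2_tendsto_def)
  qed
  then show ?thesis by (simp add: LIM_zero_iff)
qed

lemma L2_tendsto_AE_subseq:
  assumes "L2_tendsto u f"
  obtains r :: "nat \<Rightarrow> nat" where "strict_mono r" "AE x in lborel. (\<lambda>k. u (r k) x) \<longlonglongrightarrow> f x"
proof -
  have L: "(\<lambda>x. u k x - f x) \<in> L2" for k using assms by (auto simp: L2_tendsto_def L2_diff)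
  have "(\<lambda>k. (L2_norm (\<lambda>x. u k x - f x))\<^sup>2) \<longlonglongrightarrow> 0\<^sup>2"
    using assms by (intro tendsto_power) (auto simp: L2_tendsto_def)
  then have "(\<lambda>k. LINT x|lborel. norm ((cmod (u k x - f x))\<^sup>2)) \<longlonglongrightarrow> 0"
    by (simp add: L2_norm_sq)
  from tendsto_L1_AE_subseq[OF L2_integrable[OF L] this] obtain r where r: "strict_mono r"
    "AE x in lborel. (\<lambda>k. (cmod (u (r k) x - f x))\<^sup>2) \<longlonglongrightarrow> 0" by blast
  from r(2) have "AE x in lborel. (\<lambda>k. u (r k) x) \<longlonglongrightarrow> f x"
  proof eventually_elim
    case (elim x)
    then have "(\<lambda>k. sqrt ((cmod (u (r k) x - f x))\<^sup>2)) \<longlonglongrightarrow> sqrt 0"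
      by (intro tendsto_real_sqrt)
    then show ?case by (simp add: tendsto_norm_zero_iff LIM_zero_iff)
  qed
  with r(1) that show thesis by blast
qed

text \<open>The limit theorem behind all chain rules below: the factors \<open>a k\<close>,
  \<open>b k\<close> converge in norm, but a nonlinear coefficient \<open>c k\<close> of the
  approximants converges only almost everywhere and stays bounded. First the norm-convergent factors
  are exchanged with \<open>c k\<close> kept fixed, by Cauchy-Schwarz; then dominated convergence
  handles the coefficient.\<close>

lemma integral_L2_mult_tendsto:
  assumes "L2_tendsto a f" "L2_tendsto b g" "\<And>k. c k \<in> borel_measurable lborel"
    and "d \<in> borel_measurable lborel"
    and "\<And>k x. cmod (c k x) \<le> M" "AE x in lborel. (\<lambda>k. c k x) \<longlonglongrightarrow> d x"
  shows "(\<lambda>k. LINT x|lborel. c k x * a k x * b k x) \<longlonglongrightarrow> (LINT x|lborel. d x * f x * g x)"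
proof -
  have L: "a k \<in> L2" "f \<in> L2" "b k \<in> L2" "g \<in> L2" for k using assms by (auto simp: L2_tendsto_def)
  have m [measurable]: "c k \<in> borel_measurable lborel" "a k \<in> borel_measurable lborel"
    "b k \<in> borel_measurable lborel" "d \<in> borel_measurable lborel"
    "f \<in> borel_measurable lborel" "g \<in> borel_measurable lborel" for k
    using assms L by (auto simp: L2_def)
  have "M \<ge> 0" using assms(5)[of 0 undefined] norm_ge_zero order_trans by blast
  have i0: "integrable lborel (\<lambda>x. c k x * p x * q x)" if "p \<in> L2" "q \<in> L2" for k p q
    using L2_mult_integrable[OF L2_mult_bounded[OF that(1) m(1) assms(5)] that(2)] .
  define e where "e k = M * L2_norm (\<lambda>x. a k x - f x) * L2_norm (b k) + M * L2_norm f * L2_norm (\<lambda>x. b k x - g x)" for k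
  have "(\<lambda>k. (LINT x|lborel. c k x * a k x * b k x) - (LINT x|lborel. c k x * f x * g x)) \<longlonglongrightarrow> 0"
  proof (rule Lim_null_comparison[OF always_eventually])
    show "\<forall>k. norm ((LINT x|lborel. c k x * a k x * b k x) - (LINT x|lborel. c k x * f x * g x)) \<le> e k"
    proof
      fix k
      have D: "(\<lambda>x. a k x - f x) \<in> L2" "(\<lambda>x. b k x - g x) \<in> L2" using L by (auto intro: L2_diff)
      have n: "cmod (LINT x|lborel. c k x * p x * q x) \<le> M * L2_norm p * L2_norm q" if "p \<in> L2" "q \<in> L2" for p q
      proof -
        have "cmod (LINT x|lborel. c k x * p x * q x) \<le> (LINT x|lborel. cmod (c k x * p x) * cmod (q x))"
          using integral_norm_bound[of lborel "\<lambda>x. c k x * p x * q x"] by (simp add: norm_mult)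
        also have "\<dots> \<le> L2_norm (\<lambda>x. c k x * p x) * L2_norm q"
          by (rule L2_Cauchy_Schwarz[OF L2_mult_bounded[OF that(1) m(1) assms(5)] that(2)])
        also have "\<dots> \<le> M * L2_norm p * L2_norm q"
          using L2_norm_mult_bounded[OF that(1) m(1) assms(5)] by (intro mult_right_mono) auto
        finally show ?thesis .
      qed
      have "(LINT x|lborel. c k x * a k x * b k x) - (LINT x|lborel. c k x * f x * g x)
        = (LINT x|lborel. c k x * a k x * b k x - c k x * f x * g x)"
        using L i0 by (subst Bochner_Integration.integral_diff) auto
      also have "\<dots> = (LINT x|lborel. c k x * (a k x - f x) * b k x + c k x * f x * (b k x - g x))"
        by (intro Bochner_Integration.integral_cong) (auto simp: algebra_simps)
      also have "\<dots> = (LINT x|lborel. c k x * (a k x - f x) * b k x) + (LINT x|lborel. c k x * f x * (b k x - g x))"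
        using L D by (intro Bochner_Integration.integral_add i0) auto
      finally have "norm ((LINT x|lborel. c k x * a k x * b k x) - (LINT x|lborel. c k x * f x * g x))
         \<le> cmod (LINT x|lborel. c k x * (a k x - f x) * b k x) + cmod (LINT x|lborel. c k x * f x * (b k x - g x))"
        by (simp add: norm_triangle_ineq)
      also have "\<dots> \<le> e k" unfolding e_def by (intro add_mono n L D)
      finally show "norm ((LINT x|lborel. c k x * a k x * b k x) - (LINT x|lborel. c k x * f x * g x)) \<le> e k" .
    qed
    have "e \<longlonglongrightarrow> M * 0 * L2_norm g + M * L2_norm f * 0"
      unfolding e_def using assms(1,2) L2_norm_tendsto[OF assms(2)]
      by (intro tendsto_intros) (auto simp: L2_tendsto_def)
    then show "e \<longlonglongrightarrow> 0" by simp
  qed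
  moreover have "(\<lambda>k. LINT x|lborel. c k x * f x * g x) \<longlonglongrightarrow> (LINT x|lborel. d x * f x * g x)"
  proof (rule integral_dominated_convergence[where w="\<lambda>x. M * cmod (f x * g x)"])
    show "integrable lborel (\<lambda>x. M * cmod (f x * g x))"
      using L2_mult_integrable[OF L(2,4)] by auto
    show "AE x in lborel. (\<lambda>k. c k x * f x * g x) \<longlonglongrightarrow> d x * f x * g x"
      using assms(6) by eventually_elim (intro tendsto_intros)
    show "AE x in lborel. cmod (c k x * f x * g x) \<le> M * cmod (f x * g x)" for k
      using assms(5)[of k] by (auto simp: norm_mult mult.assoc intro!: mult_right_mono)
  qed measurable
  ultimately show ?thesis by (rule Lim_transform[rotated])
qed

lemma L2_inner_tendsto:
  assumes "L2_tendsto a f" "L2_tendsto b g"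
  shows "(\<lambda>k. L2_inner (a k) (b k)) \<longlonglongrightarrow> L2_inner f g"
  using integral_L2_mult_tendsto[OF assms(1) L2_tendsto_cnj[OF assms(2)],
      of "\<lambda>_ _. 1" "\<lambda>_. 1" 1]
  unfolding L2_inner_def by simp

text \<open>Riesz-Fischer. A subsequence with rapidly decreasing increments converges almost
  everywhere, and Fatou's lemma identifies its pointwise limit as the norm limit.\<close>

lemma L2_complete:
  assumes "\<And>k. u k \<in> L2"
    and "\<And>e. e > 0 \<Longrightarrow> \<exists>N. \<forall>i\<ge>N. \<forall>j\<ge>N. L2_norm (\<lambda>x. u i x - u j x) < e"
  shows "\<exists>f. L2_tendsto u f"
proof -
  have "\<exists>r. \<forall>n. (\<forall>i\<ge>r n. \<forall>j\<ge>r n. L2_norm (\<lambda>x. u i x - u j x) < (1/4)^n) \<and> r n < r (Suc n)"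
  proof (intro dependent_nat_choice)
    show "\<exists>x. \<forall>i\<ge>x. \<forall>j\<ge>x. L2_norm (\<lambda>y. u i y - u j y) < (1/4)^0"
      using assms(2)[of 1] by simp
    fix x n
    obtain N where "\<forall>i\<ge>N. \<forall>j\<ge>N. L2_norm (\<lambda>x. u i x - u j x) < (1/4)^(Suc n)"
      using assms(2)[of "(1/4)^(Suc n)"] by auto
    then show "\<exists>y. (\<forall>i\<ge>y. \<forall>j\<ge>y. L2_norm (\<lambda>x. u i x - u j x) < (1/4)^(Suc n)) \<and> x < y"
      by (intro exI[of _ "max N (Suc x)"]) auto
  qed
  then obtain r where r: "\<And>n i j. i \<ge> r n \<Longrightarrow> j \<ge> r n \<Longrightarrow> L2_norm (\<lambda>x. u i x - u j x) < (1/4)^n"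
    and "\<And>n. r n < r (Suc n)" by blast
  then have sm: "strict_mono r" by (simp add: strict_mono_Suc_iff)
  define v where "v k = u (r k)" for k
  have vL: "v k \<in> L2" for k by (simp add: v_def assms)
  have [measurable]: "v k \<in> borel_measurable lborel" for k using vL by (simp add: L2_def)
  have dn: "L2_norm (\<lambda>x. v (Suc k) x - v k x) \<le> (1/4)^k" for k
    unfolding v_def by (rule less_imp_le, rule r) (simp_all add: sm strict_mono_less_eq)
  \<comment> \<open>The squared norms of the increments are at most \<open>(1/16)^k\<close>. The
    weight \<open>4^k\<close> keeps the series of integrals summable and still forces pointwise
    increments of order \<open>(1/2)^k\<close>.\<close>
  have sqb: "(LINT x|lborel. 4^k * (cmod (v (Suc k) x - v k x))\<^sup>2) \<le> (1/4)^k" for k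
  proof -
    have "(LINT x|lborel. 4^k * (cmod (v (Suc k) x - v k x))\<^sup>2) = 4^k * (L2_norm (\<lambda>x. v (Suc k) x - v k x))\<^sup>2"
      by (simp add: L2_norm_sq)
    also have "\<dots> \<le> 4^k * ((1/4)^k)\<^sup>2"
      by (intro mult_left_mono power_mono dn) auto
    also have "\<dots> = (1/4)^k" by (simp add: power2_eq_square power_divide)
    finally show ?thesis .
  qed
    have fin: "(\<integral>\<^sup>+x. (\<Sum>k. ennreal (4^k * (cmod (v (Suc k) x - v k x))\<^sup>2)) \<partial>lborel) < \<infinity>"
    proof -
      have "(\<integral>\<^sup>+x. (\<Sum>k. ennreal (4^k * (cmod (v (Suc k) x - v k x))\<^sup>2)) \<partial>lborel)
        = (\<Sum>k. (\<integral>\<^sup>+x. ennreal (4^k * (cmod (v (Suc k) x - v k x))\<^sup>2) \<partial>lborel))"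
        by (intro nn_integral_suminf) measurable
      also have "\<dots> = (\<Sum>k. ennreal (LINT x|lborel. 4^k * (cmod (v (Suc k) x - v k x))\<^sup>2))"
        using L2_integrable[OF L2_diff[OF vL vL]] by (intro suminf_cong nn_integral_eq_integral) auto
      also have "\<dots> \<le> (\<Sum>k. ennreal ((1/4)^k))"
        by (intro suminf_le ennreal_leI sqb) auto
      also have "\<dots> = ennreal (\<Sum>k. (1/4)^k)"
        by (intro suminf_ennreal2) (auto intro: summable_geometric)
      also have "\<dots> < \<infinity>" by simp
      finally show ?thesis .
    qed
  have "AE x in lborel. (\<Sum>k. ennreal (4^k * (cmod (v (Suc k) x - v k x))\<^sup>2)) \<noteq> \<infinity>"
  proof (rule nn_integral_PInf_AE)
    show "(\<lambda>x. \<Sum>k. ennreal (4^k * (cmod (v (Suc k) x - v k x))\<^sup>2)) \<in> borel_measurable lborel"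
      by measurable
  qed (use fin in simp)
  then have "AE x in lborel. summable (\<lambda>k. 4^k * (cmod (v (Suc k) x - v k x))\<^sup>2)"
  proof eventually_elim
    case (elim x)
    then show ?case by (intro summable_suminf_not_top) auto
  qed
  then have "AE x in lborel. convergent (\<lambda>k. v k x)"
  proof eventually_elim
    case (elim x)
    then have "(\<lambda>k. 4^k * (cmod (v (Suc k) x - v k x))\<^sup>2) \<longlonglongrightarrow> 0"
      by (rule summable_LIMSEQ_zero)
    then have "Bseq (\<lambda>k. 4^k * (cmod (v (Suc k) x - v k x))\<^sup>2)"
      by (intro convergent_imp_Bseq convergentI)
    then obtain B where B: "\<And>k. norm (4^k * (cmod (v (Suc k) x - v k x))\<^sup>2) \<le> B"
      unfolding Bseq_def by blast
    have "cmod (v (Suc k) x - v k x) \<le> sqrt B * (1/2)^k" for k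
    proof (rule power2_le_imp_le)
      have "4^k * (cmod (v (Suc k) x - v k x))\<^sup>2 \<le> B" using B[of k] by simp
      moreover have "B \<ge> 0" using B[of 0] norm_ge_zero order_trans by blast
      moreover have "((2::real)^k)\<^sup>2 = 4^k" by (simp add: power2_eq_square flip: power_mult_distrib)
      ultimately show "(cmod (v (Suc k) x - v k x))\<^sup>2 \<le> (sqrt B * (1/2)^k)\<^sup>2"
        by (simp add: power_mult_distrib power_divide field_simps)
      show "0 \<le> sqrt B * (1/2)^k" using \<open>B \<ge> 0\<close> by simp
    qed
    moreover have "summable (\<lambda>k. sqrt B * (1/2::real)^k)"
      by (rule summable_mult[OF summable_geometric]) simp
    ultimately have "summable (\<lambda>k. v (Suc k) x - v k x)"
      by (rule summable_comparison_test'[where N=0, rotated])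
    then have "convergent (\<lambda>n. v n x - v 0 x)"
      using sum_lessThan_telescope[of "\<lambda>k. v k x"] by (simp add: summable_iff_convergent)
    then show ?case using convergent_diff_const_right_iff[of "\<lambda>n. v n x" "v 0 x"] by simp
  qed
  then have lim: "AE x in lborel. (\<lambda>k. v k x) \<longlonglongrightarrow> lim (\<lambda>k. v k x)"
    by eventually_elim (simp add: convergent_LIMSEQ_iff)
  \<comment> \<open>On the null set of divergence \<open>lim\<close> is an unspecified value;
    \<open>f\<close> is measurable all the same.\<close>
  define f where "f x = lim (\<lambda>k. v k x)" for x
  have [measurable]: "f \<in> borel_measurable lborel" unfolding f_def by measurable
  \<comment> \<open>Fatou's lemma in the second index only: \<open>j\<close> ranges over the whole
    sequence, so the full sequence converges and not just the subsequence.\<close>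
  have key: "(\<integral>\<^sup>+x. ennreal ((cmod (u j x - f x))\<^sup>2) \<partial>lborel) \<le> ennreal (((1/4)^n)\<^sup>2)" if "j \<ge> r n" for j n
  proof -
    have [measurable]: "u j \<in> borel_measurable lborel" using assms by (auto simp: L2_def)
    have "(\<integral>\<^sup>+x. ennreal ((cmod (u j x - f x))\<^sup>2) \<partial>lborel)
      = (\<integral>\<^sup>+x. liminf (\<lambda>k. ennreal ((cmod (u j x - v k x))\<^sup>2)) \<partial>lborel)"
    proof (rule nn_integral_cong_AE)
      show "AE x in lborel. ennreal ((cmod (u j x - f x))\<^sup>2) = liminf (\<lambda>k. ennreal ((cmod (u j x - v k x))\<^sup>2))"
        using lim
      proof eventually_elim
        case (elim x)
        have "(\<lambda>k. ennreal ((cmod (u j x - v k x))\<^sup>2)) \<longlonglongrightarrow> ennreal ((cmod (u j x - f x))\<^sup>2)"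
          unfolding f_def by (intro tendsto_intros elim tendsto_ennrealI)
        from lim_imp_Liminf[OF sequentially_bot this] show ?case by (rule sym)
      qed
    qed
    also have "\<dots> \<le> liminf (\<lambda>k. \<integral>\<^sup>+x. ennreal ((cmod (u j x - v k x))\<^sup>2) \<partial>lborel)"
      by (intro nn_integral_liminf) measurable
    also have "\<dots> \<le> ennreal (((1/4)^n)\<^sup>2)"
    proof (rule Liminf_le)
      show "\<forall>\<^sub>F k in sequentially. (\<integral>\<^sup>+x. ennreal ((cmod (u j x - v k x))\<^sup>2) \<partial>lborel) \<le> ennreal (((1/4)^n)\<^sup>2)"
        using eventually_ge_at_top[of n]
      proof eventually_elim
        case (elim k)
        have "L2_norm (\<lambda>x. u j x - v k x) \<le> (1/4)^n"
          unfolding v_def using elim that by (intro less_imp_le[OF r]) (auto simp: sm strict_mono_less_eq intro: order_trans)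
        then have "(LINT x|lborel. (cmod (u j x - v k x))\<^sup>2) \<le> ((1/4)^n)\<^sup>2"
          unfolding L2_norm_sq[symmetric] by (intro power_mono) auto
        then show ?case
          by (subst nn_integral_eq_integral[OF L2_integrable[OF L2_diff[OF assms(1) vL]]])
             (auto intro: ennreal_leI)
      qed
    qed simp
    finally show ?thesis .
  qed
  have dL: "(\<lambda>x. u j x - f x) \<in> L2" if "j \<ge> r 0" for j
  proof -
    have [measurable]: "u j \<in> borel_measurable lborel" using assms by (auto simp: L2_def)
    have "integrable lborel (\<lambda>x. (cmod (u j x - f x))\<^sup>2)"
      using key[OF that] by (intro integrableI_bounded) (auto intro: le_less_trans)
    then show ?thesis by (auto simp: L2_def)
  qed
  have fL: "f \<in> L2" using L2_diff[OF assms(1)[of "r 0"] dL[OF order_refl]] by simp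
  have nb: "L2_norm (\<lambda>x. u j x - f x) \<le> (1/4)^n" if "j \<ge> r n" for j n
  proof (rule power2_le_imp_le)
    show "(L2_norm (\<lambda>x. u j x - f x))\<^sup>2 \<le> ((1/4)^n)\<^sup>2"
      using key[OF that] unfolding L2_norm_sq
      by (subst (asm) nn_integral_eq_integral[OF L2_integrable[OF L2_diff[OF assms(1) fL]]]) auto
  qed simp
  have "(\<lambda>k. L2_norm (\<lambda>x. u k x - f x)) \<longlonglongrightarrow> 0"
  proof (rule LIMSEQ_I)
    fix e :: real assume "e > 0"
    then obtain n where "(1/4)^n < e" using real_arch_pow_inv[of e "1/4"] by auto
    then show "\<exists>no. \<forall>k\<ge>no. norm (L2_norm (\<lambda>x. u k x - f x) - 0) < e"
      using nb[of n] by (intro exI[of _ "r n"]) (auto intro: le_less_trans)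
  qed
  then show ?thesis using assms(1) fL by (auto simp: L2_tendsto_def)
qed

section \<open>Smooth functions\<close>

lemma C_k_differentiable: "C_k (Suc k) f \<Longrightarrow> f differentiable (at x)"
  by simp

lemma C_k_partial: "C_k (Suc k) f \<Longrightarrow> C_k k (partial_deriv i f)"
  by simp

lemma C_k_continuous: "C_k k f \<Longrightarrow> continuous_on UNIV f"
  by (cases k) (auto intro!: continuous_at_imp_continuous_on differentiable_imp_continuous_within)

lemma C_k_Suc_D: "C_k (Suc k) f \<Longrightarrow> C_k k f"
proof (induction k arbitrary: f)
  case 0 then show ?case using C_k_continuous by fastforce
next
  case (Suc k)
  have "C_k k (partial_deriv i f)" for i
    by (rule Suc.IH) (rule C_k_partial[OF Suc.prems])
  moreover have "f differentiable (at x)" for x by (rule C_k_differentiable[OF Suc.prems])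
  ultimately show ?case by simp
qed

lemma partial_deriv_eq:
  "(f has_derivative D) (at x) \<Longrightarrow> partial_deriv i f x = D (axis i 1)"
  unfolding partial_deriv_def using frechet_derivative_at by metis

lemma has_derivative_partial:
  fixes f :: "real^'n::finite \<Rightarrow> 'b::real_normed_vector"
  assumes "f differentiable (at x)"
  shows "(f has_derivative (\<lambda>v. \<Sum>i\<in>UNIV. v $ i *\<^sub>R partial_deriv i f x)) (at x)"
proof -
  have D: "(f has_derivative frechet_derivative f (at x)) (at x)"
    using assms frechet_derivative_works by blast
  then have lin: "linear (frechet_derivative f (at x))" by (rule has_derivative_linear)
  have "frechet_derivative f (at x) v = (\<Sum>i\<in>UNIV. v $ i *\<^sub>R partial_deriv i f x)" for v
  proof -
    have "v = (\<Sum>i\<in>UNIV. v $ i *\<^sub>R axis i 1)"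
      using basis_expansion[of v] by (simp add: scalar_mult_eq_scaleR)
    then have "frechet_derivative f (at x) v = frechet_derivative f (at x) (\<Sum>i\<in>UNIV. v $ i *\<^sub>R axis i 1)"
      by simp
    also have "\<dots> = (\<Sum>i\<in>UNIV. v $ i *\<^sub>R partial_deriv i f x)"
      by (simp add: linear_sum[OF lin] linear_cmul[OF lin] partial_deriv_def)
    finally show ?thesis .
  qed
  then have "frechet_derivative f (at x) = (\<lambda>v. \<Sum>i\<in>UNIV. v $ i *\<^sub>R partial_deriv i f x)" by (rule ext)
  with D show ?thesis by simp
qed

lemma partial_deriv_const [simp]: "partial_deriv i (\<lambda>x. c) = (\<lambda>x. 0)"
  by (rule ext) (simp add: partial_deriv_eq[OF has_derivative_const])

lemma C_k_const [simp]: "C_k k (\<lambda>x. c)"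
  by (induction k arbitrary: c) auto

lemma partial_deriv_bounded_linear:
  assumes "bounded_linear L" "f differentiable (at x)"
  shows "partial_deriv i (\<lambda>x. L (f x)) x = L (partial_deriv i f x)"
proof -
  have "(f has_derivative frechet_derivative f (at x)) (at x)"
    using assms frechet_derivative_works by blast
  from bounded_linear.has_derivative[OF assms(1) this] show ?thesis
    by (subst partial_deriv_eq) (auto simp: partial_deriv_def)
qed

lemma C_k_bounded_linear:
  assumes "bounded_linear L" shows "C_k k f \<Longrightarrow> C_k k (\<lambda>x. L (f x))"
proof (induction k arbitrary: f)
  case 0
  then show ?case by (auto intro!: bounded_linear.continuous_on[OF assms])
next
  case (Suc k)
  have "partial_deriv i (\<lambda>x. L (f x)) = (\<lambda>x. L (partial_deriv i f x))" for i
    using Suc.prems by (intro ext partial_deriv_bounded_linear[OF assms]) simp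
  moreover have "(\<lambda>x. L (f x)) differentiable at x" for x
    using Suc.prems bounded_linear.has_derivative[OF assms] unfolding differentiable_def C_k.simps by blast
  ultimately show ?case using Suc by simp
qed

lemma partial_deriv_add:
  assumes "f differentiable (at x)" "g differentiable (at x)"
  shows "partial_deriv i (\<lambda>x. f x + g x) x = partial_deriv i f x + partial_deriv i g x"
  using assms partial_deriv_eq[OF has_derivative_add[of f "frechet_derivative f (at x)" "at x" g "frechet_derivative g (at x)"]]
  by (simp add: frechet_derivative_works partial_deriv_def)

lemma C_k_add: "C_k k f \<Longrightarrow> C_k k g \<Longrightarrow> C_k k (\<lambda>x. f x + g x)"
proof (induction k arbitrary: f g)
  case 0 then show ?case by (auto intro: continuous_on_add)
next
  case (Suc k)
  have "partial_deriv i (\<lambda>x. f x + g x) = (\<lambda>x. partial_deriv i f x + partial_deriv i g x)" for i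
    using Suc.prems by (intro ext partial_deriv_add) simp_all
  then show ?case using Suc by simp
qed

lemma partial_deriv_mult:
  fixes f g :: "real^'n::finite \<Rightarrow> 'b::real_normed_algebra"
  assumes "f differentiable (at x)" "g differentiable (at x)"
  shows "partial_deriv i (\<lambda>x. f x * g x) x = f x * partial_deriv i g x + partial_deriv i f x * g x"
  using assms partial_deriv_eq[OF has_derivative_mult[of f "frechet_derivative f (at x)" x UNIV g "frechet_derivative g (at x)"]]
  by (simp add: frechet_derivative_works partial_deriv_def)

lemma C_k_mult:
  fixes f g :: "real^'n::finite \<Rightarrow> 'b::real_normed_algebra"
  shows "C_k k f \<Longrightarrow> C_k k g \<Longrightarrow> C_k k (\<lambda>x. f x * g x)"
proof (induction k arbitrary: f g)
  case 0 then show ?case by (auto intro: continuous_on_mult)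
next
  case (Suc k)
  have "partial_deriv i (\<lambda>x. f x * g x) = (\<lambda>x. f x * partial_deriv i g x + partial_deriv i f x * g x)" for i
    using Suc.prems by (intro ext partial_deriv_mult) simp_all
  moreover have "C_k k f" "C_k k g" using Suc.prems C_k_Suc_D by blast+
  ultimately show ?case using Suc by (simp add: C_k_add)
qed

lemma C_k_prod:
  fixes f :: "'i \<Rightarrow> real^'n::finite \<Rightarrow> 'b::{real_normed_algebra_1, comm_monoid_mult}"
  shows "(\<And>i. i \<in> I \<Longrightarrow> C_k k (f i)) \<Longrightarrow> C_k k (\<lambda>x. \<Prod>i\<in>I. f i x)"
  by (induction I rule: infinite_finite_induct) (auto intro: C_k_mult)

lemma partial_deriv_compose_real:
  fixes f :: "real^'n::finite \<Rightarrow> real" and h :: "real \<Rightarrow> real"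
  assumes "f differentiable (at x)" "(h has_real_derivative h') (at (f x))"
  shows "partial_deriv i (\<lambda>x. h (f x)) x = h' * partial_deriv i f x"
    and "(\<lambda>x. h (f x)) differentiable (at x)"
proof -
  have "(f has_derivative frechet_derivative f (at x)) (at x)"
    using assms frechet_derivative_works by blast
  then have D: "((\<lambda>x. h (f x)) has_derivative (\<lambda>v. h' * frechet_derivative f (at x) v)) (at x)"
    using assms(2) has_derivative_compose[of f _ x UNIV h "(*) h'"] by (simp add: has_field_derivative_def)
  show "partial_deriv i (\<lambda>x. h (f x)) x = h' * partial_deriv i f x"
    using partial_deriv_eq[OF D] by (simp add: partial_deriv_def)
  show "(\<lambda>x. h (f x)) differentiable (at x)" using D differentiable_def by blast
qed

lemma C_k_inverse:
  fixes f :: "real^'n::finite \<Rightarrow> real"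
  assumes "\<And>x. f x \<noteq> 0"
  shows "C_k k f \<Longrightarrow> C_k k (\<lambda>x. inverse (f x))"
proof (induction k)
  case 0 then show ?case using assms by (auto intro: continuous_on_inverse)
next
  case (Suc k)
  have D: "((\<lambda>y. inverse y) has_real_derivative - (inverse (f x) * inverse (f x))) (at (f x))" for x
    using DERIV_inverse[OF assms, of x UNIV] by (simp add: power2_eq_square)
  have "partial_deriv i (\<lambda>x. inverse (f x)) = (\<lambda>x. (-1) * (inverse (f x) * inverse (f x)) * partial_deriv i f x)" for i
    using Suc.prems by (intro ext) (simp add: partial_deriv_compose_real(1)[where f=f and h=inverse, OF _ D])
  moreover have "C_k k (\<lambda>x. (-1) * (inverse (f x) * inverse (f x)) * partial_deriv i f x)" for i
    using Suc C_k_Suc_D by (intro C_k_mult C_k_const C_k_partial) blast+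
  moreover have "(\<lambda>x. inverse (f x)) differentiable (at x)" for x
    using Suc.prems by (intro partial_deriv_compose_real(2)[where f=f and h=inverse, OF _ D]) simp
  ultimately show ?case by (simp del: mult_minus1)
qed

definition smooth :: "(real^'n::finite \<Rightarrow> 'b::real_normed_vector) \<Rightarrow> bool" where
  "smooth f \<longleftrightarrow> (\<forall>k. C_k k f)"

lemma smooth_partial: "smooth f \<Longrightarrow> smooth (partial_deriv i f)"
  unfolding smooth_def using C_k_partial by blast

lemma smooth_differentiable: "smooth f \<Longrightarrow> f differentiable (at x)"
  unfolding smooth_def using C_k_differentiable by blast

lemma smooth_continuous: "smooth f \<Longrightarrow> continuous_on S f"
  unfolding smooth_def using C_k_continuous continuous_on_subset by blast

lemma smooth_measurable: "smooth f \<Longrightarrow> f \<in> borel_measurable lborel"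
  for f :: "real^'n::finite \<Rightarrow> 'b::real_normed_vector"
  using borel_measurable_continuous_onI[OF smooth_continuous] by simp

lemma smooth_const: "smooth (\<lambda>x. c)" by (simp add: smooth_def)
lemma smooth_add: "smooth f \<Longrightarrow> smooth g \<Longrightarrow> smooth (\<lambda>x. f x + g x)" by (simp add: smooth_def C_k_add)
lemma smooth_mult: "smooth f \<Longrightarrow> smooth g \<Longrightarrow> smooth (\<lambda>x. f x * g x)"
  for f g :: "real^'n::finite \<Rightarrow> 'b::real_normed_algebra" by (simp add: smooth_def C_k_mult)
lemma smooth_prod: "(\<And>i. i \<in> I \<Longrightarrow> smooth (f i)) \<Longrightarrow> smooth (\<lambda>x. \<Prod>i\<in>I. f i x)"
  for f :: "'i \<Rightarrow> real^'n::finite \<Rightarrow> 'b::{real_normed_algebra_1, comm_monoid_mult}"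
  by (simp add: smooth_def C_k_prod)
lemma smooth_inverse: "smooth f \<Longrightarrow> (\<And>x. f x \<noteq> 0) \<Longrightarrow> smooth (\<lambda>x. inverse (f x))"
  for f :: "real^'n::finite \<Rightarrow> real" by (simp add: smooth_def C_k_inverse)
lemma smooth_bounded_linear: "bounded_linear L \<Longrightarrow> smooth f \<Longrightarrow> smooth (\<lambda>x. L (f x))"
  by (simp add: smooth_def C_k_bounded_linear)
lemmas smooth_cnj = smooth_bounded_linear[OF bounded_linear_cnj]
lemmas smooth_of_real = smooth_bounded_linear[OF bounded_linear_of_real]
lemmas smooth_Re = smooth_bounded_linear[OF bounded_linear_Re]

lemma smooth_linear: "smooth f" if "bounded_linear f"
proof -
  have D: "(f has_derivative f) (at x)" for x by (rule bounded_linear_imp_has_derivative[OF that])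
  have "C_k k f" for k
  proof (cases k)
    case 0 then show ?thesis using linear_continuous_on[OF that] by simp
  next
    case (Suc m)
    have "partial_deriv i f = (\<lambda>x. f (axis i 1))" for i by (rule ext) (rule partial_deriv_eq[OF D])
    moreover have "f differentiable (at x)" for x using D unfolding differentiable_def by blast
    ultimately show ?thesis using Suc by simp
  qed
  then show ?thesis by (simp add: smooth_def)
qed

lemma smooth_real_polynomial: "real_polynomial_function p \<Longrightarrow> smooth p"
  for p :: "real^'n::finite \<Rightarrow> real"
  by (induction rule: real_polynomial_function.induct)
     (auto intro: smooth_linear smooth_const smooth_add smooth_mult)

section \<open>A flat function\<close>

text \<open>The derivatives of the flat function \<open>exp_inv 0\<close> are combinations of the \<open>exp_inv j\<close>.\<close>

definition exp_inv :: "nat \<Rightarrow> real \<Rightarrow> real" where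
  "exp_inv j t = (if t > 0 then inverse t ^ j * exp (- inverse t) else 0)"

text \<open>A single term of the exponential series.\<close>

lemma power_le_fact_exp: "y ^ n \<le> fact n * exp y" if "0 \<le> (y::real)"
proof -
  have "(\<Sum>k\<in>{n}. y ^ k /\<^sub>R fact k) \<le> (\<Sum>k. y ^ k /\<^sub>R fact k)"
    using that by (intro sum_le_suminf summable_exp_generic) auto
  then show ?thesis by (simp add: exp_def field_simps)
qed

lemma exp_inv_nonneg [simp]: "0 \<le> exp_inv j t"
  by (simp add: exp_inv_def)

text \<open>Comparing with the power \<open>j + 2\<close> of \<open>inverse t\<close> instead of
  \<open>j\<close> gains the factor \<open>t^2\<close>, which makes the difference quotient at 0
  tend to 0.\<close>

lemma exp_inv_le: "exp_inv j t \<le> fact (j + 2) * t\<^sup>2"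
proof (cases "t > 0")
  case True
  have "inverse t ^ j * inverse t ^ 2 \<le> fact (j + 2) * exp (inverse t)"
    using power_le_fact_exp[of "inverse t" "j + 2"] True unfolding power_add by simp
  then have "inverse t ^ j * inverse t ^ 2 * (t\<^sup>2 * exp (- inverse t)) \<le> fact (j + 2) * exp (inverse t) * (t\<^sup>2 * exp (- inverse t))"
    by (intro mult_right_mono) auto
  moreover have "inverse t ^ j * inverse t ^ 2 * (t\<^sup>2 * exp (- inverse t)) = exp_inv j t"
    using True by (simp add: exp_inv_def power_inverse)
  moreover have "fact (j + 2) * exp (inverse t) * (t\<^sup>2 * exp (- inverse t)) = fact (j + 2) * t\<^sup>2"
    by (simp add: exp_minus)
  ultimately show ?thesis by (simp only:)
qed (simp add: exp_inv_def)

lemma exp_inv_DERIV: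
  "(exp_inv j has_real_derivative (exp_inv (j + 2) t - real j * exp_inv (j + 1) t)) (at t)"
proof -
  consider "t > 0" | "t < 0" | "t = 0" by linarith
  then show ?thesis
  proof cases
    case 1
    \<comment> \<open>The case split on \<open>j\<close> is due to the truncated exponent
      \<open>j - 1\<close> in the power rule.\<close>
    have "((\<lambda>t. inverse t ^ j * exp (- inverse t)) has_real_derivative
        (exp_inv (j + 2) t - real j * exp_inv (j + 1) t)) (at t)"
      using 1 by (auto intro!: derivative_eq_intros simp: exp_inv_def power2_eq_square)
        (cases j; simp add: algebra_simps)
    then show ?thesis
      by (rule has_field_derivative_transform_within_open[of _ _ _ "{0<..}"])
         (use 1 in \<open>auto simp: exp_inv_def\<close>)
  next
    case 2
    have "((\<lambda>t. 0) has_real_derivative 0) (at t)" by simp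
    then have "(exp_inv j has_real_derivative 0) (at t)"
      by (rule has_field_derivative_transform_within_open[of _ _ _ "{..<0}"])
         (use 2 in \<open>auto simp: exp_inv_def\<close>)
    with 2 show ?thesis by (simp add: exp_inv_def)
  next
    case 3
    have "(\<lambda>h. (exp_inv j (0 + h) - exp_inv j 0) / h) \<midarrow>0\<rightarrow> 0"
    proof (rule Lim_null_comparison[OF always_eventually])
      show "\<forall>h. norm ((exp_inv j (0 + h) - exp_inv j 0) / h) \<le> fact (j + 2) * \<bar>h\<bar>"
      proof
        fix h :: real
        show "norm ((exp_inv j (0 + h) - exp_inv j 0) / h) \<le> fact (j + 2) * \<bar>h\<bar>"
        proof (cases "h = 0")
          case False
          have "\<bar>exp_inv j h\<bar> / \<bar>h\<bar> \<le> (fact (j + 2) * h\<^sup>2) / \<bar>h\<bar>"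
            using exp_inv_le[of j h] by (intro divide_right_mono) auto
          also have "h\<^sup>2 = \<bar>h\<bar> * \<bar>h\<bar>" by (simp add: power2_eq_square)
          also have "fact (j + 2) * (\<bar>h\<bar> * \<bar>h\<bar>) / \<bar>h\<bar> = fact (j + 2) * \<bar>h\<bar>"
            using False by (simp del: abs_mult_self_eq)
          finally show ?thesis by (simp add: exp_inv_def[of j 0])
        qed simp
      qed
      have "(\<lambda>h::real. fact (j + 2) * \<bar>h\<bar>) \<midarrow>0\<rightarrow> fact (j + 2) * \<bar>0\<bar>" by (intro tendsto_intros)
      then show "(\<lambda>h::real. fact (j + 2) * \<bar>h\<bar>) \<midarrow>0\<rightarrow> 0" by simp
    qed
    with 3 show ?thesis by (simp add: DERIV_def exp_inv_def)
  qed
qed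

text \<open>The induction on the order runs over all \<open>j\<close> simultaneously, since
  differentiation moves \<open>j\<close> to \<open>j + 1\<close> and \<open>j + 2\<close>.\<close>

lemma smooth_exp_inv:
  fixes f :: "real^'n::finite \<Rightarrow> real"
  assumes "smooth f" shows "smooth (\<lambda>x. exp_inv j (f x))"
proof -
  have "C_k k (\<lambda>x. exp_inv j (f x))" for k
  proof (induction k arbitrary: j)
    case 0
    have "continuous_on UNIV (exp_inv j)" 
      by (intro continuous_at_imp_continuous_on ballI DERIV_isCont[OF exp_inv_DERIV])
    then show ?case using smooth_continuous[OF assms, of UNIV] continuous_on_compose2 by fastforce
  next
    case (Suc k)
    have "partial_deriv i (\<lambda>x. exp_inv j (f x)) =
      (\<lambda>x. (exp_inv (j + 2) (f x) + (- real j) * exp_inv (j + 1) (f x)) * partial_deriv i f x)" for i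
      by (rule ext, subst partial_deriv_compose_real(1)[OF smooth_differentiable[OF assms] exp_inv_DERIV]) simp
    moreover have "C_k k (\<lambda>x. (exp_inv (j + 2) (f x) + (- real j) * exp_inv (j + 1) (f x)) * partial_deriv i f x)" for i
      using smooth_partial[OF assms] by (intro C_k_mult C_k_add C_k_const Suc.IH) (simp add: smooth_def)
    ultimately show ?case
      using partial_deriv_compose_real(2)[OF smooth_differentiable[OF assms] exp_inv_DERIV] by simp
  qed
  then show ?thesis by (simp add: smooth_def)
qed

section \<open>Test functions and weak derivatives\<close>

lemma test_functions_iff: "u \<in> test_functions \<longleftrightarrow> smooth u \<and> bounded {x. u x \<noteq> 0}"
  by (auto simp: test_functions_def smooth_def compactly_supported_in_def compact_eq_bounded_closed
      intro: bounded_closure bounded_subset[OF _ closure_subset])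

lemma test_smooth: "u \<in> test_functions \<Longrightarrow> smooth u"
  by (simp add: test_functions_iff)

lemma test_functionsI: "smooth u \<Longrightarrow> bounded B \<Longrightarrow> (\<And>x. x \<notin> B \<Longrightarrow> u x = 0) \<Longrightarrow> u \<in> test_functions"
  unfolding test_functions_iff using bounded_subset[of B "{x. u x \<noteq> 0}"] by blast

lemma partial_deriv_zero_open:
  assumes "open S" "x \<in> S" "\<And>y. y \<in> S \<Longrightarrow> f y = c"
  shows "partial_deriv i f x = 0"
proof -
  have "((\<lambda>y. c) has_derivative (\<lambda>_. 0)) (at x)" by simp
  then have "(f has_derivative (\<lambda>_. 0)) (at x)"
    by (rule has_derivative_transform_within_open[OF _ assms(1,2)]) (simp add: assms(3))
  then show ?thesis by (simp add: partial_deriv_eq)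
qed

lemma partial_deriv_support: "partial_deriv i u x \<noteq> 0 \<Longrightarrow> x \<in> closure {x. u x \<noteq> 0}"
  using partial_deriv_zero_open[of "- closure {x. u x \<noteq> 0}" x u 0 i] closure_subset[of "{x. u x \<noteq> 0}"] by blast

lemma test_partial: "u \<in> test_functions \<Longrightarrow> partial_deriv i u \<in> test_functions"
  by (rule test_functionsI[of _ "closure {x. u x \<noteq> 0}"])
     (auto simp: test_functions_iff smooth_partial dest: partial_deriv_support)

lemma test_add: "u \<in> test_functions \<Longrightarrow> v \<in> test_functions \<Longrightarrow> (\<lambda>x. u x + v x) \<in> test_functions"
  by (rule test_functionsI[of _ "{x. u x \<noteq> 0} \<union> {x. v x \<noteq> 0}"])
     (auto simp: test_functions_iff smooth_add)

lemma test_mult: "smooth u \<Longrightarrow> v \<in> test_functions \<Longrightarrow> (\<lambda>x. u x * v x) \<in> test_functions"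
  by (rule test_functionsI[of _ "{x. v x \<noteq> 0}"]) (auto simp: test_functions_iff smooth_mult)

lemma test_cmult: "u \<in> test_functions \<Longrightarrow> (\<lambda>x. c * u x) \<in> test_functions"
  using test_mult[OF smooth_const] .

lemma test_cnj: "u \<in> test_functions \<Longrightarrow> (\<lambda>x. cnj (u x)) \<in> test_functions"
  by (rule test_functionsI[of _ "{x. u x \<noteq> 0}"]) (auto simp: test_functions_iff smooth_cnj)

lemma test_zero: "(\<lambda>x. 0) \<in> test_functions"
  by (simp add: test_functions_iff smooth_const)

lemma test_bounded:
  assumes "u \<in> test_functions" obtains M where "\<And>x. cmod (u x) \<le> M" "M \<ge> 0"
proof -
  have c: "compact (closure {x. u x \<noteq> 0})" using assms by (simp add: test_functions_iff)
  have "bounded (u ` closure {x. u x \<noteq> 0})"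
    by (intro compact_imp_bounded compact_continuous_image c smooth_continuous test_smooth assms)
  then obtain M where M: "\<And>x. x \<in> closure {x. u x \<noteq> 0} \<Longrightarrow> cmod (u x) \<le> M" "M > 0"
    unfolding bounded_pos by auto
  have "cmod (u x) \<le> M" for x
    using M closure_subset[of "{x. u x \<noteq> 0}"] by (cases "u x = 0") auto
  with M(2) show thesis by (intro that) auto
qed

lemma test_measurable: "u \<in> test_functions \<Longrightarrow> u \<in> borel_measurable lborel"
  by (intro smooth_measurable test_smooth)

section \<open>Local integrability\<close>

lemma locally_integrable_mult:
  fixes w c :: "real^'n::finite \<Rightarrow> complex"
  assumes "locally_integrable w" and [measurable]: "c \<in> borel_measurable lborel"
    and "\<And>x. cmod (c x) \<le> M" "bounded B" "\<And>x. x \<notin> B \<Longrightarrow> c x = 0"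
  shows "integrable lborel (\<lambda>x. w x * c x)"
proof -
  define K where "K = closure B"
  have "compact K" using assms(4) by (simp add: K_def)
  then have i: "integrable lborel (\<lambda>x. indicator K x *\<^sub>R w x)"
    using assms(1) unfolding locally_integrable_def set_integrable_def by blast
  note [measurable] = borel_measurable_integrable[OF i]
  have eq: "(\<lambda>x. w x * c x) = (\<lambda>x. (indicator K x *\<^sub>R w x) * c x)"
    using assms(5) closure_subset[of B] by (intro ext) (auto simp: indicator_def K_def)
  show ?thesis unfolding eq
  proof (rule Bochner_Integration.integrable_bound)
    show "integrable lborel (\<lambda>x. M * cmod (indicator K x *\<^sub>R w x))"
      by (intro integrable_mult_right integrable_norm i)
    show "(\<lambda>x. (indicator K x *\<^sub>R w x) * c x) \<in> borel_measurable lborel" by measurable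
    show "AE x in lborel. cmod ((indicator K x *\<^sub>R w x) * c x) \<le> norm (M * cmod (indicator K x *\<^sub>R w x))"
    proof (rule AE_I2)
      fix x
      have "cmod (c x) \<le> \<bar>M\<bar>" using assms(3)[of x] by linarith
      then show "cmod ((indicator K x *\<^sub>R w x) * c x) \<le> norm (M * cmod (indicator K x *\<^sub>R w x))"
        using mult_right_mono[of "cmod (c x)" "\<bar>M\<bar>" "cmod (indicator K x *\<^sub>R w x)"]
        by (simp add: norm_mult abs_mult mult_ac)
    qed
  qed
qed

lemma locally_integrable_test:
  assumes "locally_integrable w" "u \<in> test_functions"
  shows "integrable lborel (\<lambda>x. w x * u x)"
proof -
  obtain M where "\<And>x. cmod (u x) \<le> M" using test_bounded[OF assms(2)] by blast
  then show ?thesis using assms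
    by (intro locally_integrable_mult[where B="{x. u x \<noteq> 0}" and M=M])
       (auto simp: test_functions_iff dest: smooth_measurable)
qed

lemma locally_integrable_bounded:
  fixes w :: "real^'n::finite \<Rightarrow> complex"
  assumes [measurable]: "w \<in> borel_measurable borel" and b: "AE x in lborel. cmod (w x) \<le> M"
  shows "locally_integrable w"
  unfolding locally_integrable_def set_integrable_def
proof (intro allI impI)
  fix K :: "(real^'n) set" assume K: "compact K"
  have [measurable]: "K \<in> sets borel" using K by (simp add: borel_compact)
  show "integrable lborel (\<lambda>x. indicator K x *\<^sub>R w x)"
  proof (rule Bochner_Integration.integrable_bound)
    have "emeasure lborel K < \<infinity>" by (rule emeasure_compact_finite[OF K])
    then show "integrable lborel (\<lambda>x. M * indicator K x :: real)"
      by (intro integrable_mult_right integrable_real_indicator) (use K in \<open>auto simp: borel_compact\<close>)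
    show "AE x in lborel. norm (indicator K x *\<^sub>R w x) \<le> norm (M * indicator K x)"
      using b by eventually_elim (auto simp: indicator_def intro: order_trans[OF _ abs_ge_self])
  qed measurable
qed

lemma locally_integrable_L2:
  assumes "f \<in> L2" shows "locally_integrable f"
  unfolding locally_integrable_def set_integrable_def
proof (intro allI impI)
  fix K :: "(real^'a) set" assume K: "compact K"
  have [measurable]: "K \<in> sets lborel" using K by (simp add: borel_compact)
  have "emeasure lborel K < \<infinity>" by (rule emeasure_compact_finite[OF K])
  then have "integrable lborel (indicator K :: _ \<Rightarrow> real)"
    by (intro integrable_real_indicator) (use K in \<open>auto simp: borel_compact\<close>)
  moreover have "(\<lambda>x. (cmod (indicator K x))\<^sup>2) = (indicator K :: _ \<Rightarrow> real)"
    by (auto simp: indicator_def)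
  ultimately have "(\<lambda>x. indicator K x) \<in> L2"
    by (simp add: L2_def)
  moreover have "(\<lambda>x. indicator K x *\<^sub>R f x) = (\<lambda>x. indicator K x * f x)"
    by (auto simp: indicator_def)
  ultimately show "integrable lborel (\<lambda>x. indicator K x *\<^sub>R f x)"
    using L2_mult_integrable[OF _ assms] by simp
qed

lemma test_L2: "u \<in> test_functions \<Longrightarrow> u \<in> L2"
proof -
  assume u: "u \<in> test_functions"
  obtain M where M: "\<And>x. cmod (u x) \<le> M" using test_bounded[OF u] by blast
  have "integrable lborel (\<lambda>x. u x * cnj (u x))"
    using test_measurable[OF u]
    by (intro locally_integrable_test locally_integrable_bounded[where M=M] AE_I2 test_cnj u M) simp
  then have "integrable lborel (\<lambda>x. Re (u x * cnj (u x)))" by (rule integrable_Re)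
  moreover have "Re (u x * cnj (u x)) = (cmod (u x))\<^sup>2" for x
    by (simp only: cmod_power2) (simp add: power2_eq_square)
  ultimately show ?thesis using test_measurable[OF u] by (simp add: L2_def)
qed

section \<open>Translation and integration by parts\<close>

lemma lborel_integral_shift:
  fixes f :: "real^'n::finite \<Rightarrow> 'b::{banach, second_countable_topology}"
  assumes [measurable]: "f \<in> borel_measurable lborel"
  shows "(LINT x|lborel. f (x + c)) = (LINT x|lborel. f x)"
proof -
  have "(LINT x|distr lborel borel ((+) c). f x) = (LINT x|lborel. f (c + x))"
    by (rule integral_distr) auto
  then show ?thesis by (simp add: lborel_distr_plus add.commute)
qed

text \<open>Differentiation of a translate falls on the test function, so \<open>w\<close> needs no regularity.\<close>

lemma integral_translate_derivative:
  fixes w :: "real^'n::finite \<Rightarrow> complex"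
  assumes w: "locally_integrable w" and u: "u \<in> test_functions"
  shows "((\<lambda>s. LINT x|lborel. w x * u (x - s *\<^sub>R v)) has_vector_derivative
    - (LINT x|lborel. w x * (\<Sum>i\<in>UNIV. v $ i *\<^sub>R partial_deriv i u (x - s *\<^sub>R v)))) (at s)"
proof -
  define D where "D x = (\<Sum>i\<in>UNIV. v $ i *\<^sub>R partial_deriv i u x)" for x
  have D: "(u has_derivative (\<lambda>y. \<Sum>i\<in>UNIV. y $ i *\<^sub>R partial_deriv i u x)) (at x)" for x
    by (rule has_derivative_partial[OF smooth_differentiable[OF test_smooth[OF u]]])
  have Dt: "D \<in> test_functions"
  proof -
    have "(\<lambda>x. \<Sum>i\<in>I. of_real (v $ i) * partial_deriv i u x) \<in> test_functions" if "finite I" for I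
      using that by induction (simp_all add: test_zero test_add test_cmult test_partial u)
    from this[of UNIV] show ?thesis unfolding D_def by (simp add: scaleR_conv_of_real)
  qed
  obtain M where M: "\<And>x. cmod (D x) \<le> M" "M \<ge> 0" using test_bounded[OF Dt] by blast
  have line: "((\<lambda>r. u (x - r *\<^sub>R v)) has_derivative (\<lambda>h. h *\<^sub>R (- D (x - r *\<^sub>R v)))) (at r within S)" for x r S
  proof -
    have "((\<lambda>r. x - r *\<^sub>R v) has_derivative (\<lambda>h. - (h *\<^sub>R v))) (at r within S)"
      by (auto intro!: derivative_eq_intros)
    from has_derivative_compose[OF this D]
    show ?thesis by (simp add: D_def scaleR_sum_right sum_negf)
  qed
  \<comment> \<open>The mean value inequality, uniform in \<open>x\<close>; it provides the
    integrable majorant for the difference quotients.\<close>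
  have lip: "cmod (u (x - r *\<^sub>R v) - u (x - s *\<^sub>R v)) \<le> M * \<bar>r - s\<bar>" for x r s
  proof -
    have "norm (u (x - r *\<^sub>R v) - u (x - s *\<^sub>R v)) \<le> M * norm (r - s)"
    proof (rule differentiable_bound[OF convex_UNIV line])
      show "onorm (\<lambda>h. h *\<^sub>R - D (x - y *\<^sub>R v)) \<le> M" for y
        by (rule onorm_bound) (use M in \<open>auto simp: mult.commute[of M] intro: mult_left_mono\<close>)
    qed auto
    then show ?thesis by simp
  qed
  obtain R where R: "\<And>x. u x \<noteq> 0 \<Longrightarrow> norm x \<le> R" 
    using u unfolding test_functions_iff bounded_iff by auto
  have RD: "norm x \<le> R" if nz: "D x \<noteq> 0" for x
  proof -
    obtain i where "partial_deriv i u x \<noteq> 0" using nz unfolding D_def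
      by (metis (mono_tags, lifting) scaleR_zero_right sum.neutral)
    then have "x \<in> closure {x. u x \<noteq> 0}" by (rule partial_deriv_support)
    moreover have "closure {x. u x \<noteq> 0} \<subseteq> cball 0 R"
      using R by (intro closure_minimal) auto
    ultimately show ?thesis by auto
  qed
  have um [measurable]: "u \<in> borel_measurable borel" and Dm [measurable]: "D \<in> borel_measurable borel"
    using test_measurable[OF u] test_measurable[OF Dt] by simp_all
  have intu: "integrable lborel (\<lambda>x. w x * u (x - r *\<^sub>R v))" for r
  proof -
    obtain M' where "\<And>x. cmod (u x) \<le> M'" using test_bounded[OF u] by blast
    then show ?thesis
    proof (intro locally_integrable_mult[OF w])
      show "u (x - r *\<^sub>R v) = 0" if "x \<notin> cball (r *\<^sub>R v) R" for x
        using that R[of "x - r *\<^sub>R v"] by (auto simp: dist_norm norm_minus_commute)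
    qed auto
  qed
  have intD: "integrable lborel (\<lambda>x. w x * D (x - r *\<^sub>R v))" for r
  proof (rule locally_integrable_mult[OF w])
    show "D (x - r *\<^sub>R v) = 0" if "x \<notin> cball (r *\<^sub>R v) R" for x
      using that RD[of "x - r *\<^sub>R v"] by (auto simp: dist_norm norm_minus_commute)
    show "cmod (D (x - r *\<^sub>R v)) \<le> M" for x by (rule M)
  qed auto
  define \<phi> where "\<phi> r = (LINT x|lborel. w x * u (x - r *\<^sub>R v))" for r
  define d where "d = - (LINT x|lborel. w x * D (x - s *\<^sub>R v))"
  have "(\<phi> has_derivative (\<lambda>h. h *\<^sub>R d)) (at s)"
    unfolding has_derivative_at_within tendsto_at_iff_sequentially
  proof (intro conjI allI impI bounded_linear_scaleR_left)
    fix X :: "nat \<Rightarrow> real" assume X: "\<forall>n. X n \<in> UNIV - {s}" "X \<longlonglongrightarrow> s"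
    have Xs: "X n \<noteq> s" for n using X by auto
    \<comment> \<open>The normalised remainder of the first-order expansion in the translation
      parameter. It tends to 0 pointwise, is bounded by \<open>2 * M\<close>, and vanishes outside
      one compact set for all \<open>n\<close>, so local integrability of \<open>w\<close> suffices
      for dominated convergence.\<close>
    define q where "q n x = (u (x - X n *\<^sub>R v) - u (x - s *\<^sub>R v) - (X n - s) *\<^sub>R (- D (x - s *\<^sub>R v))) /\<^sub>R \<bar>X n - s\<bar>" for n x
    have qm [measurable]: "q n \<in> borel_measurable borel" for n unfolding q_def by measurable
    have eq: "(\<phi> (X n) - \<phi> s - (X n - s) *\<^sub>R d) /\<^sub>R norm (X n - s) = (LINT x|lborel. w x * q n x)" for n
    proof -
      have "(LINT x|lborel. w x * q n x) = (LINT x|lborel. (w x * u (x - X n *\<^sub>R v) - w x * u (x - s *\<^sub>R v)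
          + (X n - s) *\<^sub>R (w x * D (x - s *\<^sub>R v))) /\<^sub>R \<bar>X n - s\<bar>)"
        by (intro Bochner_Integration.integral_cong) (auto simp: q_def scaleR_conv_of_real algebra_simps)
      also have "\<dots> = (\<phi> (X n) - \<phi> s - (X n - s) *\<^sub>R d) /\<^sub>R norm (X n - s)"
        using intu intD by (simp add: \<phi>_def d_def)
      finally show ?thesis by simp
    qed
    have bnd: "\<exists>B. \<forall>n. norm (X n) \<le> B" 
      using convergent_imp_Bseq[OF convergentI[OF X(2)]] by (meson BseqE)
    then obtain B where B: "\<And>n. \<bar>X n\<bar> \<le> B" by auto
    have Bs: "\<bar>s\<bar> \<le> B" using LIMSEQ_le_const2[OF tendsto_rabs[OF X(2)]] B by blast
    \<comment> \<open>Large enough for the supports of all translates by \<open>X n\<close> and by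
      the limit \<open>s\<close>.\<close>
    define K where "K = cball (0::real^'n) (R + B * norm v)"
    have qb: "cmod (q n x) \<le> 2 * M" for n x
    proof -
      have "cmod (u (x - X n *\<^sub>R v) - u (x - s *\<^sub>R v) - (X n - s) *\<^sub>R (- D (x - s *\<^sub>R v)))
         \<le> M * \<bar>X n - s\<bar> + \<bar>X n - s\<bar> * M"
        by (rule order_trans[OF norm_triangle_ineq4 add_mono[OF lip]])
           (auto intro!: mult_left_mono M)
      then show ?thesis using Xs[of n] by (simp add: q_def divide_inverse_commute[symmetric] pos_divide_le_eq mult_ac)
    qed
    have qK: "q n x = 0" if "x \<notin> K" for n x
    proof -
      have far: "norm (x - r *\<^sub>R v) > R" if "\<bar>r\<bar> \<le> B" for r
      proof -
        have "norm (r *\<^sub>R v) \<le> B * norm v" using that by (simp add: mult_right_mono)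
        moreover have "norm x > R + B * norm v" using \<open>x \<notin> K\<close> by (simp add: K_def)
        ultimately show ?thesis using norm_triangle_ineq2[of x "r *\<^sub>R v"] by linarith
      qed
      have "u (x - r *\<^sub>R v) = 0" "D (x - r *\<^sub>R v) = 0" if "\<bar>r\<bar> \<le> B" for r
        using far[OF that] R[of "x - r *\<^sub>R v"] RD[of "x - r *\<^sub>R v"] by linarith+
      then show ?thesis using B Bs by (simp add: q_def)
    qed
    have wK: "integrable lborel (\<lambda>x. indicator K x *\<^sub>R w x)"
      unfolding K_def by (rule w[unfolded locally_integrable_def set_integrable_def, rule_format]) simp
    note [measurable] = borel_measurable_integrable[OF wK]
    have wq: "w x * q n x = (indicator K x *\<^sub>R w x) * q n x" for n x
      using qK[of x n] by (auto simp: indicator_def)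
    have "(\<lambda>n. LINT x|lborel. (indicator K x *\<^sub>R w x) * q n x) \<longlonglongrightarrow> integral\<^sup>L lborel (\<lambda>x::real^'n. 0)"
    proof (rule integral_dominated_convergence[where w="\<lambda>x. cmod (indicator K x *\<^sub>R w x) * (2 * M)"])
      show "integrable lborel (\<lambda>x. cmod (indicator K x *\<^sub>R w x) * (2 * M))"
        by (intro integrable_mult_left integrable_norm wK)
      show "AE x in lborel. norm ((indicator K x *\<^sub>R w x) * q n x) \<le> cmod (indicator K x *\<^sub>R w x) * (2 * M)" for n
        by (rule AE_I2) (simp only: norm_mult, intro mult_left_mono qb norm_ge_zero)
      show "AE x in lborel. (\<lambda>n. (indicator K x *\<^sub>R w x) * q n x) \<longlonglongrightarrow> 0"
      proof (rule AE_I2)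
        fix x
        have "((\<lambda>y. (u (x - y *\<^sub>R v) - u (x - s *\<^sub>R v) - (y - s) *\<^sub>R (- D (x - s *\<^sub>R v))) /\<^sub>R norm (y - s)) \<longlongrightarrow> 0) (at s)"
          using line[of x s UNIV] unfolding has_derivative_at_within by blast
        then have "(\<lambda>n. q n x) \<longlonglongrightarrow> 0"
          unfolding tendsto_at_iff_sequentially q_def using X by (auto simp: o_def)
        then show "(\<lambda>n. (indicator K x *\<^sub>R w x) * q n x) \<longlonglongrightarrow> 0"
          by (rule tendsto_mult_right_zero)
      qed
    qed measurable
    then show "((\<lambda>y. (\<phi> y - \<phi> s - (y - s) *\<^sub>R d) /\<^sub>R norm (y - s)) \<circ> X) \<longlonglongrightarrow> 0"
      by (simp only: o_def eq wq Bochner_Integration.integral_zero)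
  qed
  then show ?thesis unfolding has_vector_derivative_def \<phi>_def d_def D_def .
qed

text \<open>For the weight 1 the integral of a translate does not depend on the translation, so its
  derivative at 0 vanishes.\<close>

lemma integral_partial_test:
  assumes u: "u \<in> test_functions"
  shows "(LINT x|lborel. partial_deriv i u x) = 0"
proof -
  have li: "locally_integrable (\<lambda>x. 1)" by (rule locally_integrable_bounded[of _ 1]) auto
  have "(\<lambda>s. LINT x|lborel. 1 * u (x - s *\<^sub>R axis i 1)) = (\<lambda>s. LINT x|lborel. u x)"
    using lborel_integral_shift[OF test_measurable[OF u], of "- (s *\<^sub>R axis i 1)" for s] by simp
  then have "((\<lambda>s. LINT x|lborel. 1 * u (x - s *\<^sub>R axis i 1)) has_vector_derivative 0) (at 0)"
    by simp
  from vector_derivative_unique_at[OF this integral_translate_derivative[OF li u]]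
  have "(LINT x|lborel. (\<Sum>j\<in>UNIV. axis i 1 $ j *\<^sub>R partial_deriv j u x)) = 0" by simp
  moreover have "(\<Sum>j\<in>UNIV. axis i 1 $ j *\<^sub>R partial_deriv j u x) = partial_deriv i u x" for x
    by (simp add: axis_def if_distrib[of "\<lambda>r. r *\<^sub>R _"] cong: if_cong)
  ultimately show ?thesis by simp
qed

lemma smooth_locally_integrable:
  assumes "smooth (u :: real^'n::finite \<Rightarrow> complex)" shows "locally_integrable u"
  unfolding locally_integrable_def set_integrable_def
  using borel_integrable_compact[of _ u] smooth_continuous[OF assms] by blast

lemma integral_by_parts:
  assumes "smooth u" "v \<in> test_functions"
  shows "(LINT x|lborel. u x * partial_deriv i v x) = - (LINT x|lborel. partial_deriv i u x * v x)"
proof -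
  have "(LINT x|lborel. partial_deriv i (\<lambda>x. u x * v x) x) = 0"
    by (rule integral_partial_test[OF test_mult[OF assms]])
  moreover have "partial_deriv i (\<lambda>x. u x * v x) x = u x * partial_deriv i v x + partial_deriv i u x * v x" for x
    by (rule partial_deriv_mult[OF smooth_differentiable[OF assms(1)] smooth_differentiable[OF test_smooth[OF assms(2)]]])
  ultimately have "(LINT x|lborel. u x * partial_deriv i v x + partial_deriv i u x * v x) = 0" by simp
  moreover have "integrable lborel (\<lambda>x. u x * partial_deriv i v x)" "integrable lborel (\<lambda>x. partial_deriv i u x * v x)"
    using locally_integrable_test[OF smooth_locally_integrable[OF assms(1)] test_partial[OF assms(2)]]
      locally_integrable_test[OF smooth_locally_integrable[OF smooth_partial[OF assms(1)]] assms(2)] by auto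
  ultimately show ?thesis by (simp add: eq_neg_iff_add_eq_0)
qed

text \<open>By Lindelof countably many of the neighbourhoods suffice, and countably many null sets
  may be united.\<close>

lemma AE_open_cover:
  fixes \<Omega> :: "(real^'n::finite) set"
  assumes "\<And>x. x \<in> \<Omega> \<Longrightarrow> \<exists>N. open N \<and> x \<in> N \<and> (AE y in lborel. y \<in> N \<longrightarrow> P y)"
  shows "AE y in lborel. y \<in> \<Omega> \<longrightarrow> P y"
proof -
  obtain N where N: "\<And>x. x \<in> \<Omega> \<Longrightarrow> open (N x) \<and> x \<in> N x \<and> (AE y in lborel. y \<in> N x \<longrightarrow> P y)"
    using assms by metis
  then have "\<And>S. S \<in> N ` \<Omega> \<Longrightarrow> open S" by auto
  then obtain F where F: "F \<subseteq> N ` \<Omega>" "countable F" "\<Union>F = \<Union>(N ` \<Omega>)"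
    using Lindelof by metis
  have "AE y in lborel. \<forall>S\<in>F. y \<in> S \<longrightarrow> P y"
    using F N by (subst AE_ball_countable) auto
  then show ?thesis
  proof eventually_elim
    case (elim y)
    show ?case
    proof
      assume "y \<in> \<Omega>"
      then have "y \<in> \<Union>F" using N F(3) by blast
      then show "P y" using elim by blast
    qed
  qed
qed

text \<open>Nonempty open sets have positive measure. This extracts an actual point from a statement
  that holds almost everywhere.\<close>

lemma AE_open_nonempty:
  fixes S :: "(real^'n::finite) set"
  assumes "open S" "S \<noteq> {}" "AE x in lborel. x \<in> S \<longrightarrow> P x"
  shows "\<exists>x\<in>S. P x"
proof (rule ccontr)
  assume "\<not> ?thesis"
  with assms(3) have "AE x in lborel. x \<notin> S" by auto
  then have "S \<in> null_sets lborel"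
    using AE_iff_null_sets[of S lborel] assms(1) by simp
  then have "negligible S"
    by (simp add: negligible_iff_null_sets null_sets_completionI)
  with open_not_negligible[OF assms(1,2)] show False by simp
qed

lemma AE_lborel_shift:
  fixes c :: "real^'n::finite"
  assumes "AE x in lborel. P (c + x)" "{x. P x} \<in> sets borel"
  shows "AE x in lborel. P x"
proof -
  have "AE x in distr lborel borel ((+) c). P x"
    using assms by (subst AE_distr_iff) auto
  then show ?thesis unfolding lborel_distr_plus .
qed

section \<open>Bump functions on boxes and the fundamental lemma of the calculus of
  variations\<close>

definition box_bump :: "real^'n::finite \<Rightarrow> real^'n \<Rightarrow> nat \<Rightarrow> real^'n \<Rightarrow> real" where
  "box_bump a b m x = (\<Prod>i\<in>UNIV. exp_inv 0 (real m * (x $ i - a $ i) - 1) * exp_inv 0 (real m * (b $ i - x $ i) - 1))"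

lemma exp_inv_0_le_1: "exp_inv 0 t \<le> 1"
  by (simp add: exp_inv_def)

lemma box_bump_bounds: "0 \<le> box_bump a b m x" "box_bump a b m x \<le> 1"
  unfolding box_bump_def
  by (auto intro!: prod_nonneg prod_le_1 mult_le_one simp: exp_inv_0_le_1)

lemma box_bump_smooth: "smooth (box_bump a b m)" for a b :: "real^'n::finite"
proof -
  have *: "smooth (\<lambda>x::real^'n. real m * (x $ i - a $ i) - 1)" "smooth (\<lambda>x::real^'n. real m * (b $ i - x $ i) - 1)" for i
  proof -
    have "smooth (\<lambda>x::real^'n. real m * x $ i + (- real m * a $ i - 1))"
      "smooth (\<lambda>x::real^'n. - real m * x $ i + (real m * b $ i - 1))"
      by (intro smooth_add smooth_mult smooth_const smooth_linear bounded_linear_vec_nth)+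
    then show "smooth (\<lambda>x::real^'n. real m * (x $ i - a $ i) - 1)" "smooth (\<lambda>x::real^'n. real m * (b $ i - x $ i) - 1)"
      by (simp_all add: algebra_simps)
  qed
  show ?thesis unfolding box_bump_def [abs_def]
    by (intro smooth_prod smooth_mult smooth_exp_inv *)
qed

text \<open>The \<open>- 1\<close> in the arguments of \<open>exp_inv\<close> keeps the support at
  distance \<open>1 / m\<close> from the faces of the box, so it is a compact subset of the open
  box, as a test function on an open set requires.\<close>

lemma box_bump_support:
  fixes a b :: "real^'n::finite"
  assumes "m > 0" shows "closure {x. of_real (box_bump a b m x) \<noteq> (0::complex)} \<subseteq> box a b"
    and "(\<lambda>x. of_real (box_bump a b m x) :: complex) \<in> test_functions"
proof -
  let ?K = "cbox (\<chi> i. a $ i + 1 / real m) (\<chi> i. b $ i - 1 / real m)"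
  have *: "x \<in> ?K" if "box_bump a b m x \<noteq> 0" for x
  proof -
    have "exp_inv 0 (real m * (x $ i - a $ i) - 1) \<noteq> 0" "exp_inv 0 (real m * (b $ i - x $ i) - 1) \<noteq> 0" for i
      using that unfolding box_bump_def by (auto simp: prod_zero_iff)
    then have "real m * (x $ i - a $ i) > 1" "real m * (b $ i - x $ i) > 1" for i
      unfolding exp_inv_def by (metis diff_gt_0_iff_gt)+
    then have "x $ i - a $ i \<ge> 1 / real m" "b $ i - x $ i \<ge> 1 / real m" for i
      using assms by (auto simp: field_simps less_imp_le)
    then show ?thesis by (simp add: mem_box_cart) (smt (verit))
  qed
  then have "closure {x. of_real (box_bump a b m x) \<noteq> (0::complex)} \<subseteq> ?K"
    by (intro closure_minimal) auto
  also have "?K \<subseteq> box a b"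
  proof
    fix x assume "x \<in> ?K"
    then have "a $ i + 1 / real m \<le> x $ i" "x $ i \<le> b $ i - 1 / real m" for i by (auto simp: mem_box_cart)
    moreover have "1 / real m > 0" using assms by simp
    ultimately have "a $ i < x $ i" "x $ i < b $ i" for i by (smt (verit))+
    then show "x \<in> box a b" by (simp add: mem_box_cart)
  qed
  finally show "closure {x. of_real (box_bump a b m x) \<noteq> (0::complex)} \<subseteq> box a b" .
  show "(\<lambda>x. of_real (box_bump a b m x) :: complex) \<in> test_functions"
    by (rule test_functionsI[of _ ?K]) (auto intro: * smooth_of_real box_bump_smooth)
qed

lemma box_bump_tendsto:
  fixes a b x :: "real^'n::finite"
  shows "(\<lambda>m. box_bump a b m x) \<longlonglongrightarrow> indicator (box a b) x"
proof (cases "x \<in> box a b")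
  case True
  have e: "(\<lambda>m. exp_inv 0 (real m * c - 1)) \<longlonglongrightarrow> 1" if "c > 0" for c
  proof -
    have l: "filterlim (\<lambda>m. real m * c - 1) at_top sequentially"
      using that by real_asymp
    have "(\<lambda>m. exp (- inverse (real m * c - 1))) \<longlonglongrightarrow> exp (- 0)"
      by (intro tendsto_intros tendsto_inverse_0_at_top l)
    moreover have "\<forall>\<^sub>F m in sequentially. exp (- inverse (real m * c - 1)) = exp_inv 0 (real m * c - 1)"
      using filterlim_at_top_dense[THEN iffD1, OF l, rule_format, of 0]
      by eventually_elim (simp add: exp_inv_def)
    ultimately have "(\<lambda>m. exp_inv 0 (real m * c - 1)) \<longlonglongrightarrow> exp (- 0)"
      by (rule Lim_transform_eventually)
    then show ?thesis by simp
  qed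
  have "(\<lambda>m. box_bump a b m x) \<longlonglongrightarrow> (\<Prod>i\<in>(UNIV::'n set). 1 * 1)"
    unfolding box_bump_def using True by (intro tendsto_prod tendsto_mult e) (auto simp: mem_box_cart)
  with True show ?thesis by simp
next
  case False
  then obtain i where "x $ i \<le> a $ i \<or> b $ i \<le> x $ i" by (auto simp: mem_box_cart not_less)
  then have "exp_inv 0 (real m * (x $ i - a $ i) - 1) * exp_inv 0 (real m * (b $ i - x $ i) - 1) = 0" for m
    using mult_nonneg_nonpos[of "real m" "x $ i - a $ i"] mult_nonneg_nonpos[of "real m" "b $ i - x $ i"]
    by (auto simp: exp_inv_def)
  then have "box_bump a b m x = 0" for m
    unfolding box_bump_def by (subst prod_zero_iff) auto
  with False show ?thesis by simp
qed

text \<open>Bumps increase to nothing larger than the indicator of a box and converge to it, so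
  \<open>G\<close> integrates to 0 over small boxes. Boxes form an intersection-stable generator of
  the Borel sets, hence all integrals of the localised function \<open>f\<close> over Borel sets
  vanish.\<close>

lemma AE_zero_of_weakly_zero:
  fixes G :: "real^'n::finite \<Rightarrow> complex"
  assumes "open \<Omega>" "locally_integrable G"
    and "\<And>u. u \<in> test_functions \<Longrightarrow> closure {x. u x \<noteq> 0} \<subseteq> \<Omega> \<Longrightarrow> (LINT x|lborel. G x * u x) = 0"
  shows "AE x in lborel. x \<in> \<Omega> \<longrightarrow> G x = 0"
proof (rule AE_open_cover)
  fix x assume "x \<in> \<Omega>"
  then obtain a b where ab: "cbox a b \<subseteq> \<Omega>" "x \<in> box a b"
    using open_contains_cbox[OF assms(1)] by metis
  define f where "f y = indicator (box a b) y *\<^sub>R G y" for y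
  have "set_integrable lborel (cbox a b) G"
    using assms(2) by (simp add: locally_integrable_def)
  then have "set_integrable lborel (box a b) G"
    by (rule set_integrable_subset) (auto simp: box_subset_cbox)
  then have fi: "integrable lborel f" by (simp add: f_def[abs_def] set_integrable_def)
  have [measurable]: "f \<in> borel_measurable lborel" using fi by simp
  have bx: "(LINT y|lborel. indicator (box p q) y *\<^sub>R f y) = 0" for p q
  proof -
    \<comment> \<open>Intersecting with the localising box keeps the support of the bump inside
      \<open>\<Omega>\<close>, for an arbitrary box \<open>p q\<close>.\<close>
    obtain r s where rs: "box p q \<inter> box a b = box r s" unfolding box_Int_box by blast
    have z: "(LINT y|lborel. box_bump r s (Suc m) y *\<^sub>R f y) = 0" for m
    proof -
      note S = box_bump_support[of "Suc m" r s]
      have "box_bump r s (Suc m) y *\<^sub>R f y = G y * of_real (box_bump r s (Suc m) y)" for y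
      proof (cases "box_bump r s (Suc m) y = 0")
        case False
        then have "y \<in> box r s" using S(1) closure_subset by fastforce
        with rs have "y \<in> box a b" by auto
        then show ?thesis by (simp add: f_def scaleR_conv_of_real)
      qed simp
      then show ?thesis using assms(3)[OF S(2)] S(1) rs ab(1) box_subset_cbox[of a b]
        by simp blast
    qed
    have "(\<lambda>m. LINT y|lborel. box_bump r s (Suc m) y *\<^sub>R f y) \<longlonglongrightarrow> (LINT y|lborel. indicator (box r s) y *\<^sub>R f y)"
    proof (rule integral_dominated_convergence[where w="\<lambda>y. cmod (f y)"])
      show "integrable lborel (\<lambda>y. cmod (f y))" using fi by simp
      show "AE y in lborel. (\<lambda>m. box_bump r s (Suc m) y *\<^sub>R f y) \<longlonglongrightarrow> indicator (box r s) y *\<^sub>R f y"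
        by (intro AE_I2 tendsto_intros LIMSEQ_Suc box_bump_tendsto)
      show "AE y in lborel. norm (box_bump r s (Suc m) y *\<^sub>R f y) \<le> cmod (f y)" for m
        by (rule AE_I2) (use box_bump_bounds[of r s "Suc m"] in \<open>auto intro: mult_left_le_one_le\<close>)
      show "(\<lambda>y. box_bump r s (Suc m) y *\<^sub>R f y) \<in> borel_measurable lborel" for m
        using smooth_measurable[OF box_bump_smooth[of r s "Suc m"]] by measurable
    qed measurable
    then have "(LINT y|lborel. indicator (box r s) y *\<^sub>R f y) = 0"
      by (simp only: z LIMSEQ_const_iff)
    moreover have "indicator (box r s) y *\<^sub>R f y = indicator (box p q) y *\<^sub>R f y" for y
      using rs by (auto simp: f_def indicator_def)
    ultimately show ?thesis by simp
  qed
  have "set_lebesgue_integral lborel A f = 0" if "A \<in> sets lborel" for A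
  proof -
    let ?E = "range (\<lambda>(a, b). box a b :: (real^'n) set)"
    have "Int_stable ?E" by (auto simp: Int_stable_def box_Int_box)
    moreover have "?E \<subseteq> Pow UNIV" by simp
    moreover have "A \<in> sigma_sets UNIV ?E" using that by (simp add: borel_eq_box)
    ultimately show ?thesis
    proof (induction rule: sigma_sets_induct_disjoint)
      case (basic A)
      then show ?case using bx by (auto simp: set_lebesgue_integral_def)
    next
      case empty show ?case by (simp add: set_lebesgue_integral_def)
    next
      case (compl A)
      then have A: "A \<in> sets borel" by (simp add: borel_eq_box)
      have "indicator (box a b) y *\<^sub>R f y = f y" for y by (simp add: f_def indicator_def)
      then have "(LINT y|lborel. f y) = 0" using bx[of a b] by (simp only:)
      moreover have "(LINT y|lborel. indicator (UNIV - A) y *\<^sub>R f y)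
        = (LINT y|lborel. f y - indicator A y *\<^sub>R f y)"
        by (intro Bochner_Integration.integral_cong) (auto simp: indicator_def)
      moreover have "integrable lborel (\<lambda>y. indicator A y *\<^sub>R f y)"
        using A by (intro integrable_mult_indicator fi) simp
      ultimately show ?case using compl fi by (simp add: set_lebesgue_integral_def)
    next
      case (union A)
      then have A: "A i \<in> sets lborel" for i by (auto simp: borel_eq_box)
      have "(LINT y:(\<Union>i. A i)|lborel. f y) = (\<Sum>i. (LINT y:(A i)|lborel. f y))"
      proof (rule lebesgue_integral_countable_add[OF A])
        show "A i \<inter> A j = {}" if "i \<noteq> j" for i j using union(1) that by (auto simp: disjoint_family_on_def)
        show "set_integrable lborel (\<Union>i. A i) f"
          unfolding set_integrable_def using A by (intro integrable_mult_indicator fi) auto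
      qed
      with union show ?case by simp
    qed
  qed
  then have "AE y in lborel. f y = 0" by (rule sigma_finite_measure.density_zero[OF lborel.sigma_finite_measure_axioms fi])
  then have "AE y in lborel. y \<in> box a b \<longrightarrow> G y = 0" by eventually_elim (simp add: f_def indicator_def)
  with ab(2) show "\<exists>N. open N \<and> x \<in> N \<and> (AE y in lborel. y \<in> N \<longrightarrow> G y = 0)"
    by (intro exI[of _ "box a b"]) auto
qed

lemma locally_integrable_diff:
  "locally_integrable f \<Longrightarrow> locally_integrable g \<Longrightarrow> locally_integrable (\<lambda>x. f x - g x)"
  by (simp add: locally_integrable_def set_integral_diff)

lemma AE_eq_of_weakly_eq:
  fixes G H :: "real^'n::finite \<Rightarrow> complex"
  assumes "locally_integrable G" "locally_integrable H"
    and "\<And>u. u \<in> test_functions \<Longrightarrow> (LINT x|lborel. G x * u x) = (LINT x|lborel. H x * u x)"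
  shows "AE x in lborel. G x = H x"
proof -
  have "AE x in lborel. x \<in> UNIV \<longrightarrow> G x - H x = 0"
    by (intro AE_zero_of_weakly_zero locally_integrable_diff assms)
       (simp_all add: left_diff_distrib locally_integrable_test assms)
  then show ?thesis by simp
qed

lemma has_weak_gradient_unique:
  assumes "has_weak_gradient f G" "has_weak_gradient f H"
  shows "AE x in lborel. G x = H x"
proof -
  have "AE x in lborel. G x $ i = H x $ i" for i
    using assms by (intro AE_eq_of_weakly_eq) (auto simp: has_weak_gradient_def)
  then have "AE x in lborel. \<forall>i. G x $ i = H x $ i" by (subst AE_all_countable) auto
  then show ?thesis by eventually_elim (simp add: vec_eq_iff)
qed

section \<open>Functions with vanishing weak gradient\<close>

lemma locally_integrable_shift:
  assumes "locally_integrable w"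
  shows "locally_integrable (\<lambda>x. w (x + v))"
  unfolding locally_integrable_def set_integrable_def
proof (intro allI impI)
  fix K :: "(real^'a) set" assume "compact K"
  then have "compact ((+) v ` K)" by (rule compact_translation)
  then have i: "integrable lborel (\<lambda>x. indicator ((+) v ` K) x *\<^sub>R w x)"
    using assms by (simp add: locally_integrable_def set_integrable_def)
  have "integrable (distr lborel borel ((+) v)) (\<lambda>x. indicator ((+) v ` K) x *\<^sub>R w x)"
    unfolding lborel_distr_plus by (rule i)
  then have "integrable lborel (\<lambda>x. indicator ((+) v ` K) (v + x) *\<^sub>R w (v + x))"
    by (rule integrable_distr[rotated]) simp
  moreover have "indicator ((+) v ` K) (v + x) = (indicator K x :: real)" for x
    by (auto simp: indicator_def)
  ultimately show "integrable lborel (\<lambda>x. indicator K x *\<^sub>R w (x + v))"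
    by (simp add: add.commute)
qed

lemma test_shift:
  assumes "u \<in> test_functions"
  shows "(\<lambda>x. u (x - v)) \<in> test_functions" "partial_deriv i (\<lambda>x. u (x - v)) x = partial_deriv i u (x - v)"
proof -
  have pd: "partial_deriv i (\<lambda>x. g (x - v)) x = partial_deriv i g (x - v)"
    and df: "(\<lambda>x. g (x - v)) differentiable (at x)"
    if "\<And>x. g differentiable (at x)" for g :: "real^'a \<Rightarrow> complex" and i x
  proof -
    have D1: "((\<lambda>x. x - v) has_derivative (\<lambda>h. h)) (at x)"
      by (auto intro!: derivative_eq_intros)
    have "(g has_derivative frechet_derivative g (at (x - v))) (at (x - v))"
      using that frechet_derivative_works by blast
    from has_derivative_compose[OF D1 this]
    have D: "((\<lambda>x. g (x - v)) has_derivative frechet_derivative g (at (x - v))) (at x)" .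
    show "partial_deriv i (\<lambda>x. g (x - v)) x = partial_deriv i g (x - v)"
      using partial_deriv_eq[OF D] by (simp add: partial_deriv_def)
    show "(\<lambda>x. g (x - v)) differentiable (at x)" using D differentiable_def by blast
  qed
  have "C_k k g \<Longrightarrow> C_k k (\<lambda>x. g (x - v))" for k and g :: "real^'a \<Rightarrow> complex"
  proof (induction k arbitrary: g)
    case 0 then show ?case by (auto intro!: continuous_on_compose2[of UNIV g] continuous_intros)
  next
    case (Suc k)
    have d: "g differentiable (at x)" for x using Suc.prems by simp
    have "partial_deriv i (\<lambda>x. g (x - v)) = (\<lambda>x. partial_deriv i g (x - v))" for i
      by (rule ext) (rule pd[OF d])
    with Suc df[OF d] show ?case by simp
  qed
  then have sm: "smooth (\<lambda>x. u (x - v))" using test_smooth[OF assms] by (simp add: smooth_def)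
  show "(\<lambda>x. u (x - v)) \<in> test_functions"
  proof (rule test_functionsI[OF sm])
    show "bounded ((+) v ` {x. u x \<noteq> 0})" using assms by (auto simp: test_functions_iff intro: bounded_translation)
    show "u (x - v) = 0" if "x \<notin> (+) v ` {x. u x \<noteq> 0}" for x
      using that by (auto simp: image_iff)
  qed
  show "partial_deriv i (\<lambda>x. u (x - v)) x = partial_deriv i u (x - v)"
    by (rule pd) (rule smooth_differentiable[OF test_smooth[OF assms]])
qed

text \<open>For a test function \<open>u\<close> supported in the ball of radius \<open>r\<close>,
  its translates by \<open>s *\<^sub>R v\<close> with \<open>s\<close> in \<open>[0,1]\<close> stay
  in the ball of radius \<open>2 * r\<close>. The derivative in \<open>s\<close> of the integral of
  \<open>w\<close> against the translate is therefore 0, and the values at \<open>s = 0\<close> and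
  \<open>s = 1\<close> agree.\<close>

lemma weak_gradient_zero_shift:
  fixes w :: "real^'n::finite \<Rightarrow> complex"
  assumes w: "locally_integrable w"
    and z: "\<And>u i. u \<in> test_functions \<Longrightarrow> closure {x. u x \<noteq> 0} \<subseteq> ball x (2 * r) \<Longrightarrow>
      (LINT x|lborel. w x * partial_deriv i u x) = 0"
    and v: "norm v < r"
  shows "AE y in lborel. y \<in> ball x r \<longrightarrow> w (y + v) = w y"
proof -
  have "AE y in lborel. y \<in> ball x r \<longrightarrow> w (y + v) - w y = 0"
  proof (rule AE_zero_of_weakly_zero[OF open_ball locally_integrable_diff[OF locally_integrable_shift[OF w] w]])
    fix u :: "real^'n \<Rightarrow> complex" assume u: "u \<in> test_functions" and su: "closure {x. u x \<noteq> 0} \<subseteq> ball x r"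
    note ts = test_shift[OF u]
    define \<phi> where "\<phi> s = (LINT x|lborel. w x * u (x - s *\<^sub>R v))" for s
    have "(\<phi> has_vector_derivative 0) (at s within {0..1})" if s: "s \<in> {0..1}" for s
    proof -
      have cl: "closure {y. u (y - s *\<^sub>R v) \<noteq> 0} \<subseteq> ball x (2 * r)"
      proof -
        have "{y. u (y - s *\<^sub>R v) \<noteq> 0} \<subseteq> (+) (s *\<^sub>R v) ` closure {x. u x \<noteq> 0}"
        proof
          fix y assume "y \<in> {y. u (y - s *\<^sub>R v) \<noteq> 0}"
          then have "y - s *\<^sub>R v \<in> closure {x. u x \<noteq> 0}" using closure_subset by fastforce
          then show "y \<in> (+) (s *\<^sub>R v) ` closure {x. u x \<noteq> 0}"
            by (intro image_eqI[of _ _ "y - s *\<^sub>R v"]) auto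
        qed
        then have "closure {y. u (y - s *\<^sub>R v) \<noteq> 0} \<subseteq> (+) (s *\<^sub>R v) ` closure {x. u x \<noteq> 0}"
          by (intro closure_minimal closed_translation) auto
        also have "\<dots> \<subseteq> ball x (2 * r)"
        proof clarsimp
          fix y assume "y \<in> closure {x. u x \<noteq> 0}"
          then have "dist x y < r" using su by auto
          moreover have "norm (s *\<^sub>R v) < r"
          proof -
            have "\<bar>s\<bar> * norm v \<le> 1 * norm v" using s by (intro mult_right_mono) auto
            then show ?thesis using v by simp
          qed
          moreover have "dist x (s *\<^sub>R v + y) \<le> dist x y + norm (s *\<^sub>R v)"
            using dist_triangle[of x "s *\<^sub>R v + y" y] by (simp add: dist_norm)
          ultimately show "dist x (s *\<^sub>R v + y) < 2 * r" by linarith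
        qed
        finally show ?thesis .
      qed
      have "(LINT x|lborel. w x * (\<Sum>i\<in>UNIV. v $ i *\<^sub>R partial_deriv i u (x - s *\<^sub>R v)))
        = (LINT x|lborel. (\<Sum>i\<in>UNIV. v $ i *\<^sub>R (w x * partial_deriv i (\<lambda>y. u (y - s *\<^sub>R v)) x)))"
        by (simp add: ts sum_distrib_left)
      also have "\<dots> = (\<Sum>i\<in>UNIV. v $ i *\<^sub>R (LINT x|lborel. w x * partial_deriv i (\<lambda>y. u (y - s *\<^sub>R v)) x))"
        using locally_integrable_test[OF w test_partial[OF ts(1)]]
        by (subst Bochner_Integration.integral_sum) auto
      also have "\<dots> = 0" by (simp add: z[OF ts(1) cl])
      finally have "(\<phi> has_vector_derivative 0) (at s)"
        using integral_translate_derivative[OF w u, of v s] by (simp add: \<phi>_def[abs_def])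
      then show ?thesis by (rule has_vector_derivative_at_within)
    qed
    then obtain c where "\<And>s. s \<in> {0..1} \<Longrightarrow> \<phi> s = c"
      using has_vector_derivative_zero_constant[of "{0..1}" \<phi>] by (metis convex_real_interval(5))
    from this[of 0] this[of 1] have "(LINT x|lborel. w x * u (x - v)) = (LINT x|lborel. w x * u x)"
      by (simp add: \<phi>_def)
    moreover have "(LINT x|lborel. w (x + v) * u x) = (LINT x|lborel. w x * u (x - v))"
      using lborel_integral_shift[OF borel_measurable_integrable[OF locally_integrable_test[OF w ts(1)[of v]]], of v]
      by simp
    moreover have "integrable lborel (\<lambda>x. w (x + v) * u x)" "integrable lborel (\<lambda>x. w x * u x)"
      using locally_integrable_test[OF locally_integrable_shift[OF w] u] locally_integrable_test[OF w u] by auto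
    ultimately show "(LINT x|lborel. (w (x + v) - w x) * u x) = 0"
      by (simp add: left_diff_distrib)
  qed
  then show ?thesis by eventually_elim auto
qed

text \<open>Fubini exchanges the quantifiers: from "for every \<open>v\<close>, for almost every
  \<open>y\<close>" to "for almost every \<open>y\<close>, for almost every \<open>v\<close>". One
  good \<open>y\<close> then determines \<open>w\<close> almost everywhere on a ball around
  \<open>y\<close>.\<close>

lemma weak_gradient_zero_locally_constant:
  fixes w :: "real^'n::finite \<Rightarrow> complex"
  assumes "open \<Omega>" and w: "locally_integrable w" and m: "w \<in> borel_measurable lborel"
    and z: "\<And>u i. u \<in> test_functions \<Longrightarrow> closure {x. u x \<noteq> 0} \<subseteq> \<Omega> \<Longrightarrow>
      (LINT x|lborel. w x * partial_deriv i u x) = 0"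
    and "x \<in> \<Omega>"
  shows "\<exists>N c. open N \<and> x \<in> N \<and> (AE y in lborel. y \<in> N \<longrightarrow> w y = c)"
proof -
  obtain e where e: "e > 0" "ball x e \<subseteq> \<Omega>" using assms(1,5) open_contains_ball by blast
  define r where "r = e / 2"
  have r: "r > 0" "ball x (2 * r) \<subseteq> \<Omega>" using e by (auto simp: r_def)
  have [measurable]: "w \<in> borel_measurable borel" using m by simp
  have "AE v in lborel. AE y in lborel. norm v < r \<longrightarrow> dist x y < r \<longrightarrow> w (y + v) = w y"
  proof (rule AE_I2)
    fix v :: "real^'n"
    show "AE y in lborel. norm v < r \<longrightarrow> dist x y < r \<longrightarrow> w (y + v) = w y"
    proof (cases "norm v < r")
      case True
      have "AE y in lborel. y \<in> ball x r \<longrightarrow> w (y + v) = w y"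
        by (rule weak_gradient_zero_shift[OF w z True]) (use r(2) in auto)
      then show ?thesis by auto
    qed simp
  qed
  moreover have "{p \<in> space (lborel \<Otimes>\<^sub>M lborel). norm (fst p) < r \<longrightarrow> dist x (snd p) < r \<longrightarrow> w (snd p + fst p) = w (snd p)}
      \<in> sets (lborel \<Otimes>\<^sub>M lborel)"
    by measurable
  ultimately have "AE y in lborel. AE v in lborel. norm v < r \<longrightarrow> dist x y < r \<longrightarrow> w (y + v) = w y"
    by (subst (asm) lborel_pair.AE_commute)
  then have "AE y in lborel. y \<in> ball x r \<longrightarrow> (AE v in lborel. norm v < r \<longrightarrow> w (y + v) = w y)"
  proof eventually_elim
    case (elim y)
    show ?case
    proof
      assume "y \<in> ball x r"
      then have "dist x y < r" by simp
      with elim show "AE v in lborel. norm v < r \<longrightarrow> w (y + v) = w y" by simp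
    qed
  qed
  \<comment> \<open>The point is taken within distance \<open>r\<close> of \<open>x\<close>, so that
    the ball of radius \<open>r\<close> around it contains \<open>x\<close>.\<close>
  from AE_open_nonempty[OF open_ball _ this] r(1) obtain y where
    y: "y \<in> ball x r" "AE v in lborel. norm v < r \<longrightarrow> w (y + v) = w y"
    by (auto simp: ball_eq_empty)
  have "AE z in lborel. z \<in> ball y r \<longrightarrow> w z = w y"
  proof (rule AE_lborel_shift[where c=y])
    show "AE v in lborel. y + v \<in> ball y r \<longrightarrow> w (y + v) = w y"
      using y(2) by eventually_elim (simp add: dist_norm)
    have "w -` {w y} \<inter> space borel \<in> sets borel"
      by (rule measurable_sets[of _ _ borel]) auto
    moreover have "{z. z \<in> ball y r \<longrightarrow> w z = w y} = - ball y r \<union> (w -` {w y} \<inter> space borel)"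
      by auto
    ultimately show "{z. z \<in> ball y r \<longrightarrow> w z = w y} \<in> sets borel" by simp
  qed
  with y(1) show ?thesis by (intro exI[of _ "ball y r"] exI[of _ "w y"]) (auto simp: dist_commute)
qed

text \<open>Two local constants agree wherever the neighbourhoods overlap, because a nonempty open
  overlap is not a null set. Hence the constant is a locally constant function of the centre, and
  connectedness applies.\<close>

lemma weak_gradient_zero_constant:
  fixes w :: "real^'n::finite \<Rightarrow> complex"
  assumes "open \<Omega>" "connected \<Omega>" "locally_integrable w" "w \<in> borel_measurable lborel"
    and "\<And>u i. u \<in> test_functions \<Longrightarrow> closure {x. u x \<noteq> 0} \<subseteq> \<Omega> \<Longrightarrow>
      (LINT x|lborel. w x * partial_deriv i u x) = 0"
  shows "\<exists>c. AE x in lborel. x \<in> \<Omega> \<longrightarrow> w x = c"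
proof -
  obtain N c where N: "\<And>x. x \<in> \<Omega> \<Longrightarrow> open (N x) \<and> x \<in> N x \<and> (AE y in lborel. y \<in> N x \<longrightarrow> w y = c x)"
    using weak_gradient_zero_locally_constant[OF assms(1,3,4,5)] by metis
  have "c constant_on \<Omega>"
  proof (rule locally_constant_imp_constant[OF assms(2)])
    fix a assume a: "a \<in> \<Omega>"
    have "c x = c a" if "x \<in> \<Omega> \<inter> N a" for x
    proof -
      have "AE y in lborel. y \<in> N a \<longrightarrow> w y = c a" "AE y in lborel. y \<in> N x \<longrightarrow> w y = c x"
        using N a that by auto
      then have ae: "AE y in lborel. y \<in> N x \<inter> N a \<longrightarrow> c x = c a" by eventually_elim auto
      have "open (N x \<inter> N a)" "N x \<inter> N a \<noteq> {}" using N a that by blast+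
      from AE_open_nonempty[OF this ae] show ?thesis by simp
    qed
    moreover have "openin (top_of_set \<Omega>) (\<Omega> \<inter> N a)" "a \<in> \<Omega> \<inter> N a"
      using N[OF a] a by (simp_all add: openin_open_Int)
    ultimately show "\<exists>T. openin (top_of_set \<Omega>) T \<and> a \<in> T \<and> (\<forall>x\<in>T. c x = c a)"
      by (intro exI[of _ "\<Omega> \<inter> N a"] conjI ballI)
  qed
  then obtain k where k: "\<And>x. x \<in> \<Omega> \<Longrightarrow> c x = k" by (auto simp: constant_on_def)
  have "AE x in lborel. x \<in> \<Omega> \<longrightarrow> w x = k"
  proof (rule AE_open_cover)
    fix x assume "x \<in> \<Omega>"
    then show "\<exists>M. open M \<and> x \<in> M \<and> (AE y in lborel. y \<in> M \<longrightarrow> w y = k)"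
      using N[of x] k[of x] by (intro exI[of _ "N x"]) simp
  qed
  then show ?thesis by blast
qed

text \<open>A Urysohn function is replaced on \<open>K\<close> by a polynomial, and the polynomial
  is composed with a smooth step. The result is exactly 1 or 0 on open neighbourhoods of the two
  compact pieces, so its derivatives vanish there too.\<close>

lemma smooth_separation:
  fixes S T K :: "(real^'n::finite) set"
  assumes "compact K" "closed S" "closed T" "S \<inter> T = {}"
  obtains h U W where "smooth h" "open U" "S \<inter> K \<subseteq> U" "\<And>x. x \<in> U \<Longrightarrow> h x = (1::real)"
    "open W" "T \<inter> K \<subseteq> W" "\<And>x. x \<in> W \<Longrightarrow> h x = 0"
proof -
  obtain f :: "real^'n \<Rightarrow> real" where f: "continuous_on UNIV f" "\<And>x. x \<in> S \<Longrightarrow> f x = 1" "\<And>x. x \<in> T \<Longrightarrow> f x = 0"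
    using Urysohn[OF assms(2,3,4), of 1 0] by metis
  obtain p where p: "real_polynomial_function p" "\<And>x. x \<in> K \<Longrightarrow> \<bar>f x - p x\<bar> < 1/4"
    using Stone_Weierstrass_real_polynomial_function[OF assms(1) continuous_on_subset[OF f(1)], of "1/4"] by auto
  have sp: "smooth p" using p(1) by (rule smooth_real_polynomial)
  \<comment> \<open>\<open>A\<close> vanishes for \<open>p x \<le> 1/4\<close>, \<open>B\<close> for
    \<open>p x \<ge> 3/4\<close>, and never both, so \<open>A / (A + B)\<close> is a smooth step.
    The approximation error \<open>1/4\<close> places \<open>p\<close> above \<open>3/4\<close> on
    \<open>S \<inter> K\<close> and below \<open>1/4\<close> on \<open>T \<inter> K\<close>.\<close>
  define A where "A x = exp_inv 0 (p x + (-1/4))" for x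
  define B where "B x = exp_inv 0 (3/4 + (-1) * p x)" for x
  have sA: "smooth A" and sB: "smooth B" unfolding A_def B_def
    by (intro smooth_exp_inv smooth_add smooth_mult smooth_const sp)+
  have pos: "A x + B x > 0" for x
  proof (cases "p x > 1/4")
    case True
    then have "A x > 0" by (simp add: A_def exp_inv_def)
    then show ?thesis by (simp add: B_def add_pos_nonneg)
  next
    case False
    then have "B x > 0" by (simp add: B_def exp_inv_def)
    then show ?thesis by (simp add: A_def add_nonneg_pos)
  qed
  have cp: "continuous_on UNIV p" by (rule smooth_continuous[OF sp])
  show thesis
  proof
    show "smooth (\<lambda>x. A x * inverse (A x + B x))"
      by (intro smooth_mult smooth_inverse smooth_add sA sB) (rule less_imp_neq[OF pos, symmetric])
    show "open {x. 3/4 < p x}" "open {x. p x < 1/4}"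
      using cp by (intro open_Collect_less continuous_on_const; simp)+
    show "S \<inter> K \<subseteq> {x. 3/4 < p x}"
    proof
      fix x assume "x \<in> S \<inter> K"
      then have "\<bar>1 - p x\<bar> < 1/4" using p(2)[of x] f(2)[of x] by simp
      then have "3/4 < p x" by linarith
      then show "x \<in> {x. 3/4 < p x}" by simp
    qed
    show "T \<inter> K \<subseteq> {x. p x < 1/4}"
    proof
      fix x assume "x \<in> T \<inter> K"
      then have "\<bar>p x\<bar> < 1/4" using p(2)[of x] f(3)[of x] by simp
      then have "p x < 1/4" by linarith
      then show "x \<in> {x. p x < 1/4}" by simp
    qed
    show "A x * inverse (A x + B x) = 1" if "x \<in> {x. 3/4 < p x}" for x
    proof -
      have "B x = 0" using that by (simp add: B_def exp_inv_def)
      then show ?thesis using pos[of x] by simp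
    qed
    show "A x * inverse (A x + B x) = 0" if "x \<in> {x. p x < 1/4}" for x
      using that by (simp add: A_def exp_inv_def)
  qed
qed

section \<open>Limits of test functions in the energy norm\<close>

text \<open>The Sobolev space as the closure of the test functions, with the gradient carried along
  as a second argument. In this form product and chain rules follow from those for smooth functions
  by passing to limits.\<close>

definition H1 :: "(real^'n::finite \<Rightarrow> complex) \<Rightarrow> (real^'n \<Rightarrow> complex^'n) \<Rightarrow> bool" where
  "H1 f G \<longleftrightarrow> (\<exists>u. (\<forall>k. u k \<in> test_functions) \<and> L2_tendsto u f \<and>
     (\<forall>i. L2_tendsto (\<lambda>k. partial_deriv i (u k)) (\<lambda>x. G x $ i)))"

lemma H1_L2: "H1 f G \<Longrightarrow> f \<in> L2" "H1 f G \<Longrightarrow> (\<lambda>x. G x $ i) \<in> L2"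
  unfolding H1_def L2_tendsto_def by blast+

lemma H1_AE_cong:
  assumes "H1 f G" "g \<in> borel_measurable lborel" "AE x in lborel. f x = g x"
  shows "H1 g G"
  using assms L2_tendsto_AE_cong unfolding H1_def by metis

lemma L2_tendsto_integral:
  assumes "L2_tendsto a f" "L2_tendsto b g"
  shows "(\<lambda>k. LINT x|lborel. a k x * b k x) \<longlonglongrightarrow> (LINT x|lborel. f x * g x)"
  using integral_L2_mult_tendsto[OF assms, of "\<lambda>_ _. 1" "\<lambda>_. 1" 1] by simp

lemma H1_has_weak_gradient:
  assumes "H1 f G" shows "has_weak_gradient f G"
proof -
  obtain u where u: "\<And>k. u k \<in> test_functions" "L2_tendsto u f"
    "\<And>i. L2_tendsto (\<lambda>k. partial_deriv i (u k)) (\<lambda>x. G x $ i)"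
    using assms unfolding H1_def by blast
  have "(LINT x|lborel. f x * partial_deriv i v x) = - (LINT x|lborel. G x $ i * v x)"
    if v: "v \<in> test_functions" for v i
  proof (rule LIMSEQ_unique)
    show "(\<lambda>k. LINT x|lborel. u k x * partial_deriv i v x) \<longlonglongrightarrow> (LINT x|lborel. f x * partial_deriv i v x)"
      by (intro L2_tendsto_integral u L2_tendsto_const test_L2 test_partial v)
    have "(\<lambda>k. - (LINT x|lborel. partial_deriv i (u k) x * v x)) \<longlonglongrightarrow> - (LINT x|lborel. G x $ i * v x)"
      by (intro tendsto_minus L2_tendsto_integral u L2_tendsto_const test_L2 v)
    then show "(\<lambda>k. LINT x|lborel. u k x * partial_deriv i v x) \<longlonglongrightarrow> - (LINT x|lborel. G x $ i * v x)"
      by (simp add: integral_by_parts[OF test_smooth[OF u(1)] v])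
  qed
  then show ?thesis
    using H1_L2[OF assms] by (simp add: has_weak_gradient_def locally_integrable_L2)
qed

definition grad_sq :: "(real^'n::finite \<Rightarrow> complex) \<Rightarrow> real" where
  "grad_sq u = (\<Sum>i\<in>UNIV. (L2_norm (partial_deriv i u))\<^sup>2)"

lemma grad_sq_nonneg [simp]: "0 \<le> grad_sq u"
  by (simp add: grad_sq_def sum_nonneg)

lemma partial_deriv_test_add:
  assumes "u \<in> test_functions" "v \<in> test_functions"
  shows "partial_deriv i (\<lambda>x. u x + v x) = (\<lambda>x. partial_deriv i u x + partial_deriv i v x)"
  by (intro ext partial_deriv_add smooth_differentiable test_smooth assms)

lemma partial_deriv_test_cmult:
  assumes "u \<in> test_functions"
  shows "partial_deriv i (\<lambda>x. c * u x) = (\<lambda>x. c * partial_deriv i u x)"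
  by (intro ext partial_deriv_bounded_linear[OF bounded_linear_mult_right] smooth_differentiable test_smooth assms)

text \<open>Stated for the midpoint, which stays in a convex set of competitors when
  \<open>u\<close> and \<open>v\<close> belong to it.\<close>

lemma grad_sq_parallelogram:
  assumes "u \<in> test_functions" "v \<in> test_functions"
  shows "4 * grad_sq (\<lambda>x. 1/2 * (u x + v x)) + (\<Sum>i\<in>UNIV. (L2_norm (\<lambda>x. partial_deriv i u x - partial_deriv i v x))\<^sup>2)
    = 2 * grad_sq u + 2 * grad_sq v"
proof -
  have "partial_deriv i (\<lambda>x. 1/2 * (u x + v x)) = (\<lambda>x. 1/2 * (partial_deriv i u x + partial_deriv i v x))" for i
    by (simp only: partial_deriv_test_cmult[OF test_add[OF assms]] partial_deriv_test_add[OF assms])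
  then have "4 * (L2_norm (partial_deriv i (\<lambda>x. 1/2 * (u x + v x))))\<^sup>2 =
      (L2_norm (\<lambda>x. partial_deriv i u x + partial_deriv i v x))\<^sup>2" for i
    by (simp only: L2_norm_cmult power_mult_distrib) (simp add: power2_eq_square)
  then have "4 * (L2_norm (partial_deriv i (\<lambda>x. 1/2 * (u x + v x))))\<^sup>2
      + (L2_norm (\<lambda>x. partial_deriv i u x - partial_deriv i v x))\<^sup>2
    = 2 * (L2_norm (partial_deriv i u))\<^sup>2 + 2 * (L2_norm (partial_deriv i v))\<^sup>2" for i
    using L2_parallelogram[OF test_L2[OF test_partial[OF assms(1)]] test_L2[OF test_partial[OF assms(2)]], of i i]
    by simp
  then show ?thesis
    by (simp only: grad_sq_def sum_distrib_left sum.distrib[symmetric])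
qed

text \<open>Almost minimisers of the Dirichlet integral near \<open>f\<close> have Cauchy gradients, by the
  parallelogram identity; this replaces weak compactness.\<close>

lemma H1_of_bounded_gradients:
  fixes f :: "real^'n::finite \<Rightarrow> complex"
  assumes f: "f \<in> L2"
    and approx: "\<And>e. e > 0 \<Longrightarrow> \<exists>u\<in>test_functions. L2_norm (\<lambda>x. u x - f x) < e \<and> grad_sq u \<le> B"
  shows "\<exists>G. H1 f G"
proof -
  \<comment> \<open>Competitors in shrinking balls around \<open>f\<close>. Their infima
    \<open>d n\<close> increase and are bounded by \<open>B\<close>, hence converge.\<close>
  define S where "S n = {v \<in> test_functions. L2_norm (\<lambda>x. v x - f x) \<le> inverse (real (Suc n))}" for n
  define d where "d n = Inf (grad_sq ` S n)" for n
  have ne: "\<exists>v\<in>S n. grad_sq v \<le> B" for n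
    using approx[of "inverse (real (Suc n))"] by (force simp: S_def intro: less_imp_le)
  have bb: "bdd_below (grad_sq ` X)" for X by (rule bdd_belowI[of _ 0]) auto
  have dle: "d n \<le> grad_sq v" if "v \<in> S n" for n v
    unfolding d_def using that bb by (intro cInf_lower) auto
  have dB: "d n \<le> B" for n using ne[of n] dle by force
  have dmono: "d n \<le> d m" if "n \<le> m" for n m
    unfolding d_def
  proof (intro cInf_superset_mono bb image_mono)
    show "grad_sq ` S m \<noteq> {}" using ne[of m] by auto
    show "S m \<subseteq> S n" using that by (force simp: S_def intro: order_trans)
  qed
  have "\<exists>v\<in>S n. grad_sq v < d n + inverse (real (Suc n))" for n
    using cInf_lessD[of "grad_sq ` S n" "d n + inverse (real (Suc n))"] ne[of n]
    by (auto simp: d_def)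
  then obtain v where v: "\<And>n. v n \<in> S n" "\<And>n. grad_sq (v n) < d n + inverse (real (Suc n))"
    by metis
  have vt: "v n \<in> test_functions" for n using v(1) by (simp add: S_def)
  have vf: "L2_norm (\<lambda>x. v n x - f x) \<le> inverse (real (Suc n))" for n using v(1) by (simp add: S_def)
  have "incseq d" using dmono by (simp add: incseq_def)
  then obtain L where L: "d \<longlonglongrightarrow> L" "\<forall>n. d n \<le> L"
    using incseq_convergent[of d B] dB by blast
  then have dL: "d n \<le> L" for n by blast
  \<comment> \<open>For \<open>n \<le> m\<close> the midpoint of \<open>v n\<close> and
    \<open>v m\<close> again competes in \<open>S n\<close>, so its Dirichlet integral is at least
    \<open>d n\<close>. The parallelogram identity then bounds the distance of the gradients by
    quantities that tend to 0.\<close>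
  have key: "(\<Sum>i\<in>UNIV. (L2_norm (\<lambda>x. partial_deriv i (v n) x - partial_deriv i (v m) x))\<^sup>2)
      \<le> 2 * (L - d n) + 4 * inverse (real (Suc n))" if "n \<le> m" for n m
  proof -
    have inv: "inverse (real (Suc m)) \<le> inverse (real (Suc n))" using that by simp
    have "(\<lambda>x. 1/2 * (v n x + v m x)) \<in> S n"
    proof -
      have L2s: "(\<lambda>x. v n x - f x) \<in> L2" "(\<lambda>x. v m x - f x) \<in> L2"
        by (intro L2_diff test_L2 vt f)+
      have "L2_norm (\<lambda>x. 1/2 * (v n x + v m x) - f x) = L2_norm (\<lambda>x. 1/2 * ((v n x - f x) + (v m x - f x)))"
        by (rule arg_cong[of _ _ L2_norm]) (auto simp: field_simps)
      also have "\<dots> \<le> 1/2 * (L2_norm (\<lambda>x. v n x - f x) + L2_norm (\<lambda>x. v m x - f x))"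
        unfolding L2_norm_cmult using L2_norm_triangle[OF L2s] by simp
      also have "\<dots> \<le> inverse (real (Suc n))" using add_mono[OF vf[of n] order_trans[OF vf[of m] inv]] by simp
      finally show ?thesis unfolding S_def
        by (intro CollectI conjI test_cmult test_add vt)
    qed
    note mid = dle[OF this]
    \<comment> \<open>Here \<open>S\<close> and the other letters are real variables:
      \<open>g\<close> stands for the Dirichlet integral of the midpoint, \<open>p\<close> and
      \<open>q\<close> for those of the two near-minimisers, \<open>S\<close> for the squared
      distance of the gradients.\<close>
    have "S \<le> 2 * (L - dn) + 4 * a"
      if "4 * g + S = 2 * p + 2 * q" "p < dn + a" "q < dm + b" "dm \<le> L" "b \<le> a" "dn \<le> g"
      for S g p q dn dm a b :: real
      using that by argo
    from this[OF grad_sq_parallelogram[OF vt vt, of n m] v(2)[of n] v(2)[of m] dL[of m] inv mid]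
    show ?thesis .
  qed
  have "\<exists>g. L2_tendsto (\<lambda>k. partial_deriv i (v k)) g" for i
  proof (rule L2_complete)
    show "partial_deriv i (v k) \<in> L2" for k by (intro test_L2 test_partial vt)
    fix e :: real assume e: "e > 0"
    have "(\<lambda>n. 2 * (L - d n) + 4 * inverse (real (Suc n))) \<longlonglongrightarrow> 2 * (L - L) + 4 * 0"
      by (intro tendsto_intros L(1) LIMSEQ_inverse_real_of_nat)
    then have "\<forall>\<^sub>F n in sequentially. 2 * (L - d n) + 4 * inverse (real (Suc n)) < e\<^sup>2"
      using e by (intro order_tendstoD(2)) auto
    then obtain N where N: "\<And>n. n \<ge> N \<Longrightarrow> 2 * (L - d n) + 4 * inverse (real (Suc n)) < e\<^sup>2"
      by (auto simp: eventually_sequentially)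
    have *: "L2_norm (\<lambda>x. partial_deriv i (v n) x - partial_deriv i (v m) x) < e" if "N \<le> n" "n \<le> m" for n m
    proof (rule power2_less_imp_less)
      have "(L2_norm (\<lambda>x. partial_deriv i (v n) x - partial_deriv i (v m) x))\<^sup>2
        \<le> (\<Sum>i\<in>UNIV. (L2_norm (\<lambda>x. partial_deriv i (v n) x - partial_deriv i (v m) x))\<^sup>2)"
        by (rule member_le_sum) auto
      also have "\<dots> < e\<^sup>2" using key[OF that(2)] N[OF that(1)] by linarith
      finally show "(L2_norm (\<lambda>x. partial_deriv i (v n) x - partial_deriv i (v m) x))\<^sup>2 < e\<^sup>2" .
    qed (use e in simp)
    have "L2_norm (\<lambda>x. partial_deriv i (v n) x - partial_deriv i (v m) x) < e" if "N \<le> n" "N \<le> m" for n m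
      using *[of n m] *[of m n] that L2_norm_minus_commute[of "partial_deriv i (v n)" "partial_deriv i (v m)"]
      by (cases "n \<le> m") auto
    then show "\<exists>N. \<forall>n\<ge>N. \<forall>m\<ge>N. L2_norm (\<lambda>x. partial_deriv i (v n) x - partial_deriv i (v m) x) < e"
      by blast
  qed
  then obtain g where g: "\<And>i. L2_tendsto (\<lambda>k. partial_deriv i (v k)) (g i)" by metis
  have "(\<lambda>k. L2_norm (\<lambda>x. v k x - f x)) \<longlonglongrightarrow> 0"
  proof (rule tendsto_sandwich[OF _ _ tendsto_const LIMSEQ_inverse_real_of_nat])
    show "\<forall>\<^sub>F k in sequentially. L2_norm (\<lambda>x. v k x - f x) \<le> inverse (real (Suc k))"
      by (intro always_eventually allI vf)
  qed simp
  then have "L2_tendsto v f" using f vt by (simp add: L2_tendsto_def test_L2)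
  with g vt have "H1 f (\<lambda>x. \<chi> i. g i x)" unfolding H1_def by (intro exI[of _ v]) simp
  then show ?thesis by blast
qed

text \<open>The projection theorem for a subspace that may fail to be closed: \<open>h\<close> is
  \<open>f\<close> minus its projection onto the closure of \<open>R\<close>, obtained as the limit
  of a minimising sequence. Orthogonality is the vanishing of the first variation.\<close>

lemma L2_orthogonal_complement:
  assumes RL: "R \<subseteq> L2" and Rne: "R \<noteq> {}"
    and Radd: "\<And>r s. r \<in> R \<Longrightarrow> s \<in> R \<Longrightarrow> (\<lambda>x. r x + s x) \<in> R"
    and Rmult: "\<And>r c. r \<in> R \<Longrightarrow> (\<lambda>x. c * r x) \<in> R"
    and f: "f \<in> L2" and d: "\<delta> > 0" "\<And>r. r \<in> R \<Longrightarrow> \<delta> \<le> L2_norm (\<lambda>x. f x - r x)"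
  shows "\<exists>h\<in>L2. L2_norm h > 0 \<and> (\<forall>r\<in>R. L2_inner r h = 0)"
proof -
  define D where "D = Inf ((\<lambda>r. L2_norm (\<lambda>x. f x - r x)) ` R)"
  have Dle: "D \<le> L2_norm (\<lambda>x. f x - r x)" if "r \<in> R" for r
    unfolding D_def using that by (intro cInf_lower bdd_belowI[of _ 0]) auto
  have Dpos: "D > 0"
  proof -
    have "\<delta> \<le> D" unfolding D_def using d(2) Rne by (intro cInf_greatest) auto
    then show ?thesis using d(1) by simp
  qed
  have "\<exists>r\<in>R. (L2_norm (\<lambda>x. f x - r x))\<^sup>2 < D\<^sup>2 + inverse (real (Suc n))" for n
  proof -
    have "D < sqrt (D\<^sup>2 + inverse (real (Suc n)))" using Dpos by (intro real_less_rsqrt) simp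
    then obtain r where r: "r \<in> R" "L2_norm (\<lambda>x. f x - r x) < sqrt (D\<^sup>2 + inverse (real (Suc n)))"
      using cInf_lessD[of "(\<lambda>r. L2_norm (\<lambda>x. f x - r x)) ` R"] Rne unfolding D_def by auto
    have "(L2_norm (\<lambda>x. f x - r x))\<^sup>2 < (sqrt (D\<^sup>2 + inverse (real (Suc n))))\<^sup>2"
      by (rule power_strict_mono[OF r(2)]) auto
    then have "(L2_norm (\<lambda>x. f x - r x))\<^sup>2 < D\<^sup>2 + inverse (real (Suc n))"
      by (simp add: add_nonneg_nonneg)
    with r(1) show ?thesis by blast
  qed
  then obtain r where r: "\<And>n. r n \<in> R" "\<And>n. (L2_norm (\<lambda>x. f x - r n x))\<^sup>2 < D\<^sup>2 + inverse (real (Suc n))"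
    by metis
  have rL: "r n \<in> L2" for n using r(1) RL by blast
  \<comment> \<open>The midpoint of \<open>r n\<close> and \<open>r m\<close> lies in
    \<open>R\<close> and cannot be closer to \<open>f\<close> than \<open>D\<close>; the
    parallelogram identity does the rest.\<close>
  have cau: "(L2_norm (\<lambda>x. r n x - r m x))\<^sup>2 \<le> 2 * inverse (real (Suc n)) + 2 * inverse (real (Suc m))" for n m
  proof -
    have "(\<lambda>x. 1/2 * (r n x + r m x)) \<in> R" by (intro Radd Rmult r)
    then have "D \<le> L2_norm (\<lambda>x. f x - 1/2 * (r n x + r m x))" by (rule Dle)
    then have "D\<^sup>2 \<le> (L2_norm (\<lambda>x. f x - 1/2 * (r n x + r m x)))\<^sup>2" using Dpos by (intro power_mono) auto
    also have "\<dots> = 1/4 * (L2_norm (\<lambda>x. (f x - r n x) + (f x - r m x)))\<^sup>2"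
    proof -
      have "(\<lambda>x. f x - 1/2 * (r n x + r m x)) = (\<lambda>x. 1/2 * ((f x - r n x) + (f x - r m x)))"
        by (auto simp: field_simps)
      then show ?thesis by (simp only: L2_norm_cmult power_mult_distrib) (simp add: power2_eq_square)
    qed
    finally have "4 * D\<^sup>2 \<le> (L2_norm (\<lambda>x. (f x - r n x) + (f x - r m x)))\<^sup>2" by simp
    moreover have "(L2_norm (\<lambda>x. r n x - r m x))\<^sup>2 = (L2_norm (\<lambda>x. (f x - r n x) - (f x - r m x)))\<^sup>2"
      using L2_norm_minus_commute[of "r n" "r m"] by simp
    ultimately show ?thesis
      using L2_parallelogram[OF L2_diff[OF f rL] L2_diff[OF f rL], of n m] r(2)[of n] r(2)[of m] by linarith
  qed
  have "\<exists>p. L2_tendsto r p"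
  proof (rule L2_complete[OF rL])
    fix e :: real assume e: "e > 0"
    obtain N where N: "inverse (real (Suc N)) < e\<^sup>2 / 4"
      using reals_Archimedean[of "e\<^sup>2 / 4"] e by auto
    have "L2_norm (\<lambda>x. r i x - r j x) < e" if "N \<le> i" "N \<le> j" for i j
    proof (rule power2_less_imp_less)
      have "inverse (real (Suc i)) \<le> inverse (real (Suc N))" "inverse (real (Suc j)) \<le> inverse (real (Suc N))"
        using that by auto
      then show "(L2_norm (\<lambda>x. r i x - r j x))\<^sup>2 < e\<^sup>2" using cau[of i j] N by linarith
    qed (use e in simp)
    then show "\<exists>N. \<forall>i\<ge>N. \<forall>j\<ge>N. L2_norm (\<lambda>x. r i x - r j x) < e" by blast
  qed
  then obtain p where p: "L2_tendsto r p" by blast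
  have pL: "p \<in> L2" using p by (simp add: L2_tendsto_def)
  define h where "h x = f x - p x" for x
  have hL: "h \<in> L2" unfolding h_def by (intro L2_diff f pL)
  have conv: "L2_tendsto (\<lambda>k x. f x + (-1) * r k x) h"
    using L2_tendsto_add[OF L2_tendsto_const[OF f] L2_tendsto_cmult[OF p, of "-1"]]
    by (simp add: h_def[abs_def])
  have hD: "L2_norm h \<le> D"
  proof (rule power2_le_imp_le)
    have a: "(\<lambda>k. (L2_norm (\<lambda>x. f x + (-1) * r k x))\<^sup>2) \<longlonglongrightarrow> (L2_norm h)\<^sup>2"
      by (intro tendsto_power L2_norm_tendsto conv)
    have b: "(\<lambda>k. D\<^sup>2 + inverse (real (Suc k))) \<longlonglongrightarrow> D\<^sup>2 + 0"
      by (intro tendsto_intros LIMSEQ_inverse_real_of_nat)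
    have "(L2_norm h)\<^sup>2 \<le> D\<^sup>2 + 0"
      by (rule LIMSEQ_le[OF a b]) (use r(2) in \<open>auto intro: less_imp_le\<close>)
    then show "(L2_norm h)\<^sup>2 \<le> D\<^sup>2" by simp
  qed (use Dpos in simp)
  have low: "D \<le> L2_norm (\<lambda>x. h x - t * s x)" if "s \<in> R" for s t
  proof -
    have sL: "s \<in> L2" using that RL by blast
    have "L2_tendsto (\<lambda>k x. (f x + (-1) * r k x) + (- t) * s x) (\<lambda>x. h x + (- t) * s x)"
      by (intro L2_tendsto_add conv L2_tendsto_const L2_cmult sL)
    from L2_norm_tendsto[OF this] show ?thesis
    proof (intro LIMSEQ_le_const[of _ "L2_norm (\<lambda>x. h x - t * s x)" D] exI[of _ 0] allI impI)
      fix k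
      have "(\<lambda>x. r k x + t * s x) \<in> R" by (intro Radd Rmult r that)
      from Dle[OF this] show "D \<le> L2_norm (\<lambda>x. (f x + (-1) * r k x) + (- t) * s x)"
        by (simp add: algebra_simps)
    qed simp
  qed
  have "L2_norm h > 0" using Dpos low[of "r 0" 0] r(1) by simp
  moreover have "L2_inner s h = 0" if s: "s \<in> R" for s
  proof (rule ccontr)
    define z where "z = L2_inner s h"
    assume "L2_inner s h \<noteq> 0"
    then have z: "cmod z > 0" by (simp add: z_def)
    have sL: "s \<in> L2" using s RL by blast
    \<comment> \<open>A step so short that the quadratic term, of order \<open>\<tau>^2\<close>, is
      beaten by the linear gain; the \<open>+ 1\<close> covers the case of a vanishing norm of
      \<open>s\<close>. The factor \<open>cnj z\<close> in the multiplier \<open>t\<close> makes the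
      linear term real and positive.\<close>
    define \<tau> where "\<tau> = 1 / ((L2_norm s)\<^sup>2 + 1)"
    have "(L2_norm s)\<^sup>2 + 1 > 0" by (simp add: add_nonneg_pos)
    then have \<tau>: "\<tau> > 0" "\<tau> * (L2_norm s)\<^sup>2 < 1" by (auto simp: \<tau>_def)
    define t where "t = of_real \<tau> * cnj z"
    have "D\<^sup>2 \<le> (L2_norm (\<lambda>x. h x - t * s x))\<^sup>2" using Dpos by (intro power_mono low s) auto
    also have "\<dots> = (L2_norm h)\<^sup>2 + (cmod t * L2_norm s)\<^sup>2 - 2 * Re (L2_inner h (\<lambda>x. t * s x))"
      by (simp add: L2_norm_diff_sq[OF hL L2_cmult[OF sL]] L2_norm_cmult)
    also have "L2_inner h (\<lambda>x. t * s x) = of_real (\<tau> * (cmod z)\<^sup>2)"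
    proof -
      have "L2_inner h (\<lambda>x. t * s x) = of_real \<tau> * (z * cnj z)"
        unfolding L2_inner_cmult_right by (simp add: t_def z_def L2_inner_cnj)
      then show ?thesis by (simp only: complex_norm_square of_real_mult)
    qed
    also have "(cmod t * L2_norm s)\<^sup>2 = \<tau> * (\<tau> * (L2_norm s)\<^sup>2) * (cmod z)\<^sup>2"
      using \<tau>(1) by (simp add: t_def norm_mult power_mult_distrib power2_eq_square)
    finally have "D\<^sup>2 \<le> (L2_norm h)\<^sup>2 + \<tau> * (\<tau> * (L2_norm s)\<^sup>2) * (cmod z)\<^sup>2 - 2 * (\<tau> * (cmod z)\<^sup>2)"
      by simp
    moreover have "(L2_norm h)\<^sup>2 \<le> D\<^sup>2" using hD by (intro power_mono) auto
    moreover have "\<tau> * (\<tau> * (L2_norm s)\<^sup>2) * (cmod z)\<^sup>2 < \<tau> * 1 * (cmod z)\<^sup>2"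
      using \<tau> z by (intro mult_strict_right_mono mult_strict_left_mono) auto
    moreover have "\<tau> * (cmod z)\<^sup>2 > 0" using \<tau> z by simp
    ultimately show False by simp
  qed
  ultimately show ?thesis using hL by blast
qed

section \<open>Approximation by test functions of bounded energy\<close>

definition apply_hamiltonian :: "(real^'n::finite \<Rightarrow> real) \<Rightarrow> (real^'n \<Rightarrow> complex) \<Rightarrow> real^'n \<Rightarrow> complex" where
  "apply_hamiltonian V u x = - (1/2) * laplacian u x + of_real (V x) * u x"

lemma hamiltonian_iff: "(u, v) \<in> hamiltonian V \<longleftrightarrow> u \<in> test_functions \<and> v = apply_hamiltonian V u"
  unfolding hamiltonian_def apply_hamiltonian_def[abs_def] by blast

lemma partial_deriv_cnj:
  assumes "u \<in> test_functions"
  shows "partial_deriv i (\<lambda>x. cnj (u x)) = (\<lambda>x. cnj (partial_deriv i u x))"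
  by (intro ext partial_deriv_bounded_linear[OF bounded_linear_cnj] smooth_differentiable test_smooth assms)

lemma test_sum: "(\<And>i. i \<in> I \<Longrightarrow> f i \<in> test_functions) \<Longrightarrow> (\<lambda>x. \<Sum>i\<in>I. f i x) \<in> test_functions"
  by (induction I rule: infinite_finite_induct) (auto intro: test_add test_zero)

lemma test_laplacian: "u \<in> test_functions \<Longrightarrow> laplacian u \<in> test_functions"
  unfolding laplacian_def[abs_def] by (intro test_sum test_partial)

lemma H1_test: "u \<in> test_functions \<Longrightarrow> H1 u (\<lambda>x. \<chi> i. partial_deriv i u x)"
  unfolding H1_def by (intro exI[of _ "\<lambda>_. u"]) (auto intro!: L2_tendsto_const test_L2 test_partial)

section \<open>The quadratic form of the shifted operator\<close>

definition shifted_energy :: "(real^'n::finite \<Rightarrow> real) \<Rightarrow> real \<Rightarrow> (real^'n \<Rightarrow> complex) \<Rightarrow> real" where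
  "shifted_energy V c u = grad_sq u / 2 + (LINT x|lborel. (V x + c) * (cmod (u x))\<^sup>2)"

definition shifted_hamiltonian ::
  "(real^'n::finite \<Rightarrow> real) \<Rightarrow> real \<Rightarrow> (real^'n \<Rightarrow> complex) \<Rightarrow> real^'n \<Rightarrow> complex" where
  "shifted_hamiltonian V c u x = apply_hamiltonian V u x + of_real c * u x"

context
  fixes V :: "real^'n::finite \<Rightarrow> real" and c :: real
  assumes V_cont: "continuous_on UNIV V" and V_lower: "\<And>x. V x + c \<ge> 1"
begin

lemma V_measurable: "V \<in> borel_measurable borel"
  by (rule borel_measurable_continuous_onI[OF V_cont])

text \<open>\<open>V\<close> is bounded on the compact support of \<open>u\<close>, which is all
  that the product sees.\<close>

lemma potential_L2:
  assumes u: "u \<in> test_functions"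
  shows "(\<lambda>x. of_real (V x) * u x) \<in> L2"
proof -
  define K where "K = closure {x. u x \<noteq> 0}"
  have K: "compact K" using u by (simp add: K_def test_functions_iff)
  then have [measurable]: "K \<in> sets borel" by (rule borel_compact)
  have "bounded (V ` K)"
    by (intro compact_imp_bounded compact_continuous_image K continuous_on_subset[OF V_cont]) auto
  then obtain M where M: "\<And>x. x \<in> K \<Longrightarrow> \<bar>V x\<bar> \<le> M" "M > 0"
    unfolding bounded_pos by auto
  note [measurable] = V_measurable
  have "(\<lambda>x. (if x \<in> K then of_real (V x) else 0) * u x) \<in> L2"
  proof (rule L2_mult_bounded[OF test_L2[OF u]])
    show "cmod (if x \<in> K then of_real (V x) else 0) \<le> M" for x using M by auto
  qed measurable
  moreover have "(if x \<in> K then of_real (V x) else 0) * u x = of_real (V x) * u x" for x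
    using closure_subset[of "{x. u x \<noteq> 0}"] by (auto simp: K_def)
  ultimately show ?thesis by simp
qed

lemma shifted_potential_L2:
  assumes u: "u \<in> test_functions" shows "(\<lambda>x. of_real (V x + c) * u x) \<in> L2"
  using L2_add[OF potential_L2[OF u] L2_cmult[OF test_L2[OF u], of "of_real c"]] by (simp add: distrib_right)

lemma apply_hamiltonian_L2:
  assumes u: "u \<in> test_functions" shows "apply_hamiltonian V u \<in> L2"
  unfolding apply_hamiltonian_def[abs_def]
  by (intro L2_add L2_cmult potential_L2 u test_L2 test_laplacian)

lemma shifted_hamiltonian_L2: "u \<in> test_functions \<Longrightarrow> shifted_hamiltonian V c u \<in> L2"
  unfolding shifted_hamiltonian_def[abs_def] by (intro L2_add L2_cmult apply_hamiltonian_L2 test_L2)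

lemma laplacian_lin:
  assumes "u \<in> test_functions" "v \<in> test_functions"
  shows "laplacian (\<lambda>x. u x + v x) x = laplacian u x + laplacian v x"
    "laplacian (\<lambda>x. a * u x) x = a * laplacian u x"
  using assms by (simp_all add: laplacian_def partial_deriv_test_add partial_deriv_test_cmult test_partial
      sum.distrib sum_distrib_left)

lemma shifted_hamiltonian_lin:
  assumes "u \<in> test_functions" "v \<in> test_functions"
  shows "shifted_hamiltonian V c (\<lambda>x. u x + v x) x = shifted_hamiltonian V c u x + shifted_hamiltonian V c v x"
    "shifted_hamiltonian V c (\<lambda>x. a * u x) x = a * shifted_hamiltonian V c u x"
  using assms by (simp_all add: shifted_hamiltonian_def apply_hamiltonian_def laplacian_lin algebra_simps)

text \<open>The defining property of the weak gradient, applied to the test functions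
  \<open>cnj (partial_deriv i u x)\<close>. Only one derivative is moved onto \<open>f\<close>,
  which has no second derivatives.\<close>

lemma form_identity:
  assumes f: "f \<in> L2" and G: "has_weak_gradient f G" "\<And>i. (\<lambda>x. G x $ i) \<in> L2" and u: "u \<in> test_functions"
  shows "L2_inner f (shifted_hamiltonian V c u) =
    (\<Sum>i\<in>UNIV. L2_inner (\<lambda>x. G x $ i) (partial_deriv i u)) / 2 + (LINT x|lborel. f x * (of_real (V x + c) * cnj (u x)))"
proof -
  have i: "(LINT x|lborel. f x * cnj (partial_deriv i (partial_deriv i u) x)) = - L2_inner (\<lambda>x. G x $ i) (partial_deriv i u)" for i
  proof -
    have "(LINT x|lborel. f x * partial_deriv i (\<lambda>x. cnj (partial_deriv i u x)) x) =
        - (LINT x|lborel. G x $ i * cnj (partial_deriv i u x))"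
      using G(1) test_cnj[OF test_partial[OF u]] unfolding has_weak_gradient_def by blast
    then show ?thesis by (simp only: partial_deriv_cnj[OF test_partial[OF u]] L2_inner_def)
  qed
  have eq: "f x * cnj (shifted_hamiltonian V c u x) =
    (- 1/2) * (\<Sum>i\<in>UNIV. f x * cnj (partial_deriv i (partial_deriv i u) x)) + f x * (of_real (V x + c) * cnj (u x))" for x
    by (simp add: shifted_hamiltonian_def apply_hamiltonian_def laplacian_def sum_distrib_left algebra_simps)
  have int1: "integrable lborel (\<lambda>x. f x * cnj (partial_deriv i (partial_deriv i u) x))" for i
    by (intro L2_inner_integrable f test_L2 test_partial u)
  have int2: "integrable lborel (\<lambda>x. f x * (of_real (V x + c) * cnj (u x)))"
    using L2_inner_integrable[OF f shifted_potential_L2[OF u]] by simp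
  have "L2_inner f (shifted_hamiltonian V c u) = (- 1/2) * (\<Sum>i\<in>UNIV. (LINT x|lborel. f x * cnj (partial_deriv i (partial_deriv i u) x)))
     + (LINT x|lborel. f x * (of_real (V x + c) * cnj (u x)))"
    unfolding L2_inner_def eq using int1 int2 by simp
  then show ?thesis unfolding i by (simp add: sum_negf)
qed

lemma test_energy_integrable:
  assumes u: "u \<in> test_functions"
  shows "integrable lborel (\<lambda>x. (V x + c) * (cmod (u x))\<^sup>2)"
proof -
  have "Re (of_real (V x + c) * u x * cnj (u x)) = (V x + c) * (cmod (u x))\<^sup>2" for x
    by (simp only: mult.assoc complex_norm_square[symmetric] of_real_mult[symmetric] Re_complex_of_real)
  then show ?thesis using integrable_Re[OF L2_inner_integrable[OF shifted_potential_L2[OF u] test_L2[OF u]]] by simp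
qed

lemma form_test:
  assumes u: "u \<in> test_functions"
  shows "L2_inner u (shifted_hamiltonian V c u) = of_real (shifted_energy V c u)"
proof -
  have "L2_inner u (shifted_hamiltonian V c u) =
    (\<Sum>i\<in>UNIV. L2_inner (partial_deriv i u) (partial_deriv i u)) / 2 + (LINT x|lborel. u x * (of_real (V x + c) * cnj (u x)))"
    using form_identity[OF test_L2[OF u] H1_has_weak_gradient[OF H1_test[OF u]] H1_L2(2)[OF H1_test[OF u]] u] by simp
  also have "(\<Sum>i\<in>UNIV. L2_inner (partial_deriv i u) (partial_deriv i u)) = of_real (grad_sq u)"
    by (simp only: L2_inner_self grad_sq_def of_real_sum)
  also have "(LINT x|lborel. u x * (of_real (V x + c) * cnj (u x))) = (LINT x|lborel. complex_of_real ((V x + c) * (cmod (u x))\<^sup>2))"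
    by (intro Bochner_Integration.integral_cong refl)
       (simp only: of_real_mult complex_norm_square mult_ac)
  also have "\<dots> = of_real (LINT x|lborel. (V x + c) * (cmod (u x))\<^sup>2)" by (rule integral_complex_of_real)
  finally show ?thesis by (simp add: shifted_energy_def)
qed

text \<open>The purpose of the shift: with \<open>V x + c \<ge> 1\<close> the form dominates the
  squared norm, and its potential part is nonnegative, so that it also dominates the Dirichlet
  integral.\<close>

lemma energy_bounds:
  assumes u: "u \<in> test_functions"
  shows "grad_sq u \<le> 2 * shifted_energy V c u" "(L2_norm u)\<^sup>2 \<le> shifted_energy V c u" "0 \<le> shifted_energy V c u"
proof -
  have "(LINT x|lborel. (cmod (u x))\<^sup>2) \<le> (LINT x|lborel. (V x + c) * (cmod (u x))\<^sup>2)"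
  proof (rule integral_mono[OF L2_integrable[OF test_L2[OF u]] test_energy_integrable[OF u]])
    show "(cmod (u x))\<^sup>2 \<le> (V x + c) * (cmod (u x))\<^sup>2" for x
      using mult_right_mono[OF V_lower[of x], of "(cmod (u x))\<^sup>2"] by simp
  qed
  then have "(L2_norm u)\<^sup>2 \<le> (LINT x|lborel. (V x + c) * (cmod (u x))\<^sup>2)" by (simp only: L2_norm_sq)
  note this order_trans[OF zero_le_power2 this]
  then show "grad_sq u \<le> 2 * shifted_energy V c u" "(L2_norm u)\<^sup>2 \<le> shifted_energy V c u" "0 \<le> shifted_energy V c u"
    using grad_sq_nonneg[of u] unfolding shifted_energy_def by argo+
qed

text \<open>Young's inequality for the form. The constant \<open>B\<close> is the shifted energy of
  \<open>f\<close> itself, hence the same for all \<open>u\<close>; finite energy of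
  \<open>f\<close> is what makes it meaningful.\<close>

lemma form_le:
  assumes f: "finite_energy V f"
  obtains B where "B \<ge> 0" "\<And>u. u \<in> test_functions \<Longrightarrow>
    2 * Re (L2_inner f (shifted_hamiltonian V c u)) \<le> B + shifted_energy V c u"
proof -
  obtain G where fL: "f \<in> L2" and G: "has_weak_gradient f G" "\<And>i. (\<lambda>x. G x $ i) \<in> L2"
    and Vf: "integrable lborel (\<lambda>x. V x * (cmod (f x))\<^sup>2)"
    using f unfolding finite_energy_def by blast
  have Vcf: "integrable lborel (\<lambda>x. (V x + c) * (cmod (f x))\<^sup>2)"
    using Vf L2_integrable[OF fL] by (simp add: distrib_right)
  define B where "B = (\<Sum>i\<in>UNIV. (L2_norm (\<lambda>x. G x $ i))\<^sup>2) / 2 + (LINT x|lborel. (V x + c) * (cmod (f x))\<^sup>2)"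
  have Vpos: "0 \<le> V x + c" for x using V_lower[of x] by simp
  have "B \<ge> 0" unfolding B_def
    by (intro add_nonneg_nonneg divide_nonneg_pos sum_nonneg Bochner_Integration.integral_nonneg mult_nonneg_nonneg Vpos) auto
  moreover have "2 * Re (L2_inner f (shifted_hamiltonian V c u)) \<le> B + shifted_energy V c u" if u: "u \<in> test_functions" for u
  proof -
    have a: "2 * Re (L2_inner (\<lambda>x. G x $ i) (partial_deriv i u)) \<le> (L2_norm (\<lambda>x. G x $ i))\<^sup>2 + (L2_norm (partial_deriv i u))\<^sup>2" for i
      using L2_norm_diff_sq[OF G(2) test_L2[OF test_partial[OF u]], of i i] zero_le_power2[of "L2_norm (\<lambda>x. G x $ i - partial_deriv i u x)"]
      by linarith
    have int: "integrable lborel (\<lambda>x. f x * (of_real (V x + c) * cnj (u x)))"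
      using L2_inner_integrable[OF fL shifted_potential_L2[OF u]] by simp
    have "2 * Re (LINT x|lborel. f x * (of_real (V x + c) * cnj (u x))) = (LINT x|lborel. 2 * Re (f x * (of_real (V x + c) * cnj (u x))))"
      by (simp only: integral_Re[OF int] Bochner_Integration.integral_mult_right_zero)
    also have "\<dots> \<le> (LINT x|lborel. (V x + c) * (cmod (f x))\<^sup>2 + (V x + c) * (cmod (u x))\<^sup>2)"
    proof (rule integral_mono)
      show "integrable lborel (\<lambda>x. 2 * Re (f x * (of_real (V x + c) * cnj (u x))))"
        by (intro integrable_mult_right integrable_Re int)
      show "integrable lborel (\<lambda>x. (V x + c) * (cmod (f x))\<^sup>2 + (V x + c) * (cmod (u x))\<^sup>2)"
        by (intro Bochner_Integration.integrable_add Vcf test_energy_integrable u)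
      fix x
      have "Re (f x * cnj (u x)) \<le> cmod (f x) * cmod (u x)"
        using complex_Re_le_cmod[of "f x * cnj (u x)"] by (simp add: norm_mult)
      moreover have "2 * cmod (f x) * cmod (u x) \<le> (cmod (f x))\<^sup>2 + (cmod (u x))\<^sup>2"
        by (rule sum_squares_bound)
      ultimately have "2 * Re (f x * cnj (u x)) \<le> (cmod (f x))\<^sup>2 + (cmod (u x))\<^sup>2" by linarith
      then have "(V x + c) * (2 * Re (f x * cnj (u x))) \<le> (V x + c) * ((cmod (f x))\<^sup>2 + (cmod (u x))\<^sup>2)"
        by (rule mult_left_mono[OF _ Vpos])
      moreover have "2 * Re (f x * (of_real (V x + c) * cnj (u x))) = (V x + c) * (2 * Re (f x * cnj (u x)))"
      proof -
        have "f x * (of_real (V x + c) * cnj (u x)) = of_real (V x + c) * (f x * cnj (u x))" by (simp only: mult_ac)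
        then show ?thesis by (simp only: Re_complex_of_real times_complex.sel Im_complex_of_real) simp
      qed
      ultimately show "2 * Re (f x * (of_real (V x + c) * cnj (u x))) \<le> (V x + c) * (cmod (f x))\<^sup>2 + (V x + c) * (cmod (u x))\<^sup>2"
        by (simp only: distrib_left)
    qed
    also have "\<dots> = (LINT x|lborel. (V x + c) * (cmod (f x))\<^sup>2) + (LINT x|lborel. (V x + c) * (cmod (u x))\<^sup>2)"
      by (rule Bochner_Integration.integral_add[OF Vcf test_energy_integrable[OF u]])
    finally have b: "2 * Re (LINT x|lborel. f x * (of_real (V x + c) * cnj (u x))) \<le>
      (LINT x|lborel. (V x + c) * (cmod (f x))\<^sup>2) + (LINT x|lborel. (V x + c) * (cmod (u x))\<^sup>2)" .
    have "(\<Sum>i\<in>UNIV. 2 * Re (L2_inner (\<lambda>x. G x $ i) (partial_deriv i u)))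
       \<le> (\<Sum>i\<in>UNIV. (L2_norm (\<lambda>x. G x $ i))\<^sup>2 + (L2_norm (partial_deriv i u))\<^sup>2)"
      by (intro sum_mono a)
    then have "2 * (\<Sum>i\<in>UNIV. Re (L2_inner (\<lambda>x. G x $ i) (partial_deriv i u)))
       \<le> (\<Sum>i\<in>UNIV. (L2_norm (\<lambda>x. G x $ i))\<^sup>2) + grad_sq u"
      by (simp only: sum_distrib_left[symmetric] sum.distrib grad_sq_def)
    moreover have "2 * Re (L2_inner f (shifted_hamiltonian V c u)) =
      (\<Sum>i\<in>UNIV. Re (L2_inner (\<lambda>x. G x $ i) (partial_deriv i u)))
      + 2 * Re (LINT x|lborel. f x * (of_real (V x + c) * cnj (u x)))"
      by (simp add: form_identity[OF fL G u] Re_divide_numeral)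
    ultimately show ?thesis using b unfolding B_def shifted_energy_def by argo
  qed
  ultimately show thesis by (rule that)
qed

text \<open>A vector orthogonal to the range of \<open>1 + \<epsilon> (H + c)\<close> is an eigenvector of the adjoint, hence of
  the closure of \<open>H\<close>, for a negative eigenvalue of \<open>H + c \<ge> 1\<close>.\<close>

lemma resolvent_range_dense:
  assumes esa: "essentially_self_adjoint (hamiltonian V)" and f: "f \<in> L2" and "\<epsilon> > 0" "\<delta> > 0"
  shows "\<exists>u\<in>test_functions. L2_norm (\<lambda>x. f x - (u x + of_real \<epsilon> * shifted_hamiltonian V c u x)) < \<delta>"
proof (rule ccontr)
  define R where "R = (\<lambda>u x. u x + of_real \<epsilon> * shifted_hamiltonian V c u x) ` test_functions"
  assume "\<not> ?thesis"
  then have far: "\<delta> \<le> L2_norm (\<lambda>x. f x - r x)" if "r \<in> R" for r using that by (force simp: R_def)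
  have "\<exists>h\<in>L2. L2_norm h > 0 \<and> (\<forall>r\<in>R. L2_inner r h = 0)"
  proof (rule L2_orthogonal_complement[OF _ _ _ _ f \<open>\<delta> > 0\<close> far])
    show "R \<subseteq> L2" unfolding R_def
      by (intro image_subsetI L2_add L2_cmult) (auto intro: test_L2 shifted_hamiltonian_L2)
    show "R \<noteq> {}" unfolding R_def using test_zero by blast
    show "(\<lambda>x. r x + s x) \<in> R" if rs: "r \<in> R" "s \<in> R" for r s
    proof -
      obtain u v where uv: "u \<in> test_functions" "v \<in> test_functions"
        "r = (\<lambda>x. u x + of_real \<epsilon> * shifted_hamiltonian V c u x)" "s = (\<lambda>x. v x + of_real \<epsilon> * shifted_hamiltonian V c v x)"
        using rs unfolding R_def by blast
      show ?thesis unfolding R_def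
        by (rule image_eqI[OF _ test_add[OF uv(1,2)]]) (simp add: uv(3,4) shifted_hamiltonian_lin(1)[OF uv(1,2)] algebra_simps)
    qed
    show "(\<lambda>x. a * r x) \<in> R" if r: "r \<in> R" for r a
    proof -
      obtain u where u: "u \<in> test_functions" "r = (\<lambda>x. u x + of_real \<epsilon> * shifted_hamiltonian V c u x)"
        using r unfolding R_def by blast
      show ?thesis unfolding R_def
        by (rule image_eqI[OF _ test_cmult[OF u(1)]]) (simp add: u(2) shifted_hamiltonian_lin(2)[OF u(1) u(1)] algebra_simps)
    qed
  qed
  then obtain h where h: "h \<in> L2" "L2_norm h > 0" and orth: "\<And>r. r \<in> R \<Longrightarrow> L2_inner r h = 0" by blast
  \<comment> \<open>The value that orthogonality to the range forces on the adjoint of the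
    Hamiltonian at \<open>h\<close>.\<close>
  define g where "g x = of_real (- (1/\<epsilon> + c)) * h x" for x
  have gL: "g \<in> L2" unfolding g_def by (rule L2_cmult[OF h(1)])
  have adj: "L2_inner (apply_hamiltonian V u) h = L2_inner u g" if u: "u \<in> test_functions" for u
  proof -
    have L: "u \<in> L2" "apply_hamiltonian V u \<in> L2" using u by (auto intro: test_L2 apply_hamiltonian_L2)
    have "L2_inner (\<lambda>x. u x + of_real \<epsilon> * (apply_hamiltonian V u x + of_real c * u x)) h = 0"
      using orth u unfolding R_def shifted_hamiltonian_def[abs_def] by blast
    then have "L2_inner u h + of_real \<epsilon> * (L2_inner (apply_hamiltonian V u) h + of_real c * L2_inner u h) = 0"
      using L h(1) by (simp add: L2_inner_add_left L2_inner_cmult_left L2_add L2_cmult)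
    then have "L2_inner (apply_hamiltonian V u) h = of_real (- (1/\<epsilon> + c)) * L2_inner u h"
      using \<open>\<epsilon> > 0\<close> by (simp add: field_simps eq_neg_iff_add_eq_0)
    then show ?thesis unfolding g_def L2_inner_cmult_right by simp
  qed
  have "(h, g) \<in> op_adjoint (op_closure (hamiltonian V))"
    unfolding op_adjoint_def
  proof (clarsimp simp: h gL)
    fix u v assume "(u, v) \<in> op_closure (hamiltonian V)"
    then obtain a b where ab: "\<And>k. (a k, b k) \<in> hamiltonian V" and uv: "u \<in> L2" "v \<in> L2"
      "(\<lambda>k::nat. L2_norm (\<lambda>x. a k x - u x)) \<longlonglongrightarrow> 0" "(\<lambda>k. L2_norm (\<lambda>x. b k x - v x)) \<longlonglongrightarrow> 0"
      unfolding op_closure_def by blast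
    have at: "a k \<in> test_functions" and b: "b k = apply_hamiltonian V (a k)" for k
      using ab[of k] by (auto simp: hamiltonian_iff)
    have A: "L2_tendsto a u" "L2_tendsto b v"
      using uv at b by (auto simp: L2_tendsto_def test_L2 apply_hamiltonian_L2)
    have "(\<lambda>k. L2_inner (b k) h) \<longlonglongrightarrow> L2_inner v h"
      by (intro L2_inner_tendsto A L2_tendsto_const h)
    moreover have "(\<lambda>k. L2_inner (a k) g) \<longlonglongrightarrow> L2_inner u g"
      by (intro L2_inner_tendsto A L2_tendsto_const gL)
    moreover have "L2_inner (b k) h = L2_inner (a k) g" for k using adj[OF at] b by simp
    ultimately show "L2_inner v h = L2_inner u g" using LIMSEQ_unique by simp
  qed
  \<comment> \<open>Self-adjointness of the closure enters here. It makes \<open>h\<close> a limit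
    of test functions on which the Hamiltonian converges as well, so that the nonnegative form can
    be evaluated along them.\<close>
  then have "(h, g) \<in> op_closure (hamiltonian V)"
    using esa by (simp add: essentially_self_adjoint_def self_adjoint_def)
  then obtain a b where ab: "\<And>k. (a k, b k) \<in> hamiltonian V" and
      hg: "(\<lambda>k::nat. L2_norm (\<lambda>x. a k x - h x)) \<longlonglongrightarrow> 0" "(\<lambda>k. L2_norm (\<lambda>x. b k x - g x)) \<longlonglongrightarrow> 0"
      unfolding op_closure_def by blast
  have at: "a k \<in> test_functions" and b: "b k = apply_hamiltonian V (a k)" for k
    using ab[of k] by (auto simp: hamiltonian_iff)
  have A: "L2_tendsto a h" "L2_tendsto b g"
    using hg at b h gL by (auto simp: L2_tendsto_def test_L2 apply_hamiltonian_L2)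
  have "(\<lambda>k. L2_inner (a k) (\<lambda>x. b k x + of_real c * a k x)) \<longlonglongrightarrow> L2_inner h (\<lambda>x. g x + of_real c * h x)"
    by (intro L2_inner_tendsto L2_tendsto_add L2_tendsto_cmult A)
  moreover have "L2_inner (a k) (\<lambda>x. b k x + of_real c * a k x) = of_real (shifted_energy V c (a k))" for k
    using form_test[OF at] by (simp add: shifted_hamiltonian_def[abs_def] b)
  moreover have "L2_inner h (\<lambda>x. g x + of_real c * h x) = of_real (- (1/\<epsilon>) * (L2_norm h)\<^sup>2)"
  proof -
    have "(\<lambda>x. g x + of_real c * h x) = (\<lambda>x. of_real (- (1/\<epsilon>)) * h x)" by (auto simp: g_def algebra_simps)
    then show ?thesis by (simp only: L2_inner_cmult_right L2_inner_self of_real_mult complex_cnj_complex_of_real)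
  qed
  ultimately have "(\<lambda>k. complex_of_real (shifted_energy V c (a k))) \<longlonglongrightarrow> of_real (- (1/\<epsilon>) * (L2_norm h)\<^sup>2)"
    by simp
  then have "(\<lambda>k. shifted_energy V c (a k)) \<longlonglongrightarrow> - (1/\<epsilon>) * (L2_norm h)\<^sup>2"
    by (simp only: tendsto_of_real_iff)
  then have "0 \<le> - (1/\<epsilon>) * (L2_norm h)\<^sup>2"
    by (rule LIMSEQ_le_const) (use energy_bounds(3)[OF at] in blast)
  moreover have "(1/\<epsilon>) * (L2_norm h)\<^sup>2 > 0" using h(2) \<open>\<epsilon> > 0\<close> by (intro mult_pos_pos) auto
  ultimately show False by simp
qed

text \<open>Let \<open>u + \<epsilon> (H + c) u\<close> be close to \<open>f\<close>. Pairing with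
  \<open>(H + c) u\<close> produces the form \<open>q\<close> of \<open>u\<close> plus
  \<open>\<epsilon> * n\<^sup>2\<close>, where \<open>n\<close> is the norm of
  \<open>(H + c) u\<close>; by \<open>form_le\<close> twice the pairing is at most
  \<open>B + q\<close>. This bounds \<open>q\<close> uniformly in \<open>\<epsilon>\<close>, and
  \<open>\<epsilon> * n\<close> by a multiple of the square root of \<open>\<epsilon>\<close> for
  small \<open>\<epsilon>\<close>.\<close>

lemma finite_energy_approx:
  assumes esa: "essentially_self_adjoint (hamiltonian V)" and f: "finite_energy V f"
  shows "\<exists>B. \<forall>e>0. \<exists>u\<in>test_functions. L2_norm (\<lambda>x. f x - u x) < e \<and> shifted_energy V c u \<le> B"
proof -
  obtain B where B: "B \<ge> 0" "\<And>u. u \<in> test_functions \<Longrightarrow>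
    2 * Re (L2_inner f (shifted_hamiltonian V c u)) \<le> B + shifted_energy V c u"
    using form_le[OF f] by blast
  have fL: "f \<in> L2" using f by (simp add: finite_energy_def)
  have est: "\<exists>u\<in>test_functions. L2_norm (\<lambda>x. f x - u x) \<le> \<epsilon> + sqrt (\<epsilon> * (B + \<epsilon>)) \<and> shifted_energy V c u \<le> B + \<epsilon>"
    if e: "\<epsilon> > 0" for \<epsilon>
  proof -
    \<comment> \<open>The tolerance is \<open>\<epsilon>\<close> itself, so that the error
      \<open>w\<close> contributes at most \<open>\<epsilon> * n\<close> to the pairing and can be
      absorbed.\<close>
    obtain u where u: "u \<in> test_functions"
      and near: "L2_norm (\<lambda>x. f x - (u x + of_real \<epsilon> * shifted_hamiltonian V c u x)) < \<epsilon>"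
      using resolvent_range_dense[OF esa fL e e] by blast
    define w where "w x = f x - (u x + of_real \<epsilon> * shifted_hamiltonian V c u x)" for x
    define n where "n = L2_norm (shifted_hamiltonian V c u)"
    define q where "q = shifted_energy V c u"
    have L: "u \<in> L2" "shifted_hamiltonian V c u \<in> L2" "w \<in> L2"
      unfolding w_def by (intro L2_diff L2_add L2_cmult fL test_L2[OF u] shifted_hamiltonian_L2[OF u])+
    have n0: "n \<ge> 0" by (simp add: n_def)
    have "f = (\<lambda>x. w x + (u x + of_real \<epsilon> * shifted_hamiltonian V c u x))" by (auto simp: w_def)
    then have "L2_inner f (shifted_hamiltonian V c u) = L2_inner (\<lambda>x. w x + (u x + of_real \<epsilon> * shifted_hamiltonian V c u x)) (shifted_hamiltonian V c u)"
      by simp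
    also have "\<dots> = L2_inner w (shifted_hamiltonian V c u) + (of_real q + of_real \<epsilon> * of_real (n\<^sup>2))"
      using L by (simp add: L2_inner_add_left L2_inner_cmult_left L2_add L2_cmult form_test[OF u] q_def n_def L2_inner_self)
    finally have "Re (L2_inner f (shifted_hamiltonian V c u)) = Re (L2_inner w (shifted_hamiltonian V c u)) + q + \<epsilon> * n\<^sup>2" by simp
    moreover have "- (\<epsilon> * n) \<le> Re (L2_inner w (shifted_hamiltonian V c u))"
    proof -
      have "\<bar>Re (L2_inner w (shifted_hamiltonian V c u))\<bar> \<le> L2_norm w * n"
        using abs_Re_le_cmod[of "L2_inner w (shifted_hamiltonian V c u)"] L2_inner_le[OF L(3,2)] unfolding n_def by linarith
      also have "\<dots> \<le> \<epsilon> * n" using near n0 unfolding w_def by (intro mult_right_mono) auto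
      finally show ?thesis by linarith
    qed
    ultimately have "2 * (q + \<epsilon> * n\<^sup>2 - \<epsilon> * n) \<le> B + q" using B(2)[OF u] unfolding q_def by argo
    \<comment> \<open>Absorbs the error into half of the term
      \<open>2 * \<epsilon> * n\<^sup>2\<close>, at the cost of one
      \<open>\<epsilon>\<close>.\<close>
    moreover have "2 * (\<epsilon> * n) \<le> \<epsilon> + \<epsilon> * n\<^sup>2"
    proof -
      have "0 \<le> \<epsilon> * (n - 1)\<^sup>2" using e by simp
      then show ?thesis by (simp add: power2_diff algebra_simps)
    qed
    ultimately have main: "q + \<epsilon> * n\<^sup>2 \<le> B + \<epsilon>" by argo
    have q0: "q \<ge> 0" using energy_bounds(3)[OF u] by (simp add: q_def)
    have "\<epsilon> * n\<^sup>2 \<ge> 0" using e by simp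
    then have qB: "q \<le> B + \<epsilon>" using main by linarith
    have "(\<epsilon> * n)\<^sup>2 \<le> \<epsilon> * (B + \<epsilon>)"
    proof -
      have "\<epsilon> * (\<epsilon> * n\<^sup>2) \<le> \<epsilon> * (B + \<epsilon>)" using main q0 e by (intro mult_left_mono) auto
      then show ?thesis by (simp add: power2_eq_square mult_ac)
    qed
    then have en: "\<epsilon> * n \<le> sqrt (\<epsilon> * (B + \<epsilon>))" by (rule real_le_rsqrt)
    have "(\<lambda>x. f x - u x) = (\<lambda>x. w x + of_real \<epsilon> * shifted_hamiltonian V c u x)" by (auto simp: w_def)
    then have "L2_norm (\<lambda>x. f x - u x) \<le> L2_norm w + \<epsilon> * n"
      using L2_norm_triangle[OF L(3) L2_cmult[OF L(2), of "of_real \<epsilon>"]] L2_norm_cmult[of "of_real \<epsilon>" "shifted_hamiltonian V c u"] e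
      by (simp add: n_def)
    also have "\<dots> \<le> \<epsilon> + sqrt (\<epsilon> * (B + \<epsilon>))" using near en unfolding w_def by linarith
    finally show ?thesis using u qB unfolding q_def by blast
  qed
  show ?thesis
  proof (intro exI[of _ "B + 1"] allI impI)
    fix e :: real assume e: "e > 0"
    \<comment> \<open>Any \<open>\<epsilon>\<close> close enough to 0 will do; the restriction
      \<open>\<epsilon> < 1\<close> turns the energy bound \<open>B + \<epsilon>\<close> into the
      fixed \<open>B + 1\<close>.\<close>
    have "((\<lambda>\<epsilon>. \<epsilon> + sqrt (\<epsilon> * (B + \<epsilon>))) \<longlongrightarrow> 0 + sqrt (0 * (B + 0))) (at_right 0)"
      by (intro tendsto_intros)
    then have "\<forall>\<^sub>F \<epsilon> in at_right 0. \<epsilon> + sqrt (\<epsilon> * (B + \<epsilon>)) < e"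
      using e by (intro order_tendstoD(2)) auto
    moreover have "\<forall>\<^sub>F \<epsilon> in at_right 0. \<epsilon> \<in> {0<..<1::real}"
      by (rule eventually_at_right_real) simp
    ultimately have "\<forall>\<^sub>F \<epsilon> in at_right 0. \<epsilon> + sqrt (\<epsilon> * (B + \<epsilon>)) < e \<and> \<epsilon> < 1 \<and> \<epsilon> > 0"
      by eventually_elim simp
    then obtain \<epsilon> where eps: "\<epsilon> + sqrt (\<epsilon> * (B + \<epsilon>)) < e" "\<epsilon> < 1" "\<epsilon> > 0"
      using eventually_happens trivial_limit_at_right_real by blast
    from est[OF eps(3)] eps(1,2)
    show "\<exists>u\<in>test_functions. L2_norm (\<lambda>x. f x - u x) < e \<and> shifted_energy V c u \<le> B + 1" by force
  qed
qed

end

section \<open>The evolution preserves finite Dirichlet energy\<close>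

lemma unitary_group_L2: "unitary_group U \<Longrightarrow> f \<in> L2 \<Longrightarrow> U t f \<in> L2"
  by (simp add: unitary_group_def)

lemma unitary_group_lincomb:
  assumes "unitary_group U" "f \<in> L2" "g \<in> L2"
  shows "AE x in lborel. U t (\<lambda>y. a * f y + b * g y) x = a * U t f x + b * U t g x"
  using assms by (simp add: unitary_group_def)

lemma unitary_group_inner:
  "unitary_group U \<Longrightarrow> f \<in> L2 \<Longrightarrow> g \<in> L2 \<Longrightarrow> L2_inner (U t f) (U t g) = L2_inner f g"
  by (simp add: unitary_group_def)

lemma unitary_group_add:
  assumes "unitary_group U" "f \<in> L2"
  shows "AE x in lborel. U (s + t) f x = U s (U t f) x"
  using assms by (simp add: unitary_group_def)

lemma unitary_group_norm:
  assumes "unitary_group U" "f \<in> L2"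
  shows "L2_norm (U t f) = L2_norm f"
proof -
  have "complex_of_real ((L2_norm (U t f))\<^sup>2) = of_real ((L2_norm f)\<^sup>2)"
    using unitary_group_inner[OF assms assms(2)] by (simp only: L2_inner_self)
  then have "(L2_norm (U t f))\<^sup>2 = (L2_norm f)\<^sup>2" by (simp only: of_real_eq_iff)
  then show ?thesis by simp
qed

lemma unitary_group_diff:
  assumes U: "unitary_group U" and "f \<in> L2" "g \<in> L2"
  shows "AE x in lborel. U t (\<lambda>y. f y - g y) x = U t f x - U t g x"
  using unitary_group_lincomb[OF assms, of t 1 "-1"] by simp

lemma unitary_group_dist:
  assumes U: "unitary_group U" and L: "f \<in> L2" "g \<in> L2"
  shows "L2_norm (\<lambda>x. U t f x - U t g x) = L2_norm (\<lambda>x. f x - g x)"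
proof -
  have "L2_norm (\<lambda>x. U t f x - U t g x) = L2_norm (U t (\<lambda>y. f y - g y))"
    using unitary_group_diff[OF U L, of t]
    by (intro L2_norm_AE_cong L2_measurable L2_diff unitary_group_L2[OF U] L) auto
  also have "\<dots> = L2_norm (\<lambda>x. f x - g x)" by (rule unitary_group_norm[OF U L2_diff[OF L]])
  finally show ?thesis .
qed

text \<open>The difference quotient of the orbit of \<open>U t u\<close> is the image under
  \<open>U t\<close> of that of \<open>u\<close>, by linearity and the group law. Since
  \<open>U t\<close> is isometric, both have the same distance from their candidate derivatives, for
  every \<open>h\<close>.\<close>

lemma generator_commutes:
  assumes U: "unitary_group U" and gen: "generated_by U A" and uv: "(u, v) \<in> A"
  shows "(U t u, U t v) \<in> A"
proof -
  have gen': "(f, g) \<in> A \<longleftrightarrow> f \<in> L2 \<and> g \<in> L2 \<and>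
      ((\<lambda>h. L2_norm (\<lambda>x. (U h f x - f x) / of_real h - (- \<i> * g x))) \<longlongrightarrow> 0) (at 0)" for f g
    using gen unfolding generated_by_def by blast
  have L: "u \<in> L2" "v \<in> L2" using uv gen' by auto
  have "L2_norm (\<lambda>x. (U h (U t u) x - U t u x) / of_real h - (- \<i> * U t v x))
      = L2_norm (\<lambda>x. (U h u x - u x) / of_real h - (- \<i> * v x))" for h
  proof -
    \<comment> \<open>The quotient written as a linear combination, the shape in which linearity of
      \<open>U t\<close> is available. The laws of the group hold only almost everywhere, so the
      norms are compared up to null sets.\<close>
    define q where "q = (\<lambda>x. (1 / of_real h) * (U h u x - u x) + \<i> * v x)"
    have UL: "U s u \<in> L2" "U s v \<in> L2" "U s (U r u) \<in> L2" for s r using L by (auto intro: unitary_group_L2[OF U])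
    have dL: "(\<lambda>x. U h u x - u x) \<in> L2" by (intro L2_diff UL L)
    have qL: "q \<in> L2" unfolding q_def by (intro L2_add L2_cmult dL L)
    have "L2_norm (\<lambda>x. (U h u x - u x) / of_real h - (- \<i> * v x)) = L2_norm q"
      by (simp add: q_def)
    also have "\<dots> = L2_norm (U t q)" by (rule unitary_group_norm[OF U qL, symmetric])
    also have "\<dots> = L2_norm (\<lambda>x. (U h (U t u) x - U t u x) / of_real h - (- \<i> * U t v x))"
    proof (rule L2_norm_AE_cong)
      show "U t q \<in> borel_measurable lborel" by (intro L2_measurable unitary_group_L2[OF U] qL)
      have "(\<lambda>x. (1 / of_real h) * (U h (U t u) x - U t u x) + \<i> * U t v x) \<in> L2"
        by (intro L2_add L2_cmult L2_diff UL)
      from L2_measurable[OF this]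
      show "(\<lambda>x. (U h (U t u) x - U t u x) / of_real h - (- \<i> * U t v x)) \<in> borel_measurable lborel"
        by simp
      have 1: "AE x in lborel. U t q x = (1 / of_real h) * U t (\<lambda>x. U h u x - u x) x + \<i> * U t v x"
        unfolding q_def by (rule unitary_group_lincomb[OF U dL L(2)])
      have 2: "AE x in lborel. U t (\<lambda>x. U h u x - u x) x = U t (U h u) x - U t u x"
        by (rule unitary_group_diff[OF U UL(1) L(1)])
      have 3: "AE x in lborel. U (t + h) u x = U t (U h u) x"
        by (rule unitary_group_add[OF U L(1)])
      have 4: "AE x in lborel. U (t + h) u x = U h (U t u) x"
        using unitary_group_add[OF U L(1), of h t] by (simp add: add.commute)
      show "AE x in lborel. U t q x = (U h (U t u) x - U t u x) / of_real h - (- \<i> * U t v x)"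
        using 1 2 3 4 by eventually_elim simp
    qed
    finally show ?thesis by simp
  qed
  then show ?thesis using uv L unfolding gen' by (simp add: unitary_group_L2[OF U])
qed

lemma C11_loc_continuous: "C11_loc V \<Longrightarrow> continuous_on UNIV V"
  unfolding C11_loc_def gderiv_def
  by (meson continuous_at_imp_continuous_on has_derivative_continuous)

text \<open>Energy conservation for test functions: \<open>U t u\<close> lies in the domain of the
  closure, so test functions \<open>a k\<close> approximate it in the graph norm, and their forms
  converge to the form of \<open>u\<close>. Approximating \<open>f\<close> by such \<open>u\<close>
  with bounded energy yields test functions near \<open>U t f\<close> with bounded
  gradients.\<close>

lemma evolution_H1:
  fixes V :: "real^'n::finite \<Rightarrow> real"
  assumes V: "C11_loc V" "bdd_below (range V)" and esa: "essentially_self_adjoint (hamiltonian V)"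
    and U: "unitary_group U" and gen: "generated_by U (op_closure (hamiltonian V))"
    and f: "finite_energy V f"
  shows "\<exists>G. H1 (U t f) G"
proof -
  have Vc: "continuous_on UNIV V" by (rule C11_loc_continuous[OF V(1)])
  obtain m where m: "\<And>x. m \<le> V x" using V(2) unfolding bdd_below_def by auto
  \<comment> \<open>Normalises the lower bound of \<open>V + c\<close> to 1.\<close>
  define c where "c = 1 - m"
  have lower: "V x + c \<ge> 1" for x using m[of x] by (simp add: c_def)
  have fL: "f \<in> L2" using f by (simp add: finite_energy_def)
  obtain B where B: "\<And>e. e > 0 \<Longrightarrow> \<exists>u\<in>test_functions. L2_norm (\<lambda>x. f x - u x) < e \<and> shifted_energy V c u \<le> B"
    using finite_energy_approx[OF Vc lower esa f] by blast
  show ?thesis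
  proof (rule H1_of_bounded_gradients[where B="2 * (B + 1)"])
    show "U t f \<in> L2" by (rule unitary_group_L2[OF U fL])
    fix e :: real assume e: "e > 0"
    obtain u where u: "u \<in> test_functions" "L2_norm (\<lambda>x. f x - u x) < e / 2" "shifted_energy V c u \<le> B"
      using B[of "e / 2"] e by auto
    define H where "H = apply_hamiltonian V"
    have L: "u \<in> L2" "H u \<in> L2"
      unfolding H_def by (rule test_L2[OF u(1)], rule apply_hamiltonian_L2[OF Vc lower u(1)])
    have "(u, H u) \<in> op_closure (hamiltonian V)"
    proof -
      have "(u, H u) \<in> hamiltonian V" using u(1) by (simp add: hamiltonian_iff H_def)
      then have "\<exists>a b. (\<forall>k. (a k, b k) \<in> hamiltonian V) \<and> (\<lambda>k::nat. L2_norm (\<lambda>x. a k x - u x)) \<longlonglongrightarrow> 0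
          \<and> (\<lambda>k. L2_norm (\<lambda>x. b k x - H u x)) \<longlonglongrightarrow> 0"
        by - (rule exI[of _ "\<lambda>_. u"], rule exI[of _ "\<lambda>_. H u"], simp add: L2_norm_def)
      then show ?thesis unfolding op_closure_def using L by simp
    qed
    then have "(U t u, U t (H u)) \<in> op_closure (hamiltonian V)" by (rule generator_commutes[OF U gen])
    \<comment> \<open>\<open>U t u\<close> need not be a test function, so its energy is read off
      from approximants in the graph of the Hamiltonian.\<close>
    then obtain a b where ab: "\<And>k. (a k, b k) \<in> hamiltonian V" and
      lim: "(\<lambda>k::nat. L2_norm (\<lambda>x. a k x - U t u x)) \<longlonglongrightarrow> 0" "(\<lambda>k. L2_norm (\<lambda>x. b k x - U t (H u) x)) \<longlonglongrightarrow> 0"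
      unfolding op_closure_def by blast
    have at: "a k \<in> test_functions" and b: "b k = H (a k)" for k
      using ab[of k] by (auto simp: hamiltonian_iff H_def)
    have A: "L2_tendsto a (U t u)" "L2_tendsto b (U t (H u))"
      using lim at b L by (auto simp: L2_tendsto_def test_L2 H_def apply_hamiltonian_L2[OF Vc lower] unitary_group_L2[OF U])
    have energy: "L2_inner w (\<lambda>x. H w x + of_real c * w x) = of_real (shifted_energy V c w)" if "w \<in> test_functions" for w
      using form_test[OF Vc lower that] by (simp add: shifted_hamiltonian_def[abs_def] H_def)
    have "(\<lambda>k. L2_inner (a k) (\<lambda>x. b k x + of_real c * a k x)) \<longlonglongrightarrow> L2_inner (U t u) (\<lambda>x. U t (H u) x + of_real c * U t u x)"
      by (intro L2_inner_tendsto L2_tendsto_add L2_tendsto_cmult A)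
    \<comment> \<open>Conservation of energy: both arguments of the inner product are evolved by the
      same \<open>U t\<close>.\<close>
    moreover have "L2_inner (U t u) (\<lambda>x. U t (H u) x + of_real c * U t u x) = L2_inner u (\<lambda>x. H u x + of_real c * u x)"
      using L by (simp add: L2_inner_add_right L2_inner_cmult_right L2_cmult unitary_group_L2[OF U] unitary_group_inner[OF U])
    ultimately have "(\<lambda>k. complex_of_real (shifted_energy V c (a k))) \<longlonglongrightarrow> of_real (shifted_energy V c u)"
      by (simp only: b energy[OF at] energy[OF u(1)])
    then have "(\<lambda>k. shifted_energy V c (a k)) \<longlonglongrightarrow> shifted_energy V c u" by (simp only: tendsto_of_real_iff)
    then have "\<forall>\<^sub>F k in sequentially. shifted_energy V c (a k) < B + 1"
      using u(3) by (intro order_tendstoD(2)) auto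
    moreover have "\<forall>\<^sub>F k in sequentially. L2_norm (\<lambda>x. a k x - U t u x) < e / 2"
      using lim(1) e by (intro order_tendstoD(2)) auto
    ultimately have "\<forall>\<^sub>F k in sequentially. shifted_energy V c (a k) < B + 1 \<and> L2_norm (\<lambda>x. a k x - U t u x) < e / 2"
      by eventually_elim simp
    then obtain k where k: "shifted_energy V c (a k) < B + 1" "L2_norm (\<lambda>x. a k x - U t u x) < e / 2"
      using eventually_happens' sequentially_bot by blast
    have "L2_norm (\<lambda>x. a k x - U t f x) \<le> L2_norm (\<lambda>x. a k x - U t u x) + L2_norm (\<lambda>x. U t u x - U t f x)"
      by (intro L2_norm_triangle_diff test_L2 at unitary_group_L2[OF U] L fL)
    also have "\<dots> < e" using k(2) u(2) L2_norm_minus_commute[of u f] unitary_group_dist[OF U L(1) fL, of t] by simp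
    finally have "L2_norm (\<lambda>x. a k x - U t f x) < e" .
    moreover have "grad_sq (a k) \<le> 2 * (B + 1)" using energy_bounds(1)[OF Vc lower at[of k]] k(1) by simp
    ultimately show "\<exists>u\<in>test_functions. L2_norm (\<lambda>x. u x - U t f x) < e \<and> grad_sq u \<le> 2 * (B + 1)"
      using at by blast
  qed
qed

section \<open>Restricting a continuous function to a component of its support\<close>

text \<open>Pointwise convergence is added by passing to a subsequence; nonlinear coefficients of
  the approximants need it.\<close>

lemma H1_approx:
  assumes "H1 f G"
  shows "\<exists>u. (\<forall>k. u k \<in> test_functions) \<and> L2_tendsto u f \<and>
    (\<forall>i. L2_tendsto (\<lambda>k. partial_deriv i (u k)) (\<lambda>x. G x $ i)) \<and>
    (AE x in lborel. (\<lambda>k. u k x) \<longlonglongrightarrow> f x)"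
proof -
  obtain u where u: "\<And>k. u k \<in> test_functions" "L2_tendsto u f"
    "\<And>i. L2_tendsto (\<lambda>k. partial_deriv i (u k)) (\<lambda>x. G x $ i)"
    using assms unfolding H1_def by blast
  obtain r :: "nat \<Rightarrow> nat" where r: "strict_mono r" "AE x in lborel. (\<lambda>k. u (r k) x) \<longlonglongrightarrow> f x"
    using L2_tendsto_AE_subseq[OF u(2)] by blast
  show ?thesis
    by (rule exI[of _ "\<lambda>k. u (r k)"])
       (use u(1) r L2_tendsto_subseq[OF u(2) r(1)] L2_tendsto_subseq[OF u(3) r(1)] in simp_all)
qed

section \<open>Bounded continuous coefficients\<close>

lemma continuous_coefficient_measurable:
  fixes c :: "complex \<Rightarrow> complex" and h :: "real^'n::finite \<Rightarrow> complex"
  assumes "\<And>z. isCont c z" "h \<in> borel_measurable lborel"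
  shows "(\<lambda>x. c (h x)) \<in> borel_measurable lborel"
  by (rule measurable_compose[OF assms(2)])
     (intro borel_measurable_continuous_onI continuous_at_imp_continuous_on ballI assms(1))

lemma continuous_coefficient_integrable:
  fixes c :: "complex \<Rightarrow> complex" and h :: "real^'n::finite \<Rightarrow> complex"
  assumes c: "\<And>z. isCont c z" "\<And>z. cmod (c z) \<le> N" and h: "h \<in> borel_measurable lborel" and "p \<in> L2" "q \<in> L2"
  shows "integrable lborel (\<lambda>x. c (h x) * p x * q x)"
  by (rule L2_mult_integrable[OF L2_mult_bounded[where c="\<lambda>x. c (h x)" and M=N] assms(5)])
     (use c(2) assms(4) continuous_coefficient_measurable[OF c(1) h] in auto)

lemma continuous_coefficient_tendsto:
  fixes c :: "complex \<Rightarrow> complex" and f :: "real^'n::finite \<Rightarrow> complex"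
  assumes c: "\<And>z. isCont c z" "\<And>z. cmod (c z) \<le> N"
    and m: "\<And>k. a k \<in> borel_measurable lborel" "f \<in> borel_measurable lborel"
    and ae: "AE x in lborel. (\<lambda>k. a k x) \<longlonglongrightarrow> f x" and "L2_tendsto p p'" "L2_tendsto q q'"
  shows "(\<lambda>k. LINT x|lborel. c (a k x) * p k x * q k x) \<longlonglongrightarrow> (LINT x|lborel. c (f x) * p' x * q' x)"
proof (rule integral_L2_mult_tendsto[OF assms(6,7) _ _ c(2)])
  show "AE x in lborel. (\<lambda>k. c (a k x)) \<longlonglongrightarrow> c (f x)"
    using ae by eventually_elim (rule isCont_tendsto_compose[OF c(1)])
qed (rule continuous_coefficient_measurable[OF c(1)] m)+

lemma L2_tendsto_test_mult:
  assumes w: "w \<in> test_functions" and p: "L2_tendsto p p'"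
  shows "L2_tendsto (\<lambda>k x. w x * p k x) (\<lambda>x. w x * p' x)"
proof -
  obtain M where M: "\<And>x. cmod (w x) \<le> M" using test_bounded[OF w] by blast
  have L: "p k \<in> L2" "p' \<in> L2" for k using p by (auto simp: L2_tendsto_def)
  have "(\<lambda>k. L2_norm (\<lambda>x. w x * (p k x - p' x))) \<longlonglongrightarrow> 0"
  proof (rule Lim_null_comparison[OF always_eventually])
    show "\<forall>k. norm (L2_norm (\<lambda>x. w x * (p k x - p' x))) \<le> M * L2_norm (\<lambda>x. p k x - p' x)"
      using L2_norm_mult_bounded[OF L2_diff[OF L] test_measurable[OF w] M] by simp
    show "(\<lambda>k. M * L2_norm (\<lambda>x. p k x - p' x)) \<longlonglongrightarrow> 0"
      using p by (intro tendsto_mult_right_zero) (simp add: L2_tendsto_def)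
  qed
  then show ?thesis
    using L2_mult_bounded[OF L(1) test_measurable[OF w] M] L2_mult_bounded[OF L(2) test_measurable[OF w] M]
    by (simp add: L2_tendsto_def right_diff_distrib)
qed

section \<open>Smooth truncation near the zero set\<close>

text \<open>The truncation \<open>z \<mapsto> trunc0 \<delta> z * z\<close> vanishes for \<open>|z|\<^sup>2 \<le> \<delta>\<close> and tends to the identity as
  \<open>\<delta> \<rightarrow> 0\<close>; \<open>trunc1\<close> and \<open>trunc2\<close> are its derivatives with respect to \<open>z\<close> and \<open>cnj z\<close>. They are
  bounded uniformly in \<open>\<delta>\<close>.\<close>

definition trunc0 :: "real \<Rightarrow> complex \<Rightarrow> complex" where
  "trunc0 \<delta> z = of_real (exp_inv 0 ((cmod z)\<^sup>2 / \<delta> - 1))"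

definition trunc1 :: "real \<Rightarrow> complex \<Rightarrow> complex" where
  "trunc1 \<delta> z = trunc0 \<delta> z + of_real (exp_inv 2 ((cmod z)\<^sup>2 / \<delta> - 1) / \<delta>) * (z * cnj z)"

definition trunc2 :: "real \<Rightarrow> complex \<Rightarrow> complex" where
  "trunc2 \<delta> z = of_real (exp_inv 2 ((cmod z)\<^sup>2 / \<delta> - 1) / \<delta>) * (z * z)"

lemma exp_inv_isCont: "isCont (exp_inv j) t"
  by (rule DERIV_isCont[OF exp_inv_DERIV])

lemma isCont_trunc: "isCont (trunc0 \<delta>) z" "isCont (trunc1 \<delta>) z" "isCont (trunc2 \<delta>) z"
proof -
  have e: "isCont (\<lambda>z. exp_inv j ((cmod z)\<^sup>2 / \<delta> - 1)) z" for j z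
    by (rule isCont_o2[OF _ exp_inv_isCont]) (auto simp: divide_inverse intro!: continuous_intros)
  have "isCont (\<lambda>t. complex_of_real (t / \<delta>)) t" for t
    by (auto simp: divide_inverse intro!: continuous_intros)
  from isCont_o2[OF e this] have e2: "isCont (\<lambda>z. complex_of_real (exp_inv j ((cmod z)\<^sup>2 / \<delta> - 1) / \<delta>)) z" for j z .
  have c: "isCont cnj z" for z by (intro continuous_intros)
  show 0: "isCont (trunc0 \<delta>) z" for z unfolding trunc0_def by (intro continuous_intros e)
  show "isCont (trunc1 \<delta>) z"
    unfolding trunc1_def by (intro isCont_add 0 isCont_mult e2 continuous_ident c)
  show "isCont (trunc2 \<delta>) z"
    unfolding trunc2_def by (intro isCont_mult e2 continuous_ident)
qed

lemma trunc_measurable [measurable]: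
  "trunc0 \<delta> \<in> borel_measurable borel" "trunc1 \<delta> \<in> borel_measurable borel" "trunc2 \<delta> \<in> borel_measurable borel"
  by (intro borel_measurable_continuous_onI continuous_at_imp_continuous_on ballI isCont_trunc)+

lemma trunc_zero: "(cmod z)\<^sup>2 \<le> \<delta> \<Longrightarrow> \<delta> > 0 \<Longrightarrow> trunc0 \<delta> z = 0 \<and> trunc1 \<delta> z = 0 \<and> trunc2 \<delta> z = 0"
  by (simp add: trunc0_def trunc1_def trunc2_def exp_inv_def)

text \<open>For \<open>t = (cmod z)\<^sup>2 / \<delta> - 1\<close> the left-hand side is the modulus
  of \<open>trunc2 \<delta> z\<close>, whence bounds independent of \<open>\<delta>\<close>. The
  substitution \<open>y = inverse t\<close> reduces it to a quadratic Taylor bound for the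
  exponential.\<close>

lemma exp_inv_2_bound: "(t + 1) * exp_inv 2 t \<le> 2"
proof (cases "t > 0")
  case True
  define y where "y = inverse t"
  have y: "y > 0" using True by (simp add: y_def)
  have "(t + 1) * exp_inv 2 t = (y + y\<^sup>2) * exp (- y)"
    using True by (simp add: exp_inv_def y_def power2_eq_square field_simps)
  also have "\<dots> \<le> 2"
  proof -
    have "y + y\<^sup>2 \<le> 2 * exp y"
      using exp_lower_Taylor_quadratic[of y] y by simp
    then have "(y + y\<^sup>2) * exp (- y) \<le> 2 * exp y * exp (- y)" by (rule mult_right_mono) simp
    also have "2 * exp y * exp (- y) = 2" by (simp add: exp_minus)
    finally show ?thesis .
  qed
  finally show ?thesis .
qed (simp add: exp_inv_def)

lemma trunc_bounds:
  assumes "\<delta> > 0"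
  shows "cmod (trunc0 \<delta> z) \<le> 1" "cmod (trunc1 \<delta> z) \<le> 3" "cmod (trunc2 \<delta> z) \<le> 2"
proof -
  show 0: "cmod (trunc0 \<delta> z) \<le> 1" by (simp add: trunc0_def exp_inv_0_le_1)
  define t where "t = (cmod z)\<^sup>2 / \<delta> - 1"
  have "exp_inv 2 t / \<delta> * (cmod z * cmod z) = (t + 1) * exp_inv 2 t"
    by (simp add: t_def power2_eq_square)
  then have *: "exp_inv 2 t / \<delta> * (cmod z * cmod z) \<le> 2" using exp_inv_2_bound[of t] by simp
  show "cmod (trunc2 \<delta> z) \<le> 2" using * assms
    by (simp add: trunc2_def norm_mult t_def[symmetric] del: of_real_divide)
  have "cmod (of_real (exp_inv 2 t / \<delta>) * (z * cnj z)) \<le> 2" using * assms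
    by (simp add: norm_mult del: of_real_divide)
  then show "cmod (trunc1 \<delta> z) \<le> 3" 
    using norm_triangle_ineq[of "trunc0 \<delta> z" "of_real (exp_inv 2 t / \<delta>) * (z * cnj z)"] 0
    unfolding trunc1_def t_def by linarith
qed

text \<open>\<open>exp_inv 2\<close> decays like the inverse square of its argument, which beats the
  linear factor in the second limit.\<close>

lemma exp_inv_at_top:
  assumes "s > 0"
  shows "(\<lambda>n. exp_inv 0 (s / inverse (real (Suc n)) - 1)) \<longlonglongrightarrow> 1"
    "(\<lambda>n. exp_inv 2 (s / inverse (real (Suc n)) - 1) * (s / inverse (real (Suc n)))) \<longlonglongrightarrow> 0"
proof -
  have "filterlim (\<lambda>n. s / inverse (real (Suc n)) - 1) at_top sequentially"
    using assms by real_asymp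
  then have ev: "\<forall>\<^sub>F n in sequentially. s / inverse (real (Suc n)) - 1 > 0"
    by (rule filterlim_at_top_dense[THEN iffD1, rule_format])
  have "(\<lambda>n. exp (- inverse (s / inverse (real (Suc n)) - 1))) \<longlonglongrightarrow> 1"
    using assms by real_asymp
  moreover from ev have "\<forall>\<^sub>F n in sequentially. exp (- inverse (s / inverse (real (Suc n)) - 1)) = exp_inv 0 (s / inverse (real (Suc n)) - 1)"
    by eventually_elim (simp add: exp_inv_def)
  ultimately show "(\<lambda>n. exp_inv 0 (s / inverse (real (Suc n)) - 1)) \<longlonglongrightarrow> 1" by (rule Lim_transform_eventually)
  have "(\<lambda>n. inverse (s / inverse (real (Suc n)) - 1)^2 * exp (- inverse (s / inverse (real (Suc n)) - 1)) * (s / inverse (real (Suc n)))) \<longlonglongrightarrow> 0"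
    using assms by real_asymp
  moreover from ev have "\<forall>\<^sub>F n in sequentially. inverse (s / inverse (real (Suc n)) - 1)^2 * exp (- inverse (s / inverse (real (Suc n)) - 1)) * (s / inverse (real (Suc n)))
      = exp_inv 2 (s / inverse (real (Suc n)) - 1) * (s / inverse (real (Suc n)))"
    by eventually_elim (simp add: exp_inv_def)
  ultimately show "(\<lambda>n. exp_inv 2 (s / inverse (real (Suc n)) - 1) * (s / inverse (real (Suc n)))) \<longlonglongrightarrow> 0"
    by (rule Lim_transform_eventually)
qed

lemma trunc_tendsto:
  assumes "z \<noteq> 0"
  shows "(\<lambda>n. trunc0 (inverse (real (Suc n))) z) \<longlonglongrightarrow> 1" "(\<lambda>n. trunc1 (inverse (real (Suc n))) z) \<longlonglongrightarrow> 1"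
    "(\<lambda>n. trunc2 (inverse (real (Suc n))) z) \<longlonglongrightarrow> 0"
proof -
  have s: "(cmod z)\<^sup>2 > 0" using assms by simp
  show 0: "(\<lambda>n. trunc0 (inverse (real (Suc n))) z) \<longlonglongrightarrow> 1"
    using tendsto_of_real[OF exp_inv_at_top(1)[OF s], where 'a=complex] unfolding trunc0_def by simp
  define p where "p n = exp_inv 2 ((cmod z)\<^sup>2 / inverse (real (Suc n)) - 1) / inverse (real (Suc n))" for n
  have "(\<lambda>n. p n * (cmod z)\<^sup>2) \<longlonglongrightarrow> 0"
    using exp_inv_at_top(2)[OF s] by (simp add: p_def divide_inverse mult_ac)
  then have "(\<lambda>n. p n * (cmod z)\<^sup>2 / (cmod z)\<^sup>2) \<longlonglongrightarrow> 0 / (cmod z)\<^sup>2"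
    by (intro tendsto_divide tendsto_const) (use s in auto)
  then have "p \<longlonglongrightarrow> 0" using s by simp
  then have "(\<lambda>n. complex_of_real (p n)) \<longlonglongrightarrow> of_real 0" by (rule tendsto_of_real)
  then have p: "(\<lambda>n. complex_of_real (p n) * w) \<longlonglongrightarrow> 0" for w
    using tendsto_mult_left_zero by simp
  show "(\<lambda>n. trunc2 (inverse (real (Suc n))) z) \<longlonglongrightarrow> 0"
    using p[of "z * z"] unfolding trunc2_def p_def .
  show "(\<lambda>n. trunc1 (inverse (real (Suc n))) z) \<longlonglongrightarrow> 1"
    using tendsto_add[OF 0 p[of "z * cnj z"]] unfolding trunc1_def p_def by simp
qed

lemma smooth_cmod_sq: "smooth u \<Longrightarrow> smooth (\<lambda>x. (cmod (u x))\<^sup>2)"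
proof -
  assume "smooth u"
  then have "smooth (\<lambda>x. Re (u x * cnj (u x)))" by (intro smooth_Re smooth_mult smooth_cnj)
  moreover have "Re (u x * cnj (u x)) = (cmod (u x))\<^sup>2" for x
    by (simp only: complex_norm_square[symmetric] Re_complex_of_real)
  ultimately show ?thesis by simp
qed

lemma partial_deriv_cmod_sq:
  assumes "smooth u"
  shows "complex_of_real (partial_deriv i (\<lambda>x. (cmod (u x))\<^sup>2) x)
    = partial_deriv i u x * cnj (u x) + u x * cnj (partial_deriv i u x)"
proof -
  note d = smooth_differentiable[OF assms] smooth_differentiable[OF smooth_cnj[OF assms]]
  have "complex_of_real (partial_deriv i (\<lambda>x. (cmod (u x))\<^sup>2) x) = partial_deriv i (\<lambda>x. complex_of_real ((cmod (u x))\<^sup>2)) x"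
    by (rule partial_deriv_bounded_linear[OF bounded_linear_of_real smooth_differentiable[OF smooth_cmod_sq[OF assms]], symmetric])
  also have "(\<lambda>x. complex_of_real ((cmod (u x))\<^sup>2)) = (\<lambda>x. u x * cnj (u x))"
    by (simp only: complex_norm_square)
  also have "partial_deriv i (\<lambda>x. u x * cnj (u x)) x = u x * partial_deriv i (\<lambda>x. cnj (u x)) x + partial_deriv i u x * cnj (u x)"
    by (rule partial_deriv_mult[OF d])
  also have "partial_deriv i (\<lambda>x. cnj (u x)) x = cnj (partial_deriv i u x)"
    by (rule partial_deriv_bounded_linear[OF bounded_linear_cnj d(1)])
  finally show ?thesis by simp
qed

text \<open>The derivative of \<open>exp_inv 0\<close> is \<open>exp_inv 2\<close>, whence the index
  2 in \<open>trunc1\<close> and \<open>trunc2\<close>. The truncation is not holomorphic, so the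
  conjugate derivative appears besides the derivative.\<close>

lemma trunc_smooth:
  assumes u: "smooth u" and "\<delta> > 0"
  shows "smooth (\<lambda>x. trunc0 \<delta> (u x) * u x)"
    "partial_deriv i (\<lambda>x. trunc0 \<delta> (u x) * u x) x = trunc1 \<delta> (u x) * partial_deriv i u x + trunc2 \<delta> (u x) * cnj (partial_deriv i u x)"
proof -
  define r where "r x = (1 / \<delta>) * (cmod (u x))\<^sup>2 + (- 1)" for x
  have r: "smooth r" unfolding r_def by (intro smooth_add smooth_mult smooth_const smooth_cmod_sq u)
  have t0: "trunc0 \<delta> (u x) = of_real (exp_inv 0 (r x))" for x by (simp add: trunc0_def r_def)
  have sm: "smooth (\<lambda>x. exp_inv 0 (r x))" by (rule smooth_exp_inv[OF r])
  show "smooth (\<lambda>x. trunc0 \<delta> (u x) * u x)" unfolding t0 by (intro smooth_mult smooth_of_real sm u)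
  have "partial_deriv i r x = (1 / \<delta>) * partial_deriv i (\<lambda>x. (cmod (u x))\<^sup>2) x"
  proof -
    have dm: "(\<lambda>x. (cmod (u x))\<^sup>2) differentiable (at x)" by (rule smooth_differentiable[OF smooth_cmod_sq[OF u]])
    have dm2: "(\<lambda>x. (1 / \<delta>) * (cmod (u x))\<^sup>2) differentiable (at x)"
      by (intro smooth_differentiable smooth_mult smooth_const smooth_cmod_sq u)
    have "partial_deriv i r x = partial_deriv i (\<lambda>x. (1 / \<delta>) * (cmod (u x))\<^sup>2) x + partial_deriv i (\<lambda>x. -1) x"
      unfolding r_def[abs_def] by (rule partial_deriv_add[OF dm2]) simp
    also have "\<dots> = (1 / \<delta>) * partial_deriv i (\<lambda>x. (cmod (u x))\<^sup>2) x"
      using partial_deriv_bounded_linear[OF bounded_linear_mult_right dm, of i "1 / \<delta>"] by simp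
    finally show ?thesis .
  qed
  moreover have "partial_deriv i (\<lambda>x. exp_inv 0 (r x)) x = (exp_inv (0 + 2) (r x) - real 0 * exp_inv (0 + 1) (r x)) * partial_deriv i r x"
    by (rule partial_deriv_compose_real(1)[OF smooth_differentiable[OF r] exp_inv_DERIV])
  ultimately have e: "partial_deriv i (\<lambda>x. exp_inv 0 (r x)) x = exp_inv 2 (r x) / \<delta> * partial_deriv i (\<lambda>x. (cmod (u x))\<^sup>2) x"
    by (simp add: numeral_2_eq_2)
  have "partial_deriv i (\<lambda>x. trunc0 \<delta> (u x)) x = of_real (exp_inv 2 (r x) / \<delta> * partial_deriv i (\<lambda>x. (cmod (u x))\<^sup>2) x)"
    unfolding t0 e[symmetric] by (rule partial_deriv_bounded_linear[OF bounded_linear_of_real smooth_differentiable[OF sm]])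
  then have d0: "partial_deriv i (\<lambda>x. trunc0 \<delta> (u x)) x = of_real (exp_inv 2 (r x) / \<delta>) * (partial_deriv i u x * cnj (u x) + u x * cnj (partial_deriv i u x))"
    by (simp only: of_real_mult partial_deriv_cmod_sq[OF u])
  have "(\<lambda>x. trunc0 \<delta> (u x)) differentiable (at x)"
    unfolding t0 by (intro smooth_differentiable smooth_of_real sm)
  then have "partial_deriv i (\<lambda>x. trunc0 \<delta> (u x) * u x) x = trunc0 \<delta> (u x) * partial_deriv i u x + partial_deriv i (\<lambda>x. trunc0 \<delta> (u x)) x * u x"
    by (rule partial_deriv_mult[OF _ smooth_differentiable[OF u]])
  moreover have rx: "r x = (cmod (u x))\<^sup>2 / \<delta> - 1" by (simp add: r_def)
  ultimately show "partial_deriv i (\<lambda>x. trunc0 \<delta> (u x) * u x) x = trunc1 \<delta> (u x) * partial_deriv i u x + trunc2 \<delta> (u x) * cnj (partial_deriv i u x)"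
    unfolding d0 trunc1_def trunc2_def rx by (simp only: ring_distribs mult_ac add_ac)
qed

text \<open>The chain rule for test functions, passed to the limit: the derivatives enter linearly
  and converge in norm, while the bounded coefficients converge almost everywhere.\<close>

lemma trunc_weak_derivative:
  assumes fG: "H1 f G" and v: "v \<in> test_functions" and \<delta>: "\<delta> > 0"
  shows "(LINT x|lborel. trunc0 \<delta> (f x) * f x * partial_deriv i v x)
    = - (LINT x|lborel. (trunc1 \<delta> (f x) * G x $ i + trunc2 \<delta> (f x) * cnj (G x $ i)) * v x)"
proof -
  obtain u where u: "\<And>k. u k \<in> test_functions" "L2_tendsto u f"
    "\<And>i. L2_tendsto (\<lambda>k. partial_deriv i (u k)) (\<lambda>x. G x $ i)" and ae: "AE x in lborel. (\<lambda>k. u k x) \<longlonglongrightarrow> f x"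
    using H1_approx[OF fG] by blast
  note fm = L2_measurable[OF H1_L2(1)[OF fG]] and um = test_measurable[OF u(1)]
  note lim = continuous_coefficient_tendsto[OF isCont_trunc(1) trunc_bounds(1)[OF \<delta>] um fm ae]
    continuous_coefficient_tendsto[OF isCont_trunc(2) trunc_bounds(2)[OF \<delta>] um fm ae]
    continuous_coefficient_tendsto[OF isCont_trunc(3) trunc_bounds(3)[OF \<delta>] um fm ae]
  note vL = L2_tendsto_const[OF test_L2[OF v]] L2_tendsto_const[OF test_L2[OF test_partial[OF v]]]
  have l: "(\<lambda>k. LINT x|lborel. trunc0 \<delta> (u k x) * u k x * partial_deriv i v x)
      \<longlonglongrightarrow> (LINT x|lborel. trunc0 \<delta> (f x) * f x * partial_deriv i v x)"
    by (rule lim(1)[OF u(2) vL(2)])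
  have r1: "(\<lambda>k. LINT x|lborel. trunc1 \<delta> (u k x) * partial_deriv i (u k) x * v x)
      \<longlonglongrightarrow> (LINT x|lborel. trunc1 \<delta> (f x) * G x $ i * v x)"
    by (rule lim(2)[OF u(3) vL(1)])
  have r2: "(\<lambda>k. LINT x|lborel. trunc2 \<delta> (u k x) * cnj (partial_deriv i (u k) x) * v x)
      \<longlonglongrightarrow> (LINT x|lborel. trunc2 \<delta> (f x) * cnj (G x $ i) * v x)"
    by (rule lim(3)[OF L2_tendsto_cnj[OF u(3)] vL(1)])
  have i: "integrable lborel (\<lambda>x. trunc1 \<delta> (w x) * h x * v x)" "integrable lborel (\<lambda>x. trunc2 \<delta> (w x) * cnj (h x) * v x)"
    if "w \<in> borel_measurable lborel" "h \<in> L2" for w h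
    using continuous_coefficient_integrable[OF isCont_trunc(2) trunc_bounds(2)[OF \<delta>] that test_L2[OF v]]
      continuous_coefficient_integrable[OF isCont_trunc(3) trunc_bounds(3)[OF \<delta>] that(1) _ test_L2[OF v], of "\<lambda>x. cnj (h x)"] that(2)
    by simp_all
  have sum: "(LINT x|lborel. (trunc1 \<delta> (w x) * h x + trunc2 \<delta> (w x) * cnj (h x)) * v x)
     = (LINT x|lborel. trunc1 \<delta> (w x) * h x * v x) + (LINT x|lborel. trunc2 \<delta> (w x) * cnj (h x) * v x)"
    if "w \<in> borel_measurable lborel" "h \<in> L2" for w h
    unfolding distrib_right by (rule Bochner_Integration.integral_add[OF i[OF that]])
  have "(LINT x|lborel. trunc0 \<delta> (u k x) * u k x * partial_deriv i v x)
     = - ((LINT x|lborel. trunc1 \<delta> (u k x) * partial_deriv i (u k) x * v x)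
        + (LINT x|lborel. trunc2 \<delta> (u k x) * cnj (partial_deriv i (u k) x) * v x))" for k
    using integral_by_parts[OF trunc_smooth(1)[OF test_smooth[OF u(1)] \<delta>] v, of k i]
    by (simp only: trunc_smooth(2)[OF test_smooth[OF u(1)] \<delta>] sum[OF um test_L2[OF test_partial[OF u(1)]]])
  then have "(\<lambda>k. LINT x|lborel. trunc0 \<delta> (u k x) * u k x * partial_deriv i v x)
    \<longlonglongrightarrow> - ((LINT x|lborel. trunc1 \<delta> (f x) * G x $ i * v x) + (LINT x|lborel. trunc2 \<delta> (f x) * cnj (G x $ i) * v x))"
    using tendsto_minus[OF tendsto_add[OF r1 r2]] by simp
  from LIMSEQ_unique[OF l this] show ?thesis
    using sum[OF fm H1_L2(2)[OF fG], of i] by simp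
qed

section \<open>Cutting along a component\<close>

lemma partial_deriv_cong_open:
  assumes "open S" "x \<in> S" "\<And>y. y \<in> S \<Longrightarrow> f y = g y" "g differentiable (at x)"
  shows "partial_deriv i f x = partial_deriv i g x"
proof -
  have g: "(g has_derivative frechet_derivative g (at x)) (at x)" using assms(4) frechet_derivative_works by blast
  have "(f has_derivative frechet_derivative g (at x)) (at x)"
    by (rule has_derivative_transform_within_open[OF g assms(1,2)]) (simp add: assms(3))
  then show ?thesis by (simp add: partial_deriv_eq partial_deriv_def[of i g])
qed

text \<open>A component is closed relative to the open set where \<open>f\<close> is nonzero. A
  superlevel set is closed and stays inside that set, so intersecting with it turns relative
  closedness into closedness.\<close>

lemma component_superlevel_closed:
  fixes f :: "real^'n::finite \<Rightarrow> complex"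
  assumes cont: "continuous_on UNIV f" and C: "C \<in> components {x. f x \<noteq> 0}" and \<delta>: "\<delta> > 0"
  shows "closed (C \<inter> {x. \<delta> \<le> (cmod (f x))\<^sup>2})" "closed ({x. \<delta> \<le> (cmod (f x))\<^sup>2} - C)" "open C"
proof -
  have D: "open {x. f x \<noteq> 0}"
    using cont by (intro open_Collect_neq continuous_on_const)
  show "open C" by (rule open_components[OF D C])
  have L: "closed {x. \<delta> \<le> (cmod (f x))\<^sup>2}"
    by (intro closed_Collect_le continuous_on_const continuous_on_power continuous_on_norm cont)
  then show "closed ({x. \<delta> \<le> (cmod (f x))\<^sup>2} - C)" using \<open>open C\<close> by (rule closed_Diff)
  obtain Z where Z: "closed Z" "C = {x. f x \<noteq> 0} \<inter> Z"
    using closedin_component[OF C] by (auto simp: closedin_closed)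
  have "C \<inter> {x. \<delta> \<le> (cmod (f x))\<^sup>2} = Z \<inter> {x. \<delta> \<le> (cmod (f x))\<^sup>2}"
    using Z(2) \<delta> by auto
  then show "closed (C \<inter> {x. \<delta> \<le> (cmod (f x))\<^sup>2})" using Z(1) L by (simp add: closed_Int)
qed

text \<open>The truncated function lives on the superlevel set, which falls into the disjoint closed
  parts \<open>S\<close> inside and \<open>T\<close> outside \<open>C\<close>. On the support of
  \<open>v\<close> a smooth \<open>h\<close> equal to 1 near \<open>S\<close> and 0 near
  \<open>T\<close> acts like the indicator, and \<open>h * v\<close> is again a test
  function.\<close>

lemma trunc_component_weak_derivative:
  fixes f :: "real^'n::finite \<Rightarrow> complex"
  assumes fG: "H1 f G" and cont: "continuous_on UNIV f" and C: "C \<in> components {x. f x \<noteq> 0}"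
    and v: "v \<in> test_functions" and \<delta>: "\<delta> > 0"
  shows "(LINT x|lborel. indicator C x * (trunc0 \<delta> (f x) * f x * partial_deriv i v x))
    = - (LINT x|lborel. indicator C x * ((trunc1 \<delta> (f x) * G x $ i + trunc2 \<delta> (f x) * cnj (G x $ i)) * v x))"
proof -
  define K where "K = closure {x. v x \<noteq> 0}"
  define S where "S = C \<inter> {x. \<delta> \<le> (cmod (f x))\<^sup>2}"
  define T where "T = {x. \<delta> \<le> (cmod (f x))\<^sup>2} - C"
  have K: "compact K" using v by (simp add: K_def test_functions_iff)
  have cl: "closed S" "closed T" "S \<inter> T = {}"
    using component_superlevel_closed[OF cont C \<delta>] by (auto simp: S_def T_def)
  obtain h U W where h: "smooth h" "open U" "S \<inter> K \<subseteq> U" "\<And>x. x \<in> U \<Longrightarrow> h x = (1::real)"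
    "open W" "T \<inter> K \<subseteq> W" "\<And>x. x \<in> W \<Longrightarrow> h x = 0"
    using smooth_separation[OF K cl] by blast
  define w where "w x = complex_of_real (h x) * v x" for x
  have w: "w \<in> test_functions" unfolding w_def by (intro test_mult smooth_of_real h v)
  have vd: "v differentiable (at x)" for x by (rule smooth_differentiable[OF test_smooth[OF v]])
  have far: "partial_deriv i w x = 0 \<and> partial_deriv i v x = 0 \<and> v x = 0 \<and> w x = 0" if "x \<notin> K" for x
  proof -
    have z: "v y = 0" if "y \<in> - K" for y using that closure_subset[of "{x. v x \<noteq> 0}"] by (auto simp: K_def)
    then have z': "w y = 0" if "y \<in> - K" for y using that by (simp add: w_def)
    have o: "open (- K)" by (simp add: K_def open_Compl)
    have x: "x \<in> - K" using that by simp
    show ?thesis using partial_deriv_zero_open[where f=v, OF o x z] partial_deriv_zero_open[where f=w, OF o x z'] z[OF x] z'[OF x] by blast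
  qed
  have onU: "partial_deriv i w x = partial_deriv i v x \<and> w x = v x" if "x \<in> S \<inter> K" for x
  proof -
    have "x \<in> U" using that h(3) by blast
    moreover have "w y = v y" if "y \<in> U" for y using h(4)[OF that] by (simp add: w_def)
    ultimately show ?thesis using partial_deriv_cong_open[OF h(2), of x w v i] vd by blast
  qed
  have onW: "partial_deriv i w x = 0 \<and> w x = 0" if "x \<in> T \<inter> K" for x
  proof -
    have "x \<in> W" using that h(6) by blast
    moreover have "w y = 0" if "y \<in> W" for y using h(7)[OF that] by (simp add: w_def)
    ultimately show ?thesis using partial_deriv_zero_open[OF h(5), of x w 0 i] by blast
  qed
  have ptw: "indicator C x * (trunc0 \<delta> (f x) * f x * partial_deriv i v x) = trunc0 \<delta> (f x) * f x * partial_deriv i w x \<and>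
     indicator C x * ((trunc1 \<delta> (f x) * G x $ i + trunc2 \<delta> (f x) * cnj (G x $ i)) * v x)
     = (trunc1 \<delta> (f x) * G x $ i + trunc2 \<delta> (f x) * cnj (G x $ i)) * w x" for x
  proof -
    \<comment> \<open>Where the squared modulus of \<open>f\<close> is at most
      \<open>\<delta>\<close>, all truncation coefficients vanish and the uncontrolled values of
      \<open>h\<close> between the two neighbourhoods do not matter.\<close>
    consider "x \<notin> K" | "x \<in> S \<inter> K" "x \<in> C" | "x \<in> T \<inter> K" "x \<notin> C" | "(cmod (f x))\<^sup>2 \<le> \<delta>"
      unfolding S_def T_def using linear[of "(cmod (f x))\<^sup>2" \<delta>] by blast
    then show ?thesis
      by cases (simp_all add: far onU onW trunc_zero[OF _ \<delta>])
  qed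
  show ?thesis
    by (simp only: ptw[THEN conjunct1] ptw[THEN conjunct2] trunc_weak_derivative[OF fG w \<delta>])
qed

text \<open>Let \<open>\<delta>\<close> tend to 0 in the truncated identity. Every point of
  \<open>C\<close> has \<open>f x \<noteq> 0\<close>, so \<open>trunc0\<close> and
  \<open>trunc1\<close> tend to 1 and \<open>trunc2\<close> to 0 there, under uniform
  bounds.\<close>

lemma component_weak_gradient:
  fixes f :: "real^'n::finite \<Rightarrow> complex"
  assumes fG: "H1 f G" and cont: "continuous_on UNIV f" and C: "C \<in> components {x. f x \<noteq> 0}"
  shows "has_weak_gradient (\<lambda>x. indicator C x * f x) (\<lambda>x. \<chi> i. indicator C x * G x $ i)"
    and "(\<lambda>x. indicator C x * f x) \<in> L2" "(\<lambda>x. indicator C x * G x $ i) \<in> L2"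
proof -
  have [measurable]: "C \<in> sets borel"
    using component_superlevel_closed(3)[OF cont C zero_less_one] by simp
  have Cz: "f x \<noteq> 0" if "x \<in> C" for x using that in_components_subset[OF C] by auto
  have [measurable]: "f \<in> borel_measurable borel" "(\<lambda>x. G x $ i) \<in> borel_measurable borel" for i
    using L2_measurable[OF H1_L2(1)[OF fG]] L2_measurable[OF H1_L2(2)[OF fG]] by simp_all
  have ind: "(\<lambda>x. indicator C x * g x) \<in> L2" if "g \<in> L2" for g
    by (rule L2_mult_bounded[OF that, of _ 1]) (auto simp: indicator_def)
  show L: "(\<lambda>x. indicator C x * f x) \<in> L2" "(\<lambda>x. indicator C x * G x $ i) \<in> L2" for i
    by (intro ind H1_L2[OF fG])+
  have "(LINT x|lborel. indicator C x * f x * partial_deriv i v x) = - (LINT x|lborel. indicator C x * G x $ i * v x)"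
    if v: "v \<in> test_functions" for v i
  proof (rule LIMSEQ_unique)
    have vm [measurable]: "v \<in> borel_measurable borel" "partial_deriv i v \<in> borel_measurable borel"
      "v \<in> borel_measurable lborel" "(\<lambda>x. cnj (G x $ i)) \<in> borel_measurable borel"
      using test_measurable[OF v] test_measurable[OF test_partial[OF v]]
        L2_measurable[of "\<lambda>x. cnj (G x $ i)"] H1_L2(2)[OF fG, of i] by simp_all
    define d where "d n = inverse (real (Suc n))" for n
    have d: "d n > 0" for n by (simp add: d_def)
    define I where "I n = (LINT x|lborel. indicator C x * (trunc0 (d n) (f x) * f x * partial_deriv i v x))" for n
    show "I \<longlonglongrightarrow> (LINT x|lborel. indicator C x * f x * partial_deriv i v x)"
      unfolding I_def
    proof (rule integral_dominated_convergence[where w="\<lambda>x. cmod (f x * partial_deriv i v x)"])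
      show "integrable lborel (\<lambda>x. cmod (f x * partial_deriv i v x))"
        by (intro integrable_norm L2_mult_integrable H1_L2[OF fG] test_L2 test_partial v)
      show "AE x in lborel. (\<lambda>n. indicator C x * (trunc0 (d n) (f x) * f x * partial_deriv i v x))
          \<longlonglongrightarrow> indicator C x * f x * partial_deriv i v x"
      proof (rule AE_I2)
        fix x
        show "(\<lambda>n. indicator C x * (trunc0 (d n) (f x) * f x * partial_deriv i v x))
          \<longlonglongrightarrow> indicator C x * f x * partial_deriv i v x"
        proof (cases "x \<in> C")
          case True
          have "(\<lambda>n. indicator C x * (trunc0 (d n) (f x) * f x * partial_deriv i v x))
            \<longlonglongrightarrow> indicator C x * (1 * f x * partial_deriv i v x)"
            unfolding d_def by (intro tendsto_intros trunc_tendsto(1) Cz True)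
          then show ?thesis by (simp add: mult.assoc)
        qed simp
      qed
      show "AE x in lborel. norm (indicator C x * (trunc0 (d n) (f x) * f x * partial_deriv i v x)) \<le> cmod (f x * partial_deriv i v x)" for n
      proof (rule AE_I2)
        fix x
        have "cmod (trunc0 (d n) (f x)) * cmod (f x * partial_deriv i v x) \<le> 1 * cmod (f x * partial_deriv i v x)"
          by (intro mult_right_mono trunc_bounds d) simp
        then show "norm (indicator C x * (trunc0 (d n) (f x) * f x * partial_deriv i v x)) \<le> cmod (f x * partial_deriv i v x)"
          by (auto simp: indicator_def norm_mult mult.assoc)
      qed
    qed measurable
    \<comment> \<open>The factor 5 in the majorant is the sum of the bounds 3 for
      \<open>trunc1\<close> and 2 for \<open>trunc2\<close>.\<close>
    have "(\<lambda>n. LINT x|lborel. indicator C x * ((trunc1 (d n) (f x) * G x $ i + trunc2 (d n) (f x) * cnj (G x $ i)) * v x))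
      \<longlonglongrightarrow> (LINT x|lborel. indicator C x * G x $ i * v x)"
    proof (rule integral_dominated_convergence[where w="\<lambda>x. 5 * cmod (G x $ i * v x)"])
      show "integrable lborel (\<lambda>x. 5 * cmod (G x $ i * v x))"
        by (intro integrable_mult_right integrable_norm L2_mult_integrable H1_L2[OF fG] test_L2 v)
      show "AE x in lborel. (\<lambda>n. indicator C x * ((trunc1 (d n) (f x) * G x $ i + trunc2 (d n) (f x) * cnj (G x $ i)) * v x))
          \<longlonglongrightarrow> indicator C x * G x $ i * v x"
      proof (rule AE_I2)
        fix x
        show "(\<lambda>n. indicator C x * ((trunc1 (d n) (f x) * G x $ i + trunc2 (d n) (f x) * cnj (G x $ i)) * v x))
          \<longlonglongrightarrow> indicator C x * G x $ i * v x"
        proof (cases "x \<in> C")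
          case True
          have "(\<lambda>n. indicator C x * ((trunc1 (d n) (f x) * G x $ i + trunc2 (d n) (f x) * cnj (G x $ i)) * v x))
            \<longlonglongrightarrow> indicator C x * ((1 * G x $ i + 0 * cnj (G x $ i)) * v x)"
            unfolding d_def by (intro tendsto_intros trunc_tendsto(2,3) Cz True)
          then show ?thesis by (simp add: mult.assoc)
        qed simp
      qed
      show "AE x in lborel. norm (indicator C x * ((trunc1 (d n) (f x) * G x $ i + trunc2 (d n) (f x) * cnj (G x $ i)) * v x)) \<le> 5 * cmod (G x $ i * v x)" for n
      proof (rule AE_I2)
        fix x
        have "cmod (trunc1 (d n) (f x) * G x $ i + trunc2 (d n) (f x) * cnj (G x $ i))
          \<le> cmod (trunc1 (d n) (f x)) * cmod (G x $ i) + cmod (trunc2 (d n) (f x)) * cmod (G x $ i)"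
          using norm_triangle_ineq[of "trunc1 (d n) (f x) * G x $ i" "trunc2 (d n) (f x) * cnj (G x $ i)"]
          by (simp add: norm_mult)
        also have "\<dots> \<le> 3 * cmod (G x $ i) + 2 * cmod (G x $ i)"
          by (intro add_mono mult_right_mono trunc_bounds d) simp_all
        also have "\<dots> = 5 * cmod (G x $ i)" by simp
        finally have "cmod (trunc1 (d n) (f x) * G x $ i + trunc2 (d n) (f x) * cnj (G x $ i)) * cmod (v x) \<le> 5 * cmod (G x $ i) * cmod (v x)"
          by (rule mult_right_mono) simp
        then show "norm (indicator C x * ((trunc1 (d n) (f x) * G x $ i + trunc2 (d n) (f x) * cnj (G x $ i)) * v x)) \<le> 5 * cmod (G x $ i * v x)"
          by (auto simp: indicator_def norm_mult mult.assoc)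
      qed
    qed measurable
    from tendsto_minus[OF this]
    show "I \<longlonglongrightarrow> - (LINT x|lborel. indicator C x * G x $ i * v x)"
      unfolding I_def by (simp only: trunc_component_weak_derivative[OF fG cont C v d])
  qed
  then show "has_weak_gradient (\<lambda>x. indicator C x * f x) (\<lambda>x. \<chi> i. indicator C x * G x $ i)"
    using L by (simp add: has_weak_gradient_def locally_integrable_L2)
qed

section \<open>Equal hydrodynamic quantities\<close>

lemma integrable_locally_integrable:
  fixes f :: "real^'n::finite \<Rightarrow> complex"
  assumes "integrable lborel f" shows "locally_integrable f"
  unfolding locally_integrable_def set_integrable_def
  using assms by (auto intro!: integrable_mult_indicator borel_compact simp: sets_lborel)

text \<open>The product rule under limits. For \<open>g = f\<close> it says that the weak gradient
  of the density is twice the real part of \<open>cnj f\<close> times the gradient of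
  \<open>f\<close>.\<close>

lemma H1_product:
  assumes f: "H1 f F" and g: "H1 g G" and v: "v \<in> test_functions"
  shows "(LINT x|lborel. g x * cnj (f x) * partial_deriv i v x)
    = - (LINT x|lborel. (G x $ i * cnj (f x) + g x * cnj (F x $ i)) * v x)"
proof -
  obtain a where a: "\<And>k. a k \<in> test_functions" "L2_tendsto a f"
    "\<And>i. L2_tendsto (\<lambda>k. partial_deriv i (a k)) (\<lambda>x. F x $ i)"
    using f unfolding H1_def by blast
  obtain b where b: "\<And>k. b k \<in> test_functions" "L2_tendsto b g"
    "\<And>i. L2_tendsto (\<lambda>k. partial_deriv i (b k)) (\<lambda>x. G x $ i)"
    using g unfolding H1_def by blast
  note lim = L2_tendsto_integral[OF L2_tendsto_test_mult]
  have int: "integrable lborel (\<lambda>x. w x * p x * q x)" if "w \<in> test_functions" "p \<in> L2" "q \<in> L2" for w p q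
    using L2_tendsto_test_mult[OF that(1) L2_tendsto_const[OF that(2)]] that(3)
    by (intro L2_mult_integrable) (simp_all add: L2_tendsto_def)
  have step: "(LINT x|lborel. partial_deriv i v x * b k x * cnj (a k x))
    = - ((LINT x|lborel. v x * partial_deriv i (b k) x * cnj (a k x)) + (LINT x|lborel. v x * b k x * cnj (partial_deriv i (a k) x)))" for k
  proof -
    have sm: "smooth (b k)" "smooth (\<lambda>x. cnj (a k x))" using a b by (auto intro: smooth_cnj test_smooth)
    have pd: "partial_deriv i (\<lambda>x. b k x * cnj (a k x)) x = b k x * cnj (partial_deriv i (a k) x) + partial_deriv i (b k) x * cnj (a k x)" for x
      using partial_deriv_mult[OF smooth_differentiable[OF sm(1)] smooth_differentiable[OF sm(2)], of i x]
      by (simp only: partial_deriv_cnj[OF a(1)])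
    have "(LINT x|lborel. b k x * cnj (a k x) * partial_deriv i v x) = - (LINT x|lborel. partial_deriv i (\<lambda>x. b k x * cnj (a k x)) x * v x)"
      by (rule integral_by_parts[OF smooth_mult[OF sm] v])
    also have "(LINT x|lborel. partial_deriv i (\<lambda>x. b k x * cnj (a k x)) x * v x) =
      (LINT x|lborel. v x * partial_deriv i (b k) x * cnj (a k x) + v x * b k x * cnj (partial_deriv i (a k) x))"
      unfolding pd by (intro Bochner_Integration.integral_cong refl) (simp add: algebra_simps)
    also have "\<dots> = (LINT x|lborel. v x * partial_deriv i (b k) x * cnj (a k x)) + (LINT x|lborel. v x * b k x * cnj (partial_deriv i (a k) x))"
      using a(1) b(1) v by (intro Bochner_Integration.integral_add int) (simp_all add: test_L2 test_partial)
    finally show ?thesis by (simp add: mult_ac)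
  qed
  have "(\<lambda>k. LINT x|lborel. partial_deriv i v x * b k x * cnj (a k x)) \<longlonglongrightarrow> (LINT x|lborel. partial_deriv i v x * g x * cnj (f x))"
    by (intro lim test_partial v b(2) L2_tendsto_cnj a(2))
  moreover have "(\<lambda>k. - ((LINT x|lborel. v x * partial_deriv i (b k) x * cnj (a k x)) + (LINT x|lborel. v x * b k x * cnj (partial_deriv i (a k) x))))
    \<longlonglongrightarrow> - ((LINT x|lborel. v x * G x $ i * cnj (f x)) + (LINT x|lborel. v x * g x * cnj (F x $ i)))"
    by (intro tendsto_minus tendsto_add lim v b(2,3) L2_tendsto_cnj a(2,3))
  ultimately have "(LINT x|lborel. partial_deriv i v x * g x * cnj (f x)) =
    - ((LINT x|lborel. v x * G x $ i * cnj (f x)) + (LINT x|lborel. v x * g x * cnj (F x $ i)))"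
    unfolding step using LIMSEQ_unique by blast
  also have "(LINT x|lborel. v x * G x $ i * cnj (f x)) + (LINT x|lborel. v x * g x * cnj (F x $ i))
    = (LINT x|lborel. v x * G x $ i * cnj (f x) + v x * g x * cnj (F x $ i))"
    using H1_L2[OF f] H1_L2[OF g] v by (intro Bochner_Integration.integral_add[symmetric] int) auto
  finally show ?thesis by (simp add: algebra_simps)
qed

text \<open>The real part of \<open>cnj f * \<nabla>f\<close> is half the weak gradient of the density, the imaginary part is
  the current, so the hydrodynamic quantities determine \<open>cnj f * \<nabla>f\<close>.\<close>

lemma hydrodynamic_log_gradient:
  assumes f: "H1 f F" and g: "H1 g G" and mass: "AE x in lborel. cmod (g x) = cmod (f x)"
    and current: "AE x in lborel. Im (cnj (g x) * G x $ i) = Im (cnj (f x) * F x $ i)"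
  shows "AE x in lborel. cnj (g x) * G x $ i = cnj (f x) * F x $ i"
proof -
  have int: "integrable lborel (\<lambda>x. H x $ i * cnj (h x) + h x * cnj (H x $ i))" if "H1 h H" for h H
    using H1_L2[OF that] by (intro Bochner_Integration.integrable_add L2_inner_integrable) auto
  have eq: "H x $ i * cnj (h x) + h x * cnj (H x $ i) = of_real (2 * Re (cnj (h x) * H x $ i))" for h :: "real^'a \<Rightarrow> complex" and H x
    by (simp add: complex_eq_iff)
  have "AE x in lborel. G x $ i * cnj (g x) + g x * cnj (G x $ i) = F x $ i * cnj (f x) + f x * cnj (F x $ i)"
  proof (rule AE_eq_of_weakly_eq[OF integrable_locally_integrable[OF int[OF g]] integrable_locally_integrable[OF int[OF f]]])
    fix v :: "real^'a \<Rightarrow> complex" assume v: "v \<in> test_functions"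
    have m: "(\<lambda>x. h x * cnj (h x) * partial_deriv i v x) \<in> borel_measurable lborel" if "H1 h H" for h H
    proof -
      have [measurable]: "h \<in> borel_measurable borel" "(\<lambda>x. cnj (h x)) \<in> borel_measurable borel" "partial_deriv i v \<in> borel_measurable borel"
        using H1_L2(1)[OF that] L2_measurable[of h] L2_measurable[of "\<lambda>x. cnj (h x)"] test_measurable[OF test_partial[OF v]] by simp_all
      show ?thesis by measurable
    qed
    have "(LINT x|lborel. g x * cnj (g x) * partial_deriv i v x) = (LINT x|lborel. f x * cnj (f x) * partial_deriv i v x)"
    proof (rule integral_cong_AE[OF m[OF g] m[OF f]])
      show "AE x in lborel. g x * cnj (g x) * partial_deriv i v x = f x * cnj (f x) * partial_deriv i v x"
        using mass by eventually_elim (simp only: complex_norm_square[symmetric])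
    qed
    then show "(LINT x|lborel. (G x $ i * cnj (g x) + g x * cnj (G x $ i)) * v x)
      = (LINT x|lborel. (F x $ i * cnj (f x) + f x * cnj (F x $ i)) * v x)"
      using H1_product[OF f f v, of i] H1_product[OF g g v, of i] by simp
  qed
  with current show ?thesis
  proof eventually_elim
    case (elim x)
    then have "Re (cnj (g x) * G x $ i) = Re (cnj (f x) * F x $ i)"
      unfolding eq of_real_eq_iff by simp
    with elim(1) show ?case by (rule complex_eqI[rotated])
  qed
qed

text \<open>The quotient rule for \<open>g * cnj f / (|f|^2 + \<epsilon>)\<close>, which is defined
  at the zeros of \<open>f\<close> as well. It holds for test functions;
  \<open>\<epsilon> > 0\<close> keeps all coefficients bounded, so it survives the limit.\<close>

lemma regularized_ratio_weak_derivative: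
  assumes f: "H1 f F" and g: "H1 g G" and v: "v \<in> test_functions" and \<epsilon>: "\<epsilon> > 0"
  defines "r \<equiv> \<lambda>z. complex_of_real (inverse ((cmod z)\<^sup>2 + \<epsilon>))"
  shows "(LINT x|lborel. g x * cnj (f x) * r (f x) * partial_deriv i v x)
    = - (LINT x|lborel. ((G x $ i * cnj (f x) + g x * cnj (F x $ i)) * r (f x)
        - g x * cnj (f x) * r (f x) * r (f x) * (F x $ i * cnj (f x) + f x * cnj (F x $ i))) * v x)"
proof -
  obtain a where a: "\<And>k. a k \<in> test_functions" "L2_tendsto a f"
    "\<And>i. L2_tendsto (\<lambda>k. partial_deriv i (a k)) (\<lambda>x. F x $ i)" and ae: "AE x in lborel. (\<lambda>k. a k x) \<longlonglongrightarrow> f x"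
    using H1_approx[OF f] by blast
  obtain b where b: "\<And>k. b k \<in> test_functions" "L2_tendsto b g"
    "\<And>i. L2_tendsto (\<lambda>k. partial_deriv i (b k)) (\<lambda>x. G x $ i)"
    using g unfolding H1_def by blast
  have pos: "(cmod z)\<^sup>2 + \<epsilon> > 0" for z using \<epsilon> by (simp add: add_nonneg_pos)
  have rc: "isCont r z" for z
    unfolding r_def using pos[of z] by (intro continuous_intros) simp
  have cc: "isCont cnj z" for z by (intro continuous_intros)
  have rnorm: "cmod (r z) = inverse ((cmod z)\<^sup>2 + \<epsilon>)" for z
    using pos[of z] unfolding r_def norm_of_real by simp
  have rb: "cmod (r z) \<le> 1 / \<epsilon>" for z
    unfolding rnorm using \<epsilon> by (simp add: inverse_eq_divide frac_le)
  have rb2: "(cmod z)\<^sup>2 * cmod (r z) \<le> 1" for z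
    unfolding rnorm using pos[of z] \<epsilon> by (simp add: divide_inverse[symmetric] pos_divide_le_eq)
  have rb1: "cmod z * cmod (r z) \<le> 1 + 1 / \<epsilon>" for z
  proof -
    have "2 * cmod z \<le> 1 + (cmod z)\<^sup>2" using sum_squares_bound[of "cmod z" 1] by simp
    then have "cmod z \<le> 1 + (cmod z)\<^sup>2" using norm_ge_zero[of z] by linarith
    then have "cmod z * cmod (r z) \<le> (1 + (cmod z)\<^sup>2) * cmod (r z)" by (intro mult_right_mono) auto
    then show ?thesis using rb[of z] rb2[of z] by (simp add: distrib_right)
  qed
  \<comment> \<open>The coefficients of the gradient of \<open>g\<close>, of \<open>g\<close> times
    the gradient of \<open>f\<close>, and of \<open>g\<close> times its conjugate, after expanding
    the quotient rule.\<close>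
  define c1 where "c1 z = cnj z * r z" for z
  define c2 where "c2 z = - (cnj z * cnj z * r z * r z)" for z
  define c3 where "c3 z = r z - z * cnj z * r z * r z" for z
  have cont: "isCont c1 z" "isCont c2 z" "isCont c3 z" for z
    unfolding c1_def c2_def c3_def by (intro isCont_minus isCont_diff isCont_mult continuous_ident rc cc)+
  have bd: "cmod (c1 z) \<le> 1 + 1 / \<epsilon>" "cmod (c2 z) \<le> 1 / \<epsilon>" "cmod (c3 z) \<le> 2 / \<epsilon>" for z
  proof -
    show "cmod (c1 z) \<le> 1 + 1 / \<epsilon>" using rb1[of z] by (simp add: c1_def norm_mult)
    have "(cmod z)\<^sup>2 * cmod (r z) * cmod (r z) \<le> 1 * (1 / \<epsilon>)" using \<epsilon> by (intro mult_mono rb rb2) auto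
    then have *: "cmod z * cmod z * cmod (r z) * cmod (r z) \<le> 1 / \<epsilon>" by (simp add: power2_eq_square)
    then show "cmod (c2 z) \<le> 1 / \<epsilon>" by (simp add: c2_def norm_mult)
    have "cmod (c3 z) \<le> cmod (r z) + cmod (z * cnj z * r z * r z)"
      unfolding c3_def by (rule norm_triangle_ineq4)
    also have "\<dots> \<le> 1 / \<epsilon> + 1 / \<epsilon>" using rb[of z] * by (simp add: norm_mult)
    finally show "cmod (c3 z) \<le> 2 / \<epsilon>" by simp
  qed
  note fm = L2_measurable[OF H1_L2(1)[OF f]] and am = test_measurable[OF a(1)]
  note lim = continuous_coefficient_tendsto[OF cont(1) bd(1) am fm ae]
    continuous_coefficient_tendsto[OF cont(2) bd(2) am fm ae] continuous_coefficient_tendsto[OF cont(3) bd(3) am fm ae]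
  note vL = L2_tendsto_const[OF test_L2[OF v]] L2_tendsto_const[OF test_L2[OF test_partial[OF v]]]
  have vp: "(\<lambda>x. v x * p x) \<in> L2" if "p \<in> L2" for p
    using L2_tendsto_test_mult[OF v L2_tendsto_const[OF that]] by (simp add: L2_tendsto_def)
  \<comment> \<open>Each integrand is a bounded coefficient times two square-integrable factors; in
    the last two integrals the bounded \<open>v\<close> is attached to \<open>p\<close> to obtain
    this shape.\<close>
  define I where "I h p h' p' = (LINT x|lborel. c1 (h x) * p' x * v x) + ((LINT x|lborel. c2 (h x) * (v x * p x) * h' x)
     + (LINT x|lborel. c3 (h x) * (v x * p x) * cnj (h' x)))" for h p h' p'
  have I_eq: "I h p h' p' = (LINT x|lborel. ((p' x * cnj (h x) + p x * cnj (h' x)) * r (h x)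
        - p x * cnj (h x) * r (h x) * r (h x) * (h' x * cnj (h x) + h x * cnj (h' x))) * v x)"
    if "h \<in> L2" "p \<in> L2" "h' \<in> L2" "p' \<in> L2" for h p h' p'
  proof -
    note hm = L2_measurable[OF that(1)]
    have "I h p h' p' = (LINT x|lborel. c1 (h x) * p' x * v x + (c2 (h x) * (v x * p x) * h' x + c3 (h x) * (v x * p x) * cnj (h' x)))"
      unfolding I_def
      using continuous_coefficient_integrable[OF cont(1) bd(1) hm that(4) test_L2[OF v]]
        continuous_coefficient_integrable[OF cont(2) bd(2) hm vp[OF that(2)] that(3)]
        continuous_coefficient_integrable[OF cont(3) bd(3) hm vp[OF that(2)], of "\<lambda>x. cnj (h' x)"] that(3)
      by simp
    also have "\<dots> = (LINT x|lborel. ((p' x * cnj (h x) + p x * cnj (h' x)) * r (h x)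
        - p x * cnj (h x) * r (h x) * r (h x) * (h' x * cnj (h x) + h x * cnj (h' x))) * v x)"
      by (intro Bochner_Integration.integral_cong refl) (simp add: c1_def c2_def c3_def algebra_simps)
    finally show ?thesis .
  qed
  have step: "(LINT x|lborel. c1 (a k x) * b k x * partial_deriv i v x) = - I (a k) (b k) (partial_deriv i (a k)) (partial_deriv i (b k))" for k
  proof -
    define s where "s x = inverse ((cmod (a k x))\<^sup>2 + \<epsilon>)" for x
    have sp: "smooth (\<lambda>x. (cmod (a k x))\<^sup>2 + \<epsilon>)" by (intro smooth_add smooth_cmod_sq smooth_const test_smooth a)
    have ss: "smooth s" unfolding s_def by (rule smooth_inverse[OF sp]) (use pos less_imp_neq in metis)
    have rs: "r (a k x) = of_real (s x)" for x by (simp add: r_def s_def)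
    have sr: "smooth (\<lambda>x. r (a k x))" unfolding rs by (rule smooth_of_real[OF ss])
    have "partial_deriv i s x = - (s x * s x) * partial_deriv i (\<lambda>x. (cmod (a k x))\<^sup>2) x" for x
    proof -
      have "((\<lambda>y. inverse (y + \<epsilon>)) has_real_derivative - (s x * s x)) (at ((cmod (a k x))\<^sup>2))"
        using pos[of "a k x"] by (auto intro!: derivative_eq_intros simp: s_def power2_eq_square field_simps)
      from partial_deriv_compose_real(1)[OF smooth_differentiable[OF smooth_cmod_sq[OF test_smooth[OF a(1)]]] this]
      show ?thesis by (simp add: s_def[abs_def])
    qed
    moreover have "partial_deriv i (\<lambda>x. complex_of_real (s x)) x = of_real (partial_deriv i s x)" for x
      by (rule partial_deriv_bounded_linear[OF bounded_linear_of_real smooth_differentiable[OF ss]])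
    ultimately have dr: "partial_deriv i (\<lambda>x. r (a k x)) x = - (r (a k x) * r (a k x)) * (partial_deriv i (a k) x * cnj (a k x) + a k x * cnj (partial_deriv i (a k) x))" for x
      unfolding rs by (simp only: of_real_mult of_real_minus partial_deriv_cmod_sq[OF test_smooth[OF a(1)]])
    have sm: "smooth (b k)" "smooth (\<lambda>x. cnj (a k x))" using a b by (auto intro: smooth_cnj test_smooth)
    have sb: "smooth (\<lambda>x. b k x * cnj (a k x))" by (intro smooth_mult smooth_cnj test_smooth a b)
    have db: "partial_deriv i (\<lambda>x. b k x * cnj (a k x)) x = b k x * cnj (partial_deriv i (a k) x) + partial_deriv i (b k) x * cnj (a k x)" for x
      using partial_deriv_mult[OF smooth_differentiable[OF sm(1)] smooth_differentiable[OF sm(2)], of i x]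
      by (simp only: partial_deriv_cnj[OF a(1)])
    have "(LINT x|lborel. b k x * cnj (a k x) * r (a k x) * partial_deriv i v x)
       = - (LINT x|lborel. partial_deriv i (\<lambda>x. b k x * cnj (a k x) * r (a k x)) x * v x)"
      by (rule integral_by_parts[OF smooth_mult[OF sb sr] v])
    also have "(\<lambda>x. partial_deriv i (\<lambda>x. b k x * cnj (a k x) * r (a k x)) x * v x) =
      (\<lambda>x. ((partial_deriv i (b k) x * cnj (a k x) + b k x * cnj (partial_deriv i (a k) x)) * r (a k x)
        - b k x * cnj (a k x) * r (a k x) * r (a k x) * (partial_deriv i (a k) x * cnj (a k x) + a k x * cnj (partial_deriv i (a k) x))) * v x)"
      unfolding partial_deriv_mult[OF smooth_differentiable[OF sb] smooth_differentiable[OF sr]] dr db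
      by (rule ext) (simp add: algebra_simps)
    also have "(LINT x|lborel. \<dots> x) = I (a k) (b k) (partial_deriv i (a k)) (partial_deriv i (b k))"
      by (rule I_eq[symmetric]) (intro test_L2 test_partial a b)+
    finally show ?thesis by (simp add: c1_def mult_ac)
  qed
  have L: "(\<lambda>k. LINT x|lborel. c1 (a k x) * b k x * partial_deriv i v x) \<longlonglongrightarrow> (LINT x|lborel. c1 (f x) * g x * partial_deriv i v x)"
    by (rule lim(1)[OF b(2) vL(2)])
  have "(\<lambda>k. - I (a k) (b k) (partial_deriv i (a k)) (partial_deriv i (b k))) \<longlonglongrightarrow> - I f g (\<lambda>x. F x $ i) (\<lambda>x. G x $ i)"
    unfolding I_def
    by (intro tendsto_minus tendsto_add lim(1)[OF b(3) vL(1)] lim(2)[OF L2_tendsto_test_mult[OF v b(2)] a(3)]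
        lim(3)[OF L2_tendsto_test_mult[OF v b(2)] L2_tendsto_cnj[OF a(3)]])
  then have "(LINT x|lborel. c1 (f x) * g x * partial_deriv i v x) = - I f g (\<lambda>x. F x $ i) (\<lambda>x. G x $ i)"
    using L unfolding step by (rule LIMSEQ_unique[rotated])
  then show ?thesis
    using I_eq[OF H1_L2(1)[OF f] H1_L2(1)[OF g] H1_L2(2)[OF f] H1_L2(2)[OF g], of i i]
    by (simp add: c1_def mult_ac)
qed

text \<open>Equal moduli and equal \<open>cnj f * \<nabla>f\<close> give
  \<open>\<nabla>g = w * \<nabla>f\<close> where \<open>f\<close> is nonzero, with
  \<open>w = g / f\<close>; formally \<open>w\<close> then has gradient 0. The regularised quotient
  rule makes this rigorous: what remains carries a factor
  \<open>\<epsilon> / (|f|^2 + \<epsilon>)^2\<close>, which vanishes in the limit on compact subsets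
  of the component.\<close>

lemma ratio_locally_constant:
  fixes f g :: "real^'n::finite \<Rightarrow> complex"
  assumes f: "H1 f F" and g: "H1 g G" and cont: "continuous_on UNIV f"
    and mass: "AE x in lborel. cmod (g x) = cmod (f x)"
    and current: "\<And>i. AE x in lborel. Im (cnj (g x) * G x $ i) = Im (cnj (f x) * F x $ i)"
    and E: "E \<in> components {x. f x \<noteq> 0}"
  shows "\<exists>c. AE x in lborel. x \<in> E \<longrightarrow> g x = c * f x"
proof -
  have Eo: "open E" by (rule component_superlevel_closed(3)[OF cont E zero_less_one])
  have Ez: "f x \<noteq> 0" if "x \<in> E" for x using that in_components_subset[OF E] by auto
  have [measurable]: "f \<in> borel_measurable borel" "g \<in> borel_measurable borel"
      "(\<lambda>x. cnj (f x)) \<in> borel_measurable borel"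
      "(\<lambda>x. F x $ i) \<in> borel_measurable borel" "(\<lambda>x. cnj (F x $ i)) \<in> borel_measurable borel"
      "(\<lambda>x. G x $ i) \<in> borel_measurable borel" for i
    using L2_measurable[OF H1_L2(1)[OF f]] L2_measurable[OF H1_L2(1)[OF g]]
      L2_measurable[of "\<lambda>x. cnj (f x)"] H1_L2(1)[OF f] L2_measurable[of "\<lambda>x. cnj (F x $ i)"] H1_L2(2)[OF f]
      L2_measurable[OF H1_L2(2)[OF f]] L2_measurable[OF H1_L2(2)[OF g]] by simp_all
  define w where "w x = g x / f x" for x
  have [measurable]: "w \<in> borel_measurable borel" unfolding w_def by measurable
  \<comment> \<open>At zeros of \<open>f\<close> the quotient has the default value 0, so the bound
    holds there as well.\<close>
  have wb: "AE x in lborel. cmod (w x) \<le> 1"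
    using mass by eventually_elim (simp add: w_def norm_divide)
  have "\<exists>c. AE x in lborel. x \<in> E \<longrightarrow> w x = c"
  proof (rule weak_gradient_zero_constant[OF Eo in_components_connected[OF E]])
    show "locally_integrable w" by (rule locally_integrable_bounded[OF _ wb]) measurable
    show "w \<in> borel_measurable lborel" by measurable
    fix v :: "real^'n \<Rightarrow> complex" and i assume v: "v \<in> test_functions" and sv: "closure {x. v x \<noteq> 0} \<subseteq> E"
    define K where "K = closure {x. v x \<noteq> 0}"
    have K: "compact K" using v by (simp add: K_def test_functions_iff)
    have vK: "v x = 0" if "x \<notin> K" for x using that closure_subset[of "{x. v x \<noteq> 0}"] by (auto simp: K_def)
    have dK: "partial_deriv i v x = 0" if "x \<notin> K" for x using that partial_deriv_support[of i v x] by (auto simp: K_def)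
    have KE: "f x \<noteq> 0" if "x \<in> K" for x using that sv Ez by (auto simp: K_def)
    have [measurable]: "v \<in> borel_measurable borel" "partial_deriv i v \<in> borel_measurable borel"
      using test_measurable[OF v] test_measurable[OF test_partial[OF v]] by simp_all
    \<comment> \<open>The support of \<open>v\<close> is a compact subset of the component, on which
      the continuous \<open>f\<close> stays away from 0.\<close>
    obtain M where M: "\<And>x. x \<in> K \<Longrightarrow> inverse ((cmod (f x))\<^sup>2) \<le> M" "M > 0"
    proof -
      have "continuous_on K (\<lambda>x. inverse ((cmod (f x))\<^sup>2))"
        using KE by (intro continuous_intros continuous_on_subset[OF cont]) auto
      then have "bounded ((\<lambda>x. inverse ((cmod (f x))\<^sup>2)) ` K)"
        by (intro compact_imp_bounded compact_continuous_image K)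
      then show thesis using that unfolding bounded_pos by (auto simp: abs_le_iff)
    qed
    define e where "e n = inverse (real (Suc n))" for n
    have e: "e n > 0" "e n \<le> 1" for n by (auto simp: e_def inverse_eq_divide)
    have e0: "e \<longlonglongrightarrow> 0" unfolding e_def by (rule LIMSEQ_inverse_real_of_nat)
    define r where "r n z = complex_of_real (inverse ((cmod z)\<^sup>2 + e n))" for n z
    define S where "S x = F x $ i * cnj (f x) + f x * cnj (F x $ i)" for x
    have [measurable]: "(\<lambda>x. r n (f x)) \<in> borel_measurable borel" "S \<in> borel_measurable borel" for n
      unfolding r_def S_def by measurable
    have rnorm: "cmod (r n z) = inverse ((cmod z)\<^sup>2 + e n)" for n z
      using e(1)[of n] unfolding r_def norm_of_real by (simp add: add_nonneg_pos)
    have rlim: "(\<lambda>n. r n z) \<longlonglongrightarrow> of_real (inverse ((cmod z)\<^sup>2))" if "z \<noteq> 0" for z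
    proof -
      have "(\<lambda>n. inverse ((cmod z)\<^sup>2 + e n)) \<longlonglongrightarrow> inverse ((cmod z)\<^sup>2 + 0)"
        using that by (intro tendsto_intros e0) simp
      then show ?thesis unfolding r_def using tendsto_of_real by fastforce
    qed
    have rM: "cmod (r n (f x)) \<le> M" if "x \<in> K" for n x
    proof -
      have "inverse ((cmod (f x))\<^sup>2 + e n) \<le> inverse ((cmod (f x))\<^sup>2)"
        using KE[OF that] e(1)[of n] by (intro le_imp_inverse_le) auto
      then show ?thesis using M(1)[OF that] unfolding rnorm by linarith
    qed
    have lg: "AE x in lborel. cnj (g x) * G x $ i = cnj (f x) * F x $ i"
      by (rule hydrodynamic_log_gradient[OF f g mass current])
    define J where "J n = (LINT x|lborel. g x * cnj (f x) * r n (f x) * partial_deriv i v x)" for n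
    have Jlim: "J \<longlonglongrightarrow> (LINT x|lborel. w x * partial_deriv i v x)"
      unfolding J_def
    proof (rule integral_dominated_convergence[where w="\<lambda>x. cmod (partial_deriv i v x)"])
      have "integrable lborel (\<lambda>x. 1 * partial_deriv i v x)"
        by (intro locally_integrable_test test_partial v locally_integrable_bounded[of _ 1]) auto
      then show "integrable lborel (\<lambda>x. cmod (partial_deriv i v x))" by simp
      show "AE x in lborel. (\<lambda>n. g x * cnj (f x) * r n (f x) * partial_deriv i v x) \<longlonglongrightarrow> w x * partial_deriv i v x"
      proof (rule AE_I2)
        fix x
        show "(\<lambda>n. g x * cnj (f x) * r n (f x) * partial_deriv i v x) \<longlonglongrightarrow> w x * partial_deriv i v x"
        proof (cases "x \<in> K")
          case True
          have "(\<lambda>n. g x * cnj (f x) * r n (f x) * partial_deriv i v x)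
            \<longlonglongrightarrow> g x * cnj (f x) * of_real (inverse ((cmod (f x))\<^sup>2)) * partial_deriv i v x"
            by (intro tendsto_intros rlim KE True)
          moreover have "g x * cnj (f x) * of_real (inverse ((cmod (f x))\<^sup>2)) = w x"
            using KE[OF True] by (simp only: of_real_inverse complex_norm_square) (simp add: w_def field_simps)
          ultimately show ?thesis by simp
        qed (simp add: dK)
      qed
      show "AE x in lborel. norm (g x * cnj (f x) * r n (f x) * partial_deriv i v x) \<le> cmod (partial_deriv i v x)" for n
        using mass
      proof eventually_elim
        case (elim x)
        have "(cmod (f x))\<^sup>2 * inverse ((cmod (f x))\<^sup>2 + e n) \<le> 1"
          using e(1)[of n] by (simp add: divide_inverse[symmetric] pos_divide_le_eq add_nonneg_pos)
        then have "cmod (f x) * cmod (f x) * cmod (r n (f x)) * cmod (partial_deriv i v x) \<le> 1 * cmod (partial_deriv i v x)"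
          unfolding rnorm by (intro mult_right_mono) (simp_all add: power2_eq_square)
        with elim show ?case by (simp add: norm_mult)
      qed
    qed measurable
    \<comment> \<open>Inserting \<open>g = w * f\<close> and its gradient, the two parts of the
      quotient rule are \<open>w * S * r\<close> and \<open>w * S * |f|^2 * r^2\<close>. As
      \<open>r = (|f|^2 + e n) * r^2\<close>, their difference keeps only the term with
      \<open>e n\<close>.\<close>
    have Jeq: "J n = - (LINT x|lborel. w x * S x * of_real (e n) * r n (f x) * r n (f x) * v x)" for n
    proof -
      have "J n = - (LINT x|lborel. ((G x $ i * cnj (f x) + g x * cnj (F x $ i)) * r n (f x)
        - g x * cnj (f x) * r n (f x) * r n (f x) * (F x $ i * cnj (f x) + f x * cnj (F x $ i))) * v x)"
        unfolding J_def r_def by (rule regularized_ratio_weak_derivative[OF f g v e(1)])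
      also have "(LINT x|lborel. ((G x $ i * cnj (f x) + g x * cnj (F x $ i)) * r n (f x)
        - g x * cnj (f x) * r n (f x) * r n (f x) * (F x $ i * cnj (f x) + f x * cnj (F x $ i))) * v x)
        = (LINT x|lborel. w x * S x * of_real (e n) * r n (f x) * r n (f x) * v x)"
      proof (rule integral_cong_AE)
        show "AE x in lborel. ((G x $ i * cnj (f x) + g x * cnj (F x $ i)) * r n (f x)
          - g x * cnj (f x) * r n (f x) * r n (f x) * (F x $ i * cnj (f x) + f x * cnj (F x $ i))) * v x
          = w x * S x * of_real (e n) * r n (f x) * r n (f x) * v x"
          using mass lg
        proof eventually_elim
          case (elim x)
          show ?case
          proof (cases "x \<in> K")
            case True
            have fz: "f x \<noteq> 0" by (rule KE[OF True])
            then have gz: "g x \<noteq> 0" using elim(1) by auto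
            have gw: "g x = w x * f x" using fz by (simp add: w_def)
            have sq: "g x * cnj (g x) = f x * cnj (f x)"
              using elim(1) by (simp only: complex_norm_square[symmetric])
            \<comment> \<open>Multiply by the density, written as \<open>g * cnj g\<close>, and
              exchange \<open>cnj g * \<nabla>g\<close> for
              \<open>cnj f * \<nabla>f\<close>.\<close>
            have Gw: "G x $ i = w x * F x $ i"
            proof -
              have "(f x * cnj (f x)) * G x $ i = g x * (cnj (f x) * F x $ i)"
                unfolding elim(2)[symmetric] sq[symmetric] by (simp add: mult_ac)
              then show ?thesis using fz by (simp add: w_def field_simps)
            qed
            have rr: "r n (f x) = (f x * cnj (f x) + of_real (e n)) * r n (f x) * r n (f x)"
            proof -
              have "(cmod (f x))\<^sup>2 + e n \<noteq> 0" using e(1)[of n] by (simp add: add_nonneg_pos less_imp_neq[symmetric])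
              then have "(of_real ((cmod (f x))\<^sup>2) + of_real (e n)) * r n (f x) = 1"
                unfolding r_def of_real_add[symmetric] of_real_mult[symmetric] by (metis of_real_1 right_inverse)
              then show ?thesis by (simp only: complex_norm_square) simp
            qed
            have "(G x $ i * cnj (f x) + g x * cnj (F x $ i)) * r n (f x) = w x * S x * ((f x * cnj (f x) + of_real (e n)) * r n (f x) * r n (f x))"
              unfolding rr[symmetric] by (simp add: Gw gw S_def algebra_simps)
            then show ?thesis by (simp add: gw S_def algebra_simps)
          qed (simp add: vK)
        qed
      qed measurable
      finally show ?thesis .
    qed
    have lim: "(\<lambda>n. LINT x|lborel. w x * S x * of_real (e n) * r n (f x) * r n (f x) * v x) \<longlonglongrightarrow> integral\<^sup>L lborel (\<lambda>x::real^'n. 0)"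
    proof (rule integral_dominated_convergence[where w="\<lambda>x. M * M * cmod (S x * v x)"])
      have "integrable lborel (\<lambda>x. S x)"
        unfolding S_def using H1_L2[OF f] by (intro Bochner_Integration.integrable_add L2_inner_integrable) auto
      then have "integrable lborel (\<lambda>x. S x * v x)"
        by (intro locally_integrable_test v integrable_locally_integrable)
      then show "integrable lborel (\<lambda>x. M * M * cmod (S x * v x))" by (intro integrable_mult_right integrable_norm)
      show "AE x in lborel. (\<lambda>n. w x * S x * of_real (e n) * r n (f x) * r n (f x) * v x) \<longlonglongrightarrow> 0"
      proof (rule AE_I2)
        fix x
        show "(\<lambda>n. w x * S x * of_real (e n) * r n (f x) * r n (f x) * v x) \<longlonglongrightarrow> 0"
        proof (cases "x \<in> K")
          case True
          have "(\<lambda>n. w x * S x * of_real (e n) * r n (f x) * r n (f x) * v x)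
            \<longlonglongrightarrow> w x * S x * of_real 0 * of_real (inverse ((cmod (f x))\<^sup>2)) * of_real (inverse ((cmod (f x))\<^sup>2)) * v x"
            by (intro tendsto_intros rlim KE True e0)
          then show ?thesis by simp
        qed (simp add: vK)
      qed
      show "AE x in lborel. norm (w x * S x * of_real (e n) * r n (f x) * r n (f x) * v x) \<le> M * M * cmod (S x * v x)" for n
        using wb
      proof eventually_elim
        case (elim x)
        show ?case
        proof (cases "x \<in> K")
          case True
          have "cmod (w x) * e n * (cmod (r n (f x)) * cmod (r n (f x))) \<le> (1 * 1) * (M * M)"
            using elim e[of n] rM[OF True, of n] M(2) by (intro mult_mono) auto
          then have "cmod (w x) * e n * (cmod (r n (f x)) * cmod (r n (f x))) * cmod (S x * v x) \<le> M * M * cmod (S x * v x)"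
            by (intro mult_right_mono) auto
          then show ?thesis using e(1)[of n] by (simp add: norm_mult mult_ac)
        qed (simp add: vK)
      qed
    qed measurable
    have "J = (\<lambda>n. - (LINT x|lborel. w x * S x * of_real (e n) * r n (f x) * r n (f x) * v x))"
      by (rule ext) (rule Jeq)
    then have "J \<longlonglongrightarrow> 0" using tendsto_minus[OF lim] by simp
    with Jlim show "(LINT x|lborel. w x * partial_deriv i v x) = 0" by (rule LIMSEQ_unique)
  qed
  then obtain c where "AE x in lborel. x \<in> E \<longrightarrow> w x = c" by blast
  then have "AE x in lborel. x \<in> E \<longrightarrow> g x = c * f x"
    by eventually_elim (use Ez in \<open>auto simp: w_def field_simps\<close>)
  then show ?thesis by blast
qed

section \<open>Non-uniqueness\<close>

text \<open>A homogeneous system with more unknowns than equations has a nontrivial solution. The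
  induction eliminates one unknown \<open>s0\<close> by means of the equation
  \<open>j\<close>.\<close>

lemma exists_linear_dependence:
  fixes b :: "'s \<Rightarrow> 'j \<Rightarrow> 'a::field"
  assumes "finite J" "finite S" "card J < card S"
  shows "\<exists>l. (\<exists>s\<in>S. l s \<noteq> 0) \<and> (\<forall>j\<in>J. (\<Sum>s\<in>S. l s * b s j) = 0)"
  using assms
proof (induction J arbitrary: S b rule: finite_induct)
  case empty
  then have "S \<noteq> {}" by auto
  then show ?case by (intro exI[of _ "\<lambda>_. 1"]) auto
next
  case (insert j J)
  show ?case
  proof (cases "\<forall>s\<in>S. b s j = 0")
    case True
    obtain l where "\<exists>s\<in>S. l s \<noteq> 0" "\<forall>j\<in>J. (\<Sum>s\<in>S. l s * b s j) = 0"
      using insert.IH[of S b] insert.prems insert.hyps by auto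
    with True show ?thesis by (intro exI[of _ l]) simp
  next
    case False
    then obtain s0 where s0: "s0 \<in> S" "b s0 j \<noteq> 0" by blast
    define S' where "S' = S - {s0}"
    have S: "S = insert s0 S'" "s0 \<notin> S'" "finite S'" using s0(1) insert.prems by (auto simp: S'_def)
    then have "card J < card S'" using insert by simp
    then obtain l where l: "\<exists>s\<in>S'. l s \<noteq> 0"
      "\<And>k. k \<in> J \<Longrightarrow> (\<Sum>s\<in>S'. l s * (b s k - b s j / b s0 j * b s0 k)) = 0"
      using insert.IH[of S' "\<lambda>s k. b s k - b s j / b s0 j * b s0 k"] S(3) by blast
    \<comment> \<open>The value at \<open>s0\<close> that solves equation \<open>j\<close>; the
      modified coefficients make it fit the remaining equations too.\<close>
    define t where "t = - (\<Sum>s\<in>S'. l s * b s j) / b s0 j"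
    define l' where "l' = l(s0 := t)"
    have sum: "(\<Sum>s\<in>S. l' s * b s k) = t * b s0 k + (\<Sum>s\<in>S'. l s * b s k)" for k
    proof -
      have "(\<Sum>s\<in>S'. l' s * b s k) = (\<Sum>s\<in>S'. l s * b s k)"
        using S(2) by (intro sum.cong) (auto simp: l'_def)
      then show ?thesis using S by (simp add: l'_def)
    qed
    have "(\<Sum>s\<in>S. l' s * b s k) = 0" if "k \<in> insert j J" for k
    proof (cases "k = j")
      case True then show ?thesis using s0(2) by (simp add: sum t_def)
    next
      case False
      then have "k \<in> J" using that by simp
      from l(2)[OF this] have "(\<Sum>s\<in>S'. l s * b s k) = (\<Sum>s\<in>S'. l s * b s j) / b s0 j * b s0 k"
        by (simp add: right_diff_distrib sum_subtractf sum_divide_distrib sum_distrib_right mult.assoc)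
      then show ?thesis by (simp add: sum t_def)
    qed
    moreover have "\<exists>s\<in>S. l' s \<noteq> 0" using l(1) S by (auto simp: l'_def)
    ultimately show ?thesis by blast
  qed
qed

lemma unitary_group_sum:
  assumes U: "unitary_group U" and "finite S" and p: "\<And>s. s \<in> S \<Longrightarrow> p s \<in> L2"
  shows "AE x in lborel. U t (\<lambda>x. \<Sum>s\<in>S. l s * p s x) x = (\<Sum>s\<in>S. l s * U t (p s) x)"
  using assms(2) p
proof (induction S)
  case empty
  show ?case using unitary_group_lincomb[OF U L2_zero L2_zero, of t 0 0] by simp
next
  case (insert s S)
  have "AE x in lborel. U t (\<lambda>x. l s * p s x + 1 * (\<Sum>s\<in>S. l s * p s x)) x
      = l s * U t (p s) x + 1 * U t (\<lambda>x. \<Sum>s\<in>S. l s * p s x) x"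
    using insert by (intro unitary_group_lincomb[OF U] L2_sum L2_cmult) auto
  moreover have "AE x in lborel. U t (\<lambda>x. \<Sum>s\<in>S. l s * p s x) x = (\<Sum>s\<in>S. l s * U t (p s) x)"
    using insert by auto
  ultimately show ?case by eventually_elim (use insert in simp)
qed

lemma weak_gradient_AE:
  assumes "has_weak_gradient f G" shows "AE x in lborel. weak_gradient f x = G x"
  unfolding weak_gradient_def
  by (rule has_weak_gradient_unique[OF someI[of "has_weak_gradient f" G] assms]) (rule assms)

lemma has_weak_gradient_lincomb:
  fixes f g :: "real^'n::finite \<Rightarrow> complex"
  assumes f: "has_weak_gradient f F" and g: "has_weak_gradient g G"
  shows "has_weak_gradient (\<lambda>x. f x - c * g x) (\<lambda>x. \<chi> i. F x $ i - c * G x $ i)"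
proof -
  have li: "locally_integrable (\<lambda>x. c * h x)" if "locally_integrable h" for h :: "real^'n \<Rightarrow> complex"
    using that by (simp add: locally_integrable_def)
  have lf: "locally_integrable f" "\<And>i. locally_integrable (\<lambda>x. F x $ i)"
    and lg: "locally_integrable g" "\<And>i. locally_integrable (\<lambda>x. G x $ i)"
    using f g by (auto simp: has_weak_gradient_def)
  have "(LINT x|lborel. (f x - c * g x) * partial_deriv i v x) = - (LINT x|lborel. (F x $ i - c * G x $ i) * v x)"
    if v: "v \<in> test_functions" for v i
  proof -
    have sub: "(LINT x|lborel. (p x - c * q x) * u x) = (LINT x|lborel. p x * u x) - c * (LINT x|lborel. q x * u x)"
      if "locally_integrable p" "locally_integrable q" "u \<in> test_functions" for p q u :: "real^'n \<Rightarrow> complex"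
      using locally_integrable_test[OF that(1,3)] locally_integrable_test[OF that(2,3)]
      by (simp add: left_diff_distrib mult.assoc)
    have "(LINT x|lborel. f x * partial_deriv i v x) = - (LINT x|lborel. F x $ i * v x)"
      "(LINT x|lborel. g x * partial_deriv i v x) = - (LINT x|lborel. G x $ i * v x)"
      using f g v by (auto simp: has_weak_gradient_def)
    then show ?thesis
      by (simp add: sub[OF lf(1) lg(1) test_partial[OF v]] sub[OF lf(2) lg(2) v])
  qed
  then show ?thesis
    using lf lg by (simp add: has_weak_gradient_def locally_integrable_diff li)
qed

theorem proposition2:
  fixes V :: "real^'n::finite \<Rightarrow> real"
    and T :: real
    and \<psi> :: "real \<Rightarrow> real^'n \<Rightarrow> complex"
  assumes "C11_loc V"
    and "bdd_below (range V)"
    and "essentially_self_adjoint (hamiltonian V)"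
    and "T > 0"
    and "bounded_energy_solution V T \<psi>"
    and "continuous_on UNIV (\<psi> 0)"
    and "continuous_on UNIV (\<psi> T)"
    and "num_components {x. mass_density (\<psi> T) x \<noteq> 0} < num_components {x. mass_density (\<psi> 0) x \<noteq> 0}"
    and "\<forall>C \<in> components {x. mass_density (\<psi> 0) x \<noteq> 0}. locally_finite_perimeter C"
  shows "\<exists>\<phi>. bounded_energy_solution V T \<phi> \<and>
    (AE x in lborel. mass_density (\<phi> 0) x = mass_density (\<psi> 0) x) \<and>
    (AE x in lborel. current_density (\<phi> 0) x = current_density (\<psi> 0) x) \<and>
    (\<exists>t\<in>{0..T}. \<not> (AE x in lborel.
        mass_density (\<phi> t) x = mass_density (\<psi> t) x \<and>
        current_density (\<phi> t) x = current_density (\<psi> t) x))"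
proof (rule ccontr)
  assume unique: "\<not> ?thesis"
  define f where "f = \<psi> 0"
  define g where "g = \<psi> T"
  have f_cont: "continuous_on UNIV f" and g_cont: "continuous_on UNIV g"
    using assms(6,7) by (simp_all add: f_def g_def)
  have D: "{x. mass_density (\<psi> 0) x \<noteq> 0} = {x. f x \<noteq> 0}" "{x. mass_density (\<psi> T) x \<noteq> 0} = {x. g x \<noteq> 0}"
    by (simp_all add: mass_density_def f_def g_def)
  obtain U where fin: "finite_energy V f" and U: "unitary_group U" and gen: "generated_by U (op_closure (hamiltonian V))"
    and sol: "\<And>t. t \<in> {0..T} \<Longrightarrow> \<psi> t \<in> L2 \<and> (AE x in lborel. \<psi> t x = U t f x)"
    using assms(5) unfolding bounded_energy_solution_def f_def by blast
  have fL: "f \<in> L2" using fin by (simp add: finite_energy_def)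
  have gL: "g \<in> L2" and gU: "AE x in lborel. g x = U T f x" using sol[of T] assms(4) by (auto simp: g_def)
  note evol = evolution_H1[OF assms(1-3) U gen]
  have U0: "AE x in lborel. U 0 h x = h x" if "h \<in> L2" for h using U that by (simp add: unitary_group_def)
  \<comment> \<open>Time 0 is treated as an evolution as well: \<open>U 0 f\<close> agrees with
    \<open>f\<close> almost everywhere, so \<open>f\<close> inherits its approximation by test
    functions.\<close>
  obtain F where F: "H1 f F" using evol[OF fin, of 0] H1_AE_cong[OF _ L2_measurable[OF fL] U0[OF fL]] by blast
  obtain G where G: "H1 g G"
  proof -
    obtain G where "H1 (U T f) G" using evol[OF fin, of T] by blast
    moreover have "AE x in lborel. U T f x = g x" using gU by eventually_elim simp
    ultimately show thesis using H1_AE_cong[OF _ L2_measurable[OF gL]] that by blast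
  qed
  define J where "J = components {x. g x \<noteq> 0}"
  \<comment> \<open>A strict inequality between extended naturals excludes infinity on the smaller
    side.\<close>
  have J: "finite J" using assms(8) by (auto simp: num_components_def D J_def split: if_splits)
  \<comment> \<open>The support of the datum may have infinitely many components; finitely many, but
    more than those at time \<open>T\<close>, suffice.\<close>
  obtain S where S: "S \<subseteq> components {x. f x \<noteq> 0}" "finite S" "card J < card S"
  proof (cases "finite (components {x. f x \<noteq> 0})")
    case True
    then have "card J < card (components {x. f x \<noteq> 0})"
      using assms(8) J by (simp add: num_components_def D J_def)
    with True show thesis by (intro that[of "components {x. f x \<noteq> 0}"]) auto
  next
    case False
    then obtain S where "finite S" "card S = Suc (card J)" "S \<subseteq> components {x. f x \<noteq> 0}"
      using infinite_arbitrarily_large by blast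
    then show thesis by (intro that[of S]) auto
  qed
  define p where "p C x = indicator C x * f x" for C x
  have p_L2: "p C \<in> L2" if "C \<in> S" for C
    using component_weak_gradient(2)[OF F f_cont] S(1) that unfolding p_def[abs_def] by blast
  \<comment> \<open>The second clause covers the zero set of \<open>g\<close>, which the components
    in \<open>J\<close> leave out and which may have positive measure.\<close>
  have "\<exists>b. (\<forall>E\<in>J. AE x in lborel. x \<in> E \<longrightarrow> U T (p C) x = b E * g x) \<and>
      (AE x in lborel. g x = 0 \<longrightarrow> U T (p C) x = 0)"
    if C: "C \<in> S" for C
  proof -
    \<comment> \<open>Equal to \<open>- f\<close> on \<open>C\<close> and to \<open>f\<close>
      elsewhere, but written linearly so that the evolution of \<open>p C\<close> can be recovered
      from that of \<open>h\<close>.\<close>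
    define h where "h x = f x - 2 * p C x" for x
    \<comment> \<open>At time 0 the value is \<open>h\<close> itself and not the representative
      \<open>U 0 h\<close>, so that density and current there are computed for \<open>h\<close>
      directly.\<close>
    define \<phi> where "\<phi> t = (if t = 0 then h else U t h)" for t
    have CC: "C \<in> components {x. f x \<noteq> 0}" using C S(1) by blast
    note cwg = component_weak_gradient[OF F f_cont CC]
    define H where "H x = (\<chi> i. F x $ i - 2 * (\<chi> i. indicator C x * F x $ i) $ i)" for x
    have hH: "has_weak_gradient h H"
      unfolding h_def p_def H_def by (rule has_weak_gradient_lincomb[OF H1_has_weak_gradient[OF F] cwg(1)])
    have h_sign: "h x = (1 - 2 * indicator C x) * f x" "H x $ i = (1 - 2 * indicator C x) * F x $ i" for x i
      by (simp_all add: h_def p_def H_def algebra_simps)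
    have sign: "cmod (1 - 2 * indicator C x) = 1" "cnj (1 - 2 * indicator C x) * (1 - 2 * indicator C x) = 1" for x
      by (simp_all add: indicator_def)
    have h_mod: "cmod (h x) = cmod (f x)" for x unfolding h_sign norm_mult sign by simp
    have hL: "h \<in> L2" unfolding h_def by (intro L2_diff L2_cmult p_L2 C fL)
    have HL: "(\<lambda>x. H x $ i) \<in> L2" for i
      unfolding H_def using L2_diff[OF H1_L2(2)[OF F] L2_cmult[OF cwg(3)], of i 2 i] by simp
    have h_fin: "finite_energy V h"
      using fin hL hH HL unfolding finite_energy_def h_mod by blast
    have "bounded_energy_solution V T \<phi>"
      unfolding bounded_energy_solution_def
    proof (intro conjI exI[of _ U] ballI U gen)
      show "finite_energy V (\<phi> 0)" using h_fin by (simp add: \<phi>_def)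
      fix t
      show "\<phi> t \<in> L2" using hL unitary_group_L2[OF U hL] by (simp add: \<phi>_def)
      show "AE x in lborel. \<phi> t x = U t (\<phi> 0) x"
      proof (cases "t = 0")
        case True
        then show ?thesis using U0[OF hL] by (auto simp: \<phi>_def)
      qed (simp add: \<phi>_def)
    qed
    moreover have "AE x in lborel. mass_density (\<phi> 0) x = mass_density (\<psi> 0) x"
      by (simp add: mass_density_def \<phi>_def h_mod f_def)
    moreover have "AE x in lborel. current_density (\<phi> 0) x = current_density (\<psi> 0) x"
      using weak_gradient_AE[OF hH] weak_gradient_AE[OF H1_has_weak_gradient[OF F]]
    proof eventually_elim
      case (elim x)
      \<comment> \<open>The sign is real with square 1 and also multiplies the gradient, hence it
        cancels.\<close>
      have "cnj (h x) * H x $ i = (cnj (1 - 2 * indicator C x) * (1 - 2 * indicator C x)) * (cnj (f x) * F x $ i)" for i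
        unfolding h_sign complex_cnj_mult by (simp only: mult_ac)
      then have "cnj (h x) * H x $ i = cnj (f x) * F x $ i" for i unfolding sign by simp
      then show ?case by (simp add: current_density_def \<phi>_def elim f_def[symmetric])
    qed
    ultimately have "AE x in lborel. mass_density (\<phi> T) x = mass_density (\<psi> T) x \<and> current_density (\<phi> T) x = current_density (\<psi> T) x"
      using unique assms(4) by (meson atLeastAtMost_iff less_imp_le order_refl)
    moreover have "\<phi> T = U T h" using assms(4) by (simp add: \<phi>_def)
    ultimately have eq: "AE x in lborel. mass_density (U T h) x = mass_density g x \<and> current_density (U T h) x = current_density g x"
      by (simp add: g_def)
    obtain K where K: "H1 (U T h) K" using evol[OF h_fin] by blast
    have mass: "AE x in lborel. cmod (U T h x) = cmod (g x)"
      using eq by eventually_elim (simp add: mass_density_def)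
    have current: "AE x in lborel. Im (cnj (U T h x) * K x $ i) = Im (cnj (g x) * G x $ i)" for i
      using eq weak_gradient_AE[OF H1_has_weak_gradient[OF K]] weak_gradient_AE[OF H1_has_weak_gradient[OF G]]
    proof eventually_elim
      case (elim x)
      from elim(1) have "current_density (U T h) x $ i = current_density g x $ i" by simp
      then show ?case by (simp add: current_density_def elim(2,3))
    qed
    have "\<forall>E\<in>J. \<exists>c. AE x in lborel. x \<in> E \<longrightarrow> U T h x = c * g x"
      unfolding J_def using ratio_locally_constant[OF G K g_cont mass current] by blast
    then obtain c where c: "\<And>E. E \<in> J \<Longrightarrow> AE x in lborel. x \<in> E \<longrightarrow> U T h x = c E * g x" by metis
    have "AE x in lborel. U T h x = 1 * U T f x + (-2) * U T (p C) x"
      using unitary_group_lincomb[OF U fL p_L2[OF C], of T 1 "-2"] by (simp add: h_def[abs_def])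
    \<comment> \<open>Solving \<open>U T h = U T f - 2 * U T (p C)\<close> for the evolved piece,
      with \<open>g\<close> in place of \<open>U T f\<close>.\<close>
    with gU have Up: "AE x in lborel. U T (p C) x = (g x - U T h x) / 2"
      by eventually_elim simp
    have "AE x in lborel. x \<in> E \<longrightarrow> U T (p C) x = (1 - c E) / 2 * g x" if "E \<in> J" for E
      using Up c[OF that] by eventually_elim (simp add: left_diff_distrib diff_divide_distrib)
    moreover have "AE x in lborel. g x = 0 \<longrightarrow> U T (p C) x = 0"
      using Up mass by eventually_elim auto
    ultimately show ?thesis by (intro exI[of _ "\<lambda>E. (1 - c E) / 2"]) simp
  qed
  then have "\<forall>C\<in>S. \<exists>b. (\<forall>E\<in>J. AE x in lborel. x \<in> E \<longrightarrow> U T (p C) x = b E * g x) \<and>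
      (AE x in lborel. g x = 0 \<longrightarrow> U T (p C) x = 0)" by (rule ballI)
  from bchoice[OF this] obtain b where b: "\<forall>C\<in>S. (\<forall>E\<in>J. AE x in lborel. x \<in> E \<longrightarrow> U T (p C) x = b C E * g x) \<and>
      (AE x in lborel. g x = 0 \<longrightarrow> U T (p C) x = 0)" ..
  \<comment> \<open>One equation per component at time \<open>T\<close>, one unknown per chosen
    component at time 0.\<close>
  obtain l C0 where l: "C0 \<in> S" "l C0 \<noteq> 0" "\<And>E. E \<in> J \<Longrightarrow> (\<Sum>C\<in>S. l C * b C E) = 0"
    using exists_linear_dependence[OF J S(2,3), of b] by blast
  define P where "P x = (\<Sum>C\<in>S. l C * p C x)" for x
  have PL: "P \<in> L2" unfolding P_def by (intro L2_sum L2_cmult p_L2)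
  \<comment> \<open>Finiteness of \<open>S\<close> and \<open>J\<close> allows the exceptional null
    sets to be united before a point is fixed.\<close>
  have "AE x in lborel. \<forall>C\<in>S. \<forall>E\<in>J. x \<in> E \<longrightarrow> U T (p C) x = b C E * g x"
    using b S(2) J by (simp add: AE_ball_countable countable_finite)
  moreover have "AE x in lborel. \<forall>C\<in>S. g x = 0 \<longrightarrow> U T (p C) x = 0"
    using b S(2) by (subst AE_ball_countable) (auto simp: countable_finite)
  moreover have "AE x in lborel. U T P x = (\<Sum>C\<in>S. l C * U T (p C) x)"
    unfolding P_def by (rule unitary_group_sum[OF U S(2) p_L2])
  ultimately have "AE x in lborel. U T P x = 0"
  proof eventually_elim
    case (elim x)
    show ?case
    proof (cases "g x = 0")
      case True
      with elim(2,3) show ?thesis by simp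
    next
      case False
      then obtain E where E: "E \<in> J" "x \<in> E" unfolding J_def using Union_components[of "{x. g x \<noteq> 0}"] by blast
      then have "U T P x = (\<Sum>C\<in>S. l C * b C E * g x)" using elim(1,3) by (simp add: mult.assoc)
      also have "\<dots> = (\<Sum>C\<in>S. l C * b C E) * g x" by (simp add: sum_distrib_right)
      finally show ?thesis using l(3)[OF E(1)] by simp
    qed
  qed
  then have "L2_norm (U T P) = L2_norm (\<lambda>x::real^'n. 0)"
    by (intro L2_norm_AE_cong L2_measurable unitary_group_L2[OF U PL] L2_zero)
  then have "L2_norm P = 0" using unitary_group_norm[OF U PL, of T] by (simp add: L2_norm_def)
  then have "AE x in lborel. P x = 0" by (rule L2_norm_zero_AE[OF PL])
  \<comment> \<open>\<open>P\<close> vanishes only almost everywhere; as \<open>C0\<close> is open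
    and nonempty, it contains a point where \<open>P\<close> vanishes.\<close>
  then have P0: "AE x in lborel. x \<in> C0 \<longrightarrow> P x = 0" by eventually_elim simp
  have C0: "C0 \<in> components {x. f x \<noteq> 0}" using l(1) S(1) by blast
  obtain x where x: "x \<in> C0" "P x = 0"
    using AE_open_nonempty[OF component_superlevel_closed(3)[OF f_cont C0 zero_less_one]
        in_components_nonempty[OF C0] P0] by blast
  \<comment> \<open>Components are disjoint, so at a point of \<open>C0\<close> the sum reduces to
    its term for \<open>C0\<close>, which is not 0.\<close>
  have "p C x = 0" if "C \<in> S" "C \<noteq> C0" for C
  proof -
    have "C \<inter> C0 = {}" using components_nonoverlap[of C "{x. f x \<noteq> 0}" C0] C0 S(1) that by blast
    then show ?thesis using x(1) by (auto simp: p_def indicator_def)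
  qed
  then have "P x = l C0 * p C0 x"
    unfolding P_def using S(2) l(1) by (subst sum.remove[of _ C0]) auto
  moreover have "p C0 x \<noteq> 0" using x(1) in_components_subset[OF C0] by (auto simp: p_def)
  ultimately show False using l(2) x(2) by simp
qed

end
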